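(* Let $p$ be a fixed prime. For a positive integer $n$, the number of isomorphism classes of commutative rings of cardinality $p^{n}$ is $p^{\delta}$, where $\delta=\delta(n)$ satisfies $\delta = \frac{2}{27}n^{3} + O(n^{5/2})$.
   Context: Rings are associative but are not assumed to have a multiplicative identity. The prime $p$ is fixed and $n$ varies; $g(n)=O(h(n))$ means $|g(n)|\le C\,h(n)$ for all $n\ge 1$ for some constant $C$ not depending on $n$ ($C$ may depend on $p$). *)

theory Defs
  imports Complex_Main "HOL-Computational_Algebra.Primes" "HOL-Algebra.Ring"
begin

text \<open>
  Associative rings without the assumption of an identity. The record type \<open>'a ring\<close> of
  HOL-Algebra is reused, but its field \<open>one\<close> carries no meaning here: no axiom below mentions it,
  and the isomorphisms below ignore it.
\<close>

locale rng = abelian_group R for R (structure) +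
  assumes m_closed: "\<lbrakk> x \<in> carrier R; y \<in> carrier R \<rbrakk> \<Longrightarrow> x \<otimes> y \<in> carrier R"
    and m_assoc: "\<lbrakk> x \<in> carrier R; y \<in> carrier R; z \<in> carrier R \<rbrakk>
      \<Longrightarrow> (x \<otimes> y) \<otimes> z = x \<otimes> (y \<otimes> z)"
    and l_distr: "\<lbrakk> x \<in> carrier R; y \<in> carrier R; z \<in> carrier R \<rbrakk>
      \<Longrightarrow> (x \<oplus> y) \<otimes> z = x \<otimes> z \<oplus> y \<otimes> z"
    and r_distr: "\<lbrakk> x \<in> carrier R; y \<in> carrier R; z \<in> carrier R \<rbrakk>
      \<Longrightarrow> z \<otimes> (x \<oplus> y) = z \<otimes> x \<oplus> z \<otimes> y"

locale comm_rng = rng +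
  assumes m_comm: "\<lbrakk> x \<in> carrier R; y \<in> carrier R \<rbrakk> \<Longrightarrow> x \<otimes> y = y \<otimes> x"

text \<open>
  The library's \<open>ring_iso\<close> additionally requires the field \<open>one\<close> to be preserved, so it is not
  usable here. The set \<open>iso R S\<close> consists of the bijections preserving multiplication.
\<close>

definition rng_iso :: "('a, 'm) ring_scheme \<Rightarrow> ('b, 'n) ring_scheme \<Rightarrow> ('a \<Rightarrow> 'b) set"
  where "rng_iso R S = iso R S \<inter> iso (add_monoid R) (add_monoid S)"

text \<open>
  Isomorphism classes of commutative rings of finite cardinality \<open>N > 0\<close> are formed among the rings
  whose carrier is a set of natural numbers; by \<open>comm_rng_nat_representative\<close> below, every
  commutative ring of cardinality \<open>N\<close>, over any type, is isomorphic to one of these.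
\<close>

definition comm_rngs_of_card :: "nat \<Rightarrow> nat ring set"
  where "comm_rngs_of_card N = {R. comm_rng R \<and> finite (carrier R) \<and> card (carrier R) = N}"

definition comm_rng_iso_rel :: "nat \<Rightarrow> nat ring rel"
  where "comm_rng_iso_rel N =
    {(R, S). R \<in> comm_rngs_of_card N \<and> S \<in> comm_rngs_of_card N \<and> rng_iso R S \<noteq> {}}"

definition num_comm_rngs :: "nat \<Rightarrow> nat"
  where "num_comm_rngs N = card (comm_rngs_of_card N // comm_rng_iso_rel N)"

lemma rng_iso_iff:
  "h \<in> rng_iso R S \<longleftrightarrow> bij_betw h (carrier R) (carrier S) \<and>
     (\<forall>x\<in>carrier R. \<forall>y\<in>carrier R. h (x \<otimes>\<^bsub>R\<^esub> y) = h x \<otimes>\<^bsub>S\<^esub> h y) \<and>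
     (\<forall>x\<in>carrier R. \<forall>y\<in>carrier R. h (x \<oplus>\<^bsub>R\<^esub> y) = h x \<oplus>\<^bsub>S\<^esub> h y)"
  by (auto simp: rng_iso_def iso_def hom_def bij_betw_def)

lemma rng_iso_sym:
  assumes "rng R" and h: "h \<in> rng_iso R S"
  shows "inv_into (carrier R) h \<in> rng_iso S R"
proof -
  interpret rng R by fact
  let ?g = "inv_into (carrier R) h"
  have b: "bij_betw h (carrier R) (carrier S)"
    and m: "\<And>x y. x \<in> carrier R \<Longrightarrow> y \<in> carrier R \<Longrightarrow> h (x \<otimes>\<^bsub>R\<^esub> y) = h x \<otimes>\<^bsub>S\<^esub> h y"
    and a: "\<And>x y. x \<in> carrier R \<Longrightarrow> y \<in> carrier R \<Longrightarrow> h (x \<oplus>\<^bsub>R\<^esub> y) = h x \<oplus>\<^bsub>S\<^esub> h y"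
    using h by (auto simp: rng_iso_iff)
  have gh: "?g (h x) = x" if "x \<in> carrier R" for x
    using that b by (simp add: bij_betw_def)
  have S: "carrier S = h ` carrier R"
    using b by (simp add: bij_betw_def)
  show ?thesis
    unfolding rng_iso_iff
  proof (intro conjI ballI)
    show "bij_betw ?g (carrier S) (carrier R)"
      using b by (rule bij_betw_inv_into)
  next
    fix x y assume "x \<in> carrier S" "y \<in> carrier S"
    then obtain u v where "u \<in> carrier R" "v \<in> carrier R" "x = h u" "y = h v"
      unfolding S by auto
    then show "?g (x \<otimes>\<^bsub>S\<^esub> y) = ?g x \<otimes>\<^bsub>R\<^esub> ?g y" "?g (x \<oplus>\<^bsub>S\<^esub> y) = ?g x \<oplus>\<^bsub>R\<^esub> ?g y"
      by (simp_all add: gh m_closed flip: m a)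
  qed
qed

lemma rng_iso_trans:
  assumes "h \<in> rng_iso R S" "k \<in> rng_iso S T"
  shows "k \<circ> h \<in> rng_iso R T"
  using assms by (auto simp: rng_iso_iff bij_betw_apply intro: bij_betw_trans)

lemma equiv_comm_rng_iso_rel: "equiv (comm_rngs_of_card N) (comm_rng_iso_rel N)"
proof (rule equivI)
  show "comm_rng_iso_rel N \<subseteq> comm_rngs_of_card N \<times> comm_rngs_of_card N"
    by (auto simp: comm_rng_iso_rel_def)
  have "id \<in> rng_iso R R" for R :: "nat ring"
    by (simp add: rng_iso_iff)
  then show "refl_on (comm_rngs_of_card N) (comm_rng_iso_rel N)"
    by (force simp: refl_on_def comm_rng_iso_rel_def)
  show "sym (comm_rng_iso_rel N)"
    using rng_iso_sym
    by (fastforce simp: sym_def comm_rng_iso_rel_def comm_rngs_of_card_def comm_rng_def)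
  show "trans (comm_rng_iso_rel N)"
    using rng_iso_trans by (fastforce simp: trans_def comm_rng_iso_rel_def)
qed

lemma comm_rng_nat_representative:
  fixes R :: "('a, 'm) ring_scheme"
  assumes "comm_rng R" and fin: "finite (carrier R)"
  shows "\<exists>S \<in> comm_rngs_of_card (card (carrier R)). rng_iso R S \<noteq> {}"
proof -
  interpret comm_rng R by fact
  obtain h where h: "bij_betw h (carrier R) {0..<card (carrier R)}"
    using ex_bij_betw_finite_nat[OF fin] by blast
  define g where "g = inv_into (carrier R) h"
  define S :: "nat ring" where
    "S = \<lparr> carrier = h ` carrier R, mult = (\<lambda>x y. h (g x \<otimes>\<^bsub>R\<^esub> g y)), one = 0,
           zero = h \<zero>\<^bsub>R\<^esub>, add = (\<lambda>x y. h (g x \<oplus>\<^bsub>R\<^esub> g y)) \<rparr>"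
  have gh [simp]: "g (h x) = x" if "x \<in> carrier R" for x
    using that h by (simp add: g_def bij_betw_def)
  have "abelian_group S"
  proof (rule abelian_groupI)
    fix x assume "x \<in> carrier S"
    then obtain u where u: "u \<in> carrier R" "x = h u" by (auto simp: S_def)
    then show "\<exists>y\<in>carrier S. y \<oplus>\<^bsub>S\<^esub> x = \<zero>\<^bsub>S\<^esub>"
      by (intro bexI[of _ "h (\<ominus>\<^bsub>R\<^esub> u)"]) (auto simp: S_def l_neg)
  qed (auto simp: S_def a_ac)
  then have "rng S"
    unfolding rng_def rng_axioms_def by (auto simp: S_def m_closed m_assoc l_distr r_distr)
  then have "comm_rng S"
    unfolding comm_rng_def comm_rng_axioms_def by (auto simp: S_def m_comm)
  moreover have "h \<in> rng_iso R S"
    using h by (auto simp: rng_iso_iff S_def bij_betw_def)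
  moreover have "finite (carrier S)" "card (carrier S) = card (carrier R)"
    using h fin by (auto simp: S_def bij_betw_def card_image)
  ultimately show ?thesis
    by (auto simp: comm_rngs_of_card_def)
qed

end

theory Submission
  imports Defs "HOL-Library.Set_Algebras" "HOL-Library.Product_Plus" "HOL-Library.FuncSet"
    "HOL-Number_Theory.Cong"
begin

text \<open>
  Lower bound: bilinear multiplications \<open>F\<^sub>p\<^sup>r \<times> F\<^sub>p\<^sup>r \<rightarrow> F\<^sub>p\<^bsup>n - r\<^esup>\<close> with \<open>r \<approx> 2n/3\<close> give about \<open>p\<close> to the
  power \<open>(n - r) r\<^sup>2 / 2\<close> rings, at most \<open>|End(F\<^sub>p\<^sup>n)|\<close> of them in each isomorphism class.

  Upper bound: splitting along idempotents reduces to rings \<open>R\<close> whose idempotents are trivial; such a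
  ring is generated over its nilradical \<open>N\<close> by \<open>O(\<surd>n)\<close> elements. Let \<open>N/(N\<^sup>2 + pN)\<close> have order \<open>p\<^sup>r\<close>
  with basis \<open>x\<^sub>i\<close>, and \<open>N\<^sup>2 + pN\<close> order \<open>p\<^sup>s\<close>, so \<open>r + s \<le> n\<close>. The products \<open>x\<^sub>i x\<^sub>j\<close> take at most
  \<open>p\<close> to the power \<open>s r (r + 1) / 2 \<le> 2n\<^sup>3/27 + O(n\<^sup>2)\<close> values. The key point is that
  \<open>N\<^sup>2 = \<Sum> y\<^sub>k N\<close> for some \<open>O(\<surd>n)\<close> elements \<open>y\<^sub>k\<close>, since then, by associativity and nilpotency, the
  \<open>x\<^sub>i x\<^sub>j\<close> and the endomorphisms \<open>y\<^sub>k\<close> determine the multiplication of \<open>N\<close>, and describing \<open>O(\<surd>n)\<close>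
  endomorphisms costs only a factor \<open>p\<close> to the power \<open>O(n\<^bsup>5/2\<^esup>)\<close>.
\<close>

section \<open>Finite subgroups and polycyclic chains\<close>

text \<open>The square root comes from a balance. A greedy choice adjoins multiples y N while each
  enlarges the sum by a factor above p^T, so at most n/T are taken; afterwards every element of N
  has rank at most T modulo that sum, and 3 T further multiples cover the remaining products. With T
  about \<surd>n both counts are O(T). Recording multiplication by a whole basis of N would cost up
  to n endomorphisms of n^2 digits each, as much as the main term. The products involving N^2 + pN
  are not recorded and have to be recovered. The defect between two multiplications with the same
  data is bilinear, its values on N lie in a subgroup that is the sum of its own multiples by the
  y_k, and nilpotency makes that subgroup zero. The constant 2/27 is the maximum of s r^2 / 2 for s
  + r = 1, attained at r = 2/3. Rings are treated as finite subsets of types of class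
  \<open>comm_ring_1\<close>: an ambient identity makes \<open>of_nat\<close> multiples, powers and
  1 - e available, although the rings themselves need not have one.\<close>

definition subgrp :: "'a::ab_group_add set \<Rightarrow> bool"
  where "subgrp H \<longleftrightarrow> 0 \<in> H \<and> (\<forall>x\<in>H. \<forall>y\<in>H. x - y \<in> H)"

lemma subgrp_zero: "subgrp H \<Longrightarrow> 0 \<in> H"
  by (simp add: subgrp_def)

lemma subgrp_diff: "subgrp H \<Longrightarrow> x \<in> H \<Longrightarrow> y \<in> H \<Longrightarrow> x - y \<in> H"
  by (simp add: subgrp_def)

lemma subgrp_uminus: "subgrp H \<Longrightarrow> x \<in> H \<Longrightarrow> - x \<in> H"
  using subgrp_diff[of H 0 x] by (simp add: subgrp_zero)

lemma subgrp_add: "subgrp H \<Longrightarrow> x \<in> H \<Longrightarrow> y \<in> H \<Longrightarrow> x + y \<in> H"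
  using subgrp_diff[of H x "- y"] by (simp add: subgrp_uminus)

lemma subgrp_sum: "subgrp H \<Longrightarrow> (\<And>i. i \<in> I \<Longrightarrow> f i \<in> H) \<Longrightarrow> sum f I \<in> H"
  by (induction I rule: infinite_finite_induct) (auto simp: subgrp_zero subgrp_add)

lemma subgrp_of_nat: "subgrp H \<Longrightarrow> x \<in> H \<Longrightarrow> of_nat k * (x::'a::comm_ring_1) \<in> H"
  by (induction k) (auto simp: subgrp_zero subgrp_add algebra_simps)

lemma subgrp_of_int: "subgrp H \<Longrightarrow> x \<in> H \<Longrightarrow> of_int k * (x::'a::comm_ring_1) \<in> H"
proof (cases k rule: int_diff_cases)
  case (diff m n)
  then show "subgrp H \<Longrightarrow> x \<in> H \<Longrightarrow> of_int k * x \<in> H"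
    by (simp add: left_diff_distrib subgrp_diff subgrp_of_nat)
qed

lemma subgrp_plus: "subgrp A \<Longrightarrow> subgrp B \<Longrightarrow> subgrp (A + B)"
  unfolding subgrp_def set_plus_def
proof (intro conjI ballI; clarsimp)
  show "\<exists>a\<in>A. \<exists>b\<in>B. a + b = 0" if "0 \<in> A" "0 \<in> B"
    using that by force
next
  fix a b a' b'
  assume "\<forall>x\<in>A. \<forall>y\<in>A. x - y \<in> A" "\<forall>x\<in>B. \<forall>y\<in>B. x - y \<in> B" "a \<in> A" "a' \<in> A" "b \<in> B" "b' \<in> B"
  then show "\<exists>c\<in>A. \<exists>d\<in>B. a + b - (a' + b') = c + d"
    by (intro bexI[of _ "a - a'"] bexI[of _ "b - b'"]) auto
qed

lemma subgrp_trivial: "subgrp {0}"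
  by (simp add: subgrp_def)

lemma subgrp_scale: "subgrp V \<Longrightarrow> subgrp ((*) (y::'a::comm_ring_1) ` V)"
  unfolding subgrp_def by (auto simp flip: right_diff_distrib intro: image_eqI[of _ _ 0])

lemma subset_plus_left: "0 \<in> B \<Longrightarrow> A \<subseteq> A + (B::'a::comm_monoid_add set)"
  by (force simp: set_plus_def)

lemma subset_plus_right: "0 \<in> A \<Longrightarrow> B \<subseteq> A + (B::'a::comm_monoid_add set)"
  by (force simp: set_plus_def)

lemma plus_least: "subgrp H \<Longrightarrow> A \<subseteq> H \<Longrightarrow> B \<subseteq> H \<Longrightarrow> A + B \<subseteq> H"
  by (auto simp: set_plus_def intro: subgrp_add)

lemma finite_plus: "finite A \<Longrightarrow> finite B \<Longrightarrow> finite (A + B)"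
  by (rule finite_set_plus)

text \<open>Quotients are never formed: indices and ranks modulo a subgroup are compared through
  this count, in which every fibre is a translate of the kernel.\<close>

lemma card_hom_image:
  assumes G: "subgrp G" "finite G"
    and add: "\<And>x y. x \<in> G \<Longrightarrow> y \<in> G \<Longrightarrow> f (x + y) = f x + (f y :: 'b::ab_group_add)"
  shows "card G = card (f ` G) * card {x\<in>G. f x = 0}"
proof -
  have diff: "f (x - y) = f x - f y" if "x \<in> G" "y \<in> G" for x y
    using add[of "x - y" y] that G(1) by (simp add: subgrp_diff)
  have fib: "card {x\<in>G. f x = z} = card {x\<in>G. f x = 0}" if "z \<in> f ` G" for z
  proof -
    obtain g where g: "g \<in> G" "z = f g" using \<open>z \<in> f ` G\<close> by (rule imageE)
    have "bij_betw (\<lambda>x. x - g) {x\<in>G. f x = z} {x\<in>G. f x = 0}"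
      by (rule bij_betwI[where g = "\<lambda>x. x + g"])
        (use g G in \<open>auto simp: diff add subgrp_diff subgrp_add\<close>)
    then show ?thesis by (rule bij_betw_same_card)
  qed
  have "card G = (\<Sum>z\<in>f ` G. card {x\<in>G. f x = z})"
    using sum.image_gen[OF G(2), of "\<lambda>_. 1::nat" f] by simp
  also have "\<dots> = card (f ` G) * card {x\<in>G. f x = 0}"
    using fib by simp
  finally show ?thesis .
qed

lemma subgrp_Times: "subgrp A \<Longrightarrow> subgrp B \<Longrightarrow> subgrp (A \<times> B)"
  by (auto simp: subgrp_def zero_prod_def)

text \<open>The kernel of addition on \<open>A \<times> B\<close> is the antidiagonal copy of
  \<open>A \<inter> B\<close>.\<close>

lemma card_plus_Int:
  assumes "subgrp A" "subgrp B" "finite A" "finite B"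
  shows "card (A + B) * card (A \<inter> B) = card A * card B"
proof -
  let ?f = "\<lambda>(a, b). a + b"
  have "card (A \<times> B) = card (?f ` (A \<times> B)) * card {x \<in> A \<times> B. ?f x = 0}"
    using assms by (intro card_hom_image subgrp_Times) auto
  moreover have "?f ` (A \<times> B) = A + B"
    by (rule set_plus_image[symmetric])
  moreover have "bij_betw fst {x \<in> A \<times> B. ?f x = 0} (A \<inter> B)"
    by (rule bij_betwI[where g = "\<lambda>x. (x, - x)"])
      (use assms subgrp_uminus[of B] in \<open>auto simp: add_eq_0_iff2 subgrp_uminus intro: minus_unique\<close>)
  ultimately show ?thesis
    by (simp add: bij_betw_same_card card_cartesian_product)
qed

lemma card_subgrp_pos: "subgrp H \<Longrightarrow> finite H \<Longrightarrow> card H > 0"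
  using card_gt_0_iff subgrp_zero by blast

text \<open>Translation by \<open>x\<close> permutes \<open>G\<close>, so the sum over
  \<open>G\<close> is unchanged when \<open>x\<close> is added to each of its terms.\<close>

lemma card_times_eq_0:
  assumes G: "subgrp G" "finite G" and x: "x \<in> (G::'a::comm_ring_1 set)"
  shows "of_nat (card G) * x = 0"
proof -
  have "bij_betw (\<lambda>g. g + x) G G"
    by (rule bij_betwI[where g = "\<lambda>g. g - x"]) (use G x in \<open>auto simp: subgrp_diff subgrp_add\<close>)
  then have "(\<Sum>g\<in>G. g + x) = \<Sum>G"
    by (rule sum.reindex_bij_betw[where g = "\<lambda>g. g"])
  then show ?thesis by (simp add: sum.distrib)
qed

lemma coprime_times_mem:
  assumes H: "subgrp H" and d: "of_nat d * a \<in> H" and p: "of_nat p * (a::'a::comm_ring_1) \<in> H"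
    and "coprime d p"
  shows "a \<in> H"
proof -
  obtain u v :: int where "u * int d + v * int p = 1"
    using bezout_int[of "int d" "int p"] \<open>coprime d p\<close> by (auto simp: coprime_iff_gcd_eq_1)
  then have "(of_int (u * int d + v * int p) :: 'a) = 1" by simp
  then have "a = of_int u * (of_nat d * a) + of_int v * (of_nat p * a)"
    by (simp add: mult.assoc[symmetric] distrib_right[symmetric])
  then show ?thesis
    using H d p by (metis subgrp_add subgrp_of_int)
qed

section \<open>Chains of subgroups with factors of order p, and digit expansions along them\<close>

definition ncomb :: "(nat \<Rightarrow> 'a::comm_ring_1) \<Rightarrow> nat \<Rightarrow> (nat \<Rightarrow> nat) \<Rightarrow> 'a"
  where "ncomb a m v = (\<Sum>i<m. of_nat (v i) * a i)"

definition nspan :: "(nat \<Rightarrow> 'a::comm_ring_1) \<Rightarrow> nat \<Rightarrow> 'a set"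
  where "nspan a m = range (ncomb a m)"

lemma ncomb_Suc: "ncomb a (Suc m) v = ncomb a m v + of_nat (v m) * a m"
  by (simp add: ncomb_def)

lemma ncomb_0 [simp]: "ncomb a 0 v = 0"
  by (simp add: ncomb_def)

lemma ncomb_cong: "(\<And>i. i < m \<Longrightarrow> v i = w i) \<Longrightarrow> (\<And>i. i < m \<Longrightarrow> a i = b i) \<Longrightarrow> ncomb a m v = ncomb b m w"
  by (simp add: ncomb_def)

lemma ncomb_add: "ncomb a m (\<lambda>i. v i + w i) = ncomb a m v + ncomb a m w"
  by (simp add: ncomb_def sum.distrib distrib_right)

lemma ncomb_times: "ncomb a m (\<lambda>i. k * v i) = of_nat k * ncomb a m v"
  by (simp add: ncomb_def sum_distrib_left mult.assoc)

lemma nspan_0 [simp]: "nspan a 0 = {0}"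
  by (auto simp: nspan_def)

lemma ncomb_in_nspan [intro, simp]: "ncomb a m v \<in> nspan a m"
  by (simp add: nspan_def)

lemma nspan_SucI: "x \<in> nspan a m \<Longrightarrow> x + of_nat j * a m \<in> nspan a (Suc m)"
proof -
  assume "x \<in> nspan a m"
  then obtain v where "x = ncomb a m v" by (auto simp: nspan_def)
  then have "x + of_nat j * a m = ncomb a (Suc m) (v(m := j))"
    by (simp add: ncomb_Suc) (rule ncomb_cong, auto)
  then show ?thesis by simp
qed

lemma nspan_Suc: "nspan a (Suc m) = (\<lambda>(x, j). x + of_nat j * a m) ` (nspan a m \<times> UNIV)"
proof
  show "nspan a (Suc m) \<subseteq> (\<lambda>(x, j). x + of_nat j * a m) ` (nspan a m \<times> UNIV)"
    by (auto simp: nspan_def ncomb_Suc)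
qed (auto intro: nspan_SucI)

lemma nspan_mono_Suc: "nspan a m \<subseteq> nspan a (Suc m)"
  using nspan_SucI[of _ a m 0] by auto

lemma nspan_mono: "m \<le> n \<Longrightarrow> nspan a m \<subseteq> nspan a n"
  by (rule lift_Suc_mono_le[of "nspan a"]) (rule nspan_mono_Suc)

lemma nspan_cong: "(\<And>i. i < m \<Longrightarrow> a i = b i) \<Longrightarrow> nspan a m = nspan b m"
  unfolding nspan_def by (intro image_cong refl ncomb_cong) auto

lemma gen_in_nspan: "i < m \<Longrightarrow> a i \<in> nspan a m"
proof -
  assume "i < m"
  have "ncomb a i (\<lambda>_. 0) + of_nat 1 * a i \<in> nspan a (Suc i)" by (intro nspan_SucI ncomb_in_nspan)
  then show ?thesis using nspan_mono[of "Suc i" m a] \<open>i < m\<close> by (auto simp: ncomb_def)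
qed

lemma nspan_least: "subgrp H \<Longrightarrow> (\<And>i. i < m \<Longrightarrow> a i \<in> H) \<Longrightarrow> nspan a m \<subseteq> H"
  by (auto simp: nspan_def ncomb_def intro!: subgrp_sum subgrp_of_nat)

text \<open>For prime \<open>p\<close> this is a composition series given by generators. The
  elements \<open>of_nat p * a m\<close>, expanded in the earlier generators, are the power
  relations of a polycyclic presentation of the group.\<close>

definition pchain :: "nat \<Rightarrow> (nat \<Rightarrow> 'a::comm_ring_1) \<Rightarrow> nat \<Rightarrow> bool"
  where "pchain p a n \<longleftrightarrow> (\<forall>m<n. a m \<notin> nspan a m \<and> of_nat p * a m \<in> nspan a m)"

lemma subgrp_nspan:
  assumes "pchain p a n" "m \<le> n" "p > 0"
  shows "subgrp (nspan a m)"
  using \<open>m \<le> n\<close>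
proof (induction m)
  case (Suc m)
  then have H: "subgrp (nspan a m)" by simp
  have pa: "of_nat p * a m \<in> nspan a m" using assms Suc.prems by (auto simp: pchain_def)
  show ?case
    unfolding subgrp_def
  proof (intro conjI ballI)
    show "0 \<in> nspan a (Suc m)" using H nspan_mono_Suc[of a m] by (auto simp: subgrp_zero)
  next
    fix x y assume "x \<in> nspan a (Suc m)" "y \<in> nspan a (Suc m)"
    then obtain u i v j where uv: "u \<in> nspan a m" "v \<in> nspan a m"
      "x = u + of_nat i * a m" "y = v + of_nat j * a m"
      unfolding nspan_Suc by auto
    \<comment> \<open>\<open>k\<close> is (p - 1) j: modulo the span below, - j a_m equals (p - 1) j
      a_m, and the correction j (p a_m) lies below.\<close>
    define k where "k = p * j - j"
    have "p * j = k + j" using \<open>p > 0\<close> by (simp add: k_def)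
    then have kk: "of_nat p * of_nat j = (of_nat k + of_nat j :: 'a)"
      by (metis of_nat_add of_nat_mult)
    have e: "x - y = (u - v - of_nat j * (of_nat p * a m)) + of_nat (i + k) * a m"
      using arg_cong[OF kk, of "\<lambda>t. t * a m"] by (simp add: uv distrib_right mult.assoc mult.left_commute[of "of_nat j"])
    show "x - y \<in> nspan a (Suc m)"
      unfolding e by (intro nspan_SucI subgrp_diff[OF H] subgrp_of_nat[OF H] uv pa)
  qed
qed (simp add: subgrp_trivial)

lemma pchain_dvd_iff:
  assumes "pchain p a n" "m < n" "Factorial_Ring.prime p"
  shows "of_nat j * a m \<in> nspan a m \<longleftrightarrow> p dvd j"
proof
  have H: "subgrp (nspan a m)" using assms subgrp_nspan[of p a n m] prime_gt_0_nat[of p] by auto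
  have pa: "of_nat p * a m \<in> nspan a m" "a m \<notin> nspan a m"
    using assms by (auto simp: pchain_def)
  show "p dvd j" if "of_nat j * a m \<in> nspan a m"
  proof (rule ccontr)
    assume "\<not> p dvd j"
    then have "coprime j p" using prime_imp_coprime[OF assms(3), of j] by (simp add: coprime_commute)
    then show False using coprime_times_mem[OF H that pa(1)] pa(2) by simp
  qed
  show "of_nat j * a m \<in> nspan a m" if "p dvd j"
    using that subgrp_of_nat[OF H pa(1)] by (auto elim!: dvdE simp: mult.assoc mult.left_commute)
qed

lemma digits_exist:
  assumes "pchain p a n" "m \<le> n" "Factorial_Ring.prime p" "x \<in> nspan a m"
  shows "\<exists>v\<in>{..<m} \<rightarrow>\<^sub>E {..<p}. ncomb a m v = x"
  using assms(2,4)
proof (induction m arbitrary: x)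
  case (Suc m)
  then obtain u j where uj: "u \<in> nspan a m" "x = u + of_nat j * a m"
    unfolding nspan_Suc by auto
  have H: "subgrp (nspan a m)"
    using assms Suc.prems subgrp_nspan[of p a n m] prime_gt_0_nat[of p] by auto
  have pa: "of_nat p * a m \<in> nspan a m" using assms Suc.prems by (auto simp: pchain_def)
  \<comment> \<open>The top digit is reduced modulo \<open>p\<close>; the carried multiple of p a_m
    moves into the lower span.\<close>
  let ?u = "u + of_nat (j div p) * (of_nat p * a m)"
  have "?u \<in> nspan a m" using H pa uj by (auto intro!: subgrp_add subgrp_of_nat)
  then obtain v where v: "v \<in> {..<m} \<rightarrow>\<^sub>E {..<p}" "ncomb a m v = ?u"
    using Suc by auto
  have "ncomb a m (v(m := j mod p)) = ncomb a m v" by (rule ncomb_cong) auto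
  then have "ncomb a (Suc m) (v(m := j mod p)) = ?u + of_nat (j mod p) * a m"
    using v by (simp add: ncomb_Suc)
  also have "\<dots> = u + of_nat (j div p * p + j mod p) * a m"
    by (simp only: of_nat_add of_nat_mult distrib_left distrib_right ac_simps)
  also have "\<dots> = x" by (simp add: uj)
  finally have "ncomb a (Suc m) (v(m := j mod p)) = x" .
  moreover have "v(m := j mod p) \<in> {..<Suc m} \<rightarrow>\<^sub>E {..<p}"
    using v(1) prime_gt_0_nat[OF assms(3)] by (auto simp: PiE_def extensional_def Pi_def less_Suc_eq)
  ultimately show ?case by blast
qed auto

lemma digits_unique:
  assumes "pchain p a n" "m \<le> n" "Factorial_Ring.prime p"
    and "v \<in> {..<m} \<rightarrow> {..<p}" "w \<in> {..<m} \<rightarrow> {..<p}" "ncomb a m v = ncomb a m w"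
  shows "\<forall>i<m. v i = w i"
  using assms(2,4-)
proof (induction m)
  case (Suc m)
  have H: "subgrp (nspan a m)"
    using assms Suc.prems subgrp_nspan[of p a n m] prime_gt_0_nat[of p] by auto
  have *: "v m = w m" if "v m \<le> w m" "ncomb a m v + of_nat (v m) * a m = ncomb a m w + of_nat (w m) * a m"
    "w m < p" for v w
  proof -
    have "of_nat (w m - v m) * a m = ncomb a m v - ncomb a m w"
      using that by (simp add: of_nat_diff algebra_simps)
    also have "\<dots> \<in> nspan a m" using H by (intro subgrp_diff) auto
    finally have "p dvd w m - v m" using pchain_dvd_iff[of p a n m] assms Suc.prems by auto
    then show ?thesis using that by (metis dvd_imp_le leD le_antisym less_imp_diff_less zero_less_diff not_le)
  qed
  have vw: "v m < p" "w m < p" using Suc.prems by auto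
  have "v m = w m"
    using *[of v w] *[of w v] Suc.prems(4) vw by (cases "v m \<le> w m") (auto simp: ncomb_Suc)
  with Suc show ?case by (force simp: ncomb_Suc less_Suc_eq)
qed auto

lemma bij_betw_ncomb:
  assumes "pchain p a n" "Factorial_Ring.prime p" "m \<le> n"
  shows "bij_betw (ncomb a m) ({..<m} \<rightarrow>\<^sub>E {..<p}) (nspan a m)"
  unfolding bij_betw_def
proof
  show "inj_on (ncomb a m) ({..<m} \<rightarrow>\<^sub>E {..<p})"
  proof (rule inj_onI)
    fix v w assume vw: "v \<in> {..<m} \<rightarrow>\<^sub>E {..<p}" "w \<in> {..<m} \<rightarrow>\<^sub>E {..<p}" "ncomb a m v = ncomb a m w"
    then have "\<forall>i<m. v i = w i"
      by (intro digits_unique[OF assms(1,3,2)]) (auto simp: PiE_def)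
    then show "v = w" using vw by (intro PiE_ext) auto
  qed
  show "ncomb a m ` ({..<m} \<rightarrow>\<^sub>E {..<p}) = nspan a m"
    using digits_exist[OF assms(1,3,2)] by (fastforce simp: image_iff)
qed

lemma card_nspan:
  assumes "pchain p a n" "Factorial_Ring.prime p" "m \<le> n"
  shows "card (nspan a m) = p ^ m"
  using bij_betw_same_card[OF bij_betw_ncomb[OF assms]] by (auto simp: card_PiE)

text \<open>Since the old generators are kept, repeated use along a flag of subgroups yields one
  chain adapted to the whole flag. The next generator is the last multiple p^i x still outside the
  span, where \<open>x\<close> is any element outside.\<close>

lemma pchain_extend:
  assumes "pchain p a k" "nspan a k \<subseteq> G" "subgrp G" "finite G" "Factorial_Ring.prime p"
    and kill: "\<And>x. x \<in> G \<Longrightarrow> of_nat (p ^ e) * x = 0"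
  shows "\<exists>b l. k \<le> l \<and> pchain p b l \<and> nspan b l = G \<and> (\<forall>i<k. b i = a i)"
  using assms(1,2)
proof (induction "card (G - nspan a k)" arbitrary: a k rule: less_induct)
  case less
  show ?case
  proof (cases "nspan a k = G")
    case True
    then show ?thesis using less by blast
  next
    case False
    then obtain x where x: "x \<in> G" "x \<notin> nspan a k" using less by auto
    have H: "subgrp (nspan a k)"
      using less.prems assms subgrp_nspan[of p a k k] prime_gt_0_nat[of p] by auto
    define j where "j = (LEAST j. of_nat (p ^ j) * x \<in> nspan a k)"
    have j: "of_nat (p ^ j) * x \<in> nspan a k"
      unfolding j_def by (rule LeastI[of _ e]) (simp only: kill[OF x(1)] subgrp_zero[OF H])
    have "j \<noteq> 0" using j x by (intro notI) auto
    then obtain i where i: "j = Suc i" by (cases j) auto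
    define y where "y = of_nat (p ^ i) * x"
    have y: "y \<in> G" "y \<notin> nspan a k" "of_nat p * y \<in> nspan a k"
      using not_less_Least[of i "\<lambda>j. of_nat (p ^ j) * x \<in> nspan a k"] j i x assms
      by (auto simp: y_def j_def[symmetric] mult.assoc intro: subgrp_of_nat simp del: of_nat_power)
    let ?a = "a(k := y)"
    have sp: "nspan ?a m = nspan a m" if "m \<le> k" for m
      using that by (intro nspan_cong) auto
    have "pchain p ?a (Suc k)"
      using less.prems(1) y by (auto simp: pchain_def sp less_Suc_eq)
    moreover have sub: "nspan ?a (Suc k) \<subseteq> G"
      using y(1) less.prems(2) sp[of k] assms(3) by (auto simp: nspan_Suc intro!: subgrp_add subgrp_of_nat)
    moreover have "card (G - nspan ?a (Suc k)) < card (G - nspan a k)"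
    proof (rule psubset_card_mono)
      have "y \<in> nspan ?a (Suc k)" using gen_in_nspan[of k "Suc k" ?a] by simp
      then show "G - nspan ?a (Suc k) \<subset> G - nspan a k"
        using y nspan_mono_Suc[of ?a k] sp[of k] by auto
    qed (use assms in auto)
    ultimately obtain b l where b: "Suc k \<le> l" "pchain p b l" "nspan b l = G" "\<forall>i<Suc k. b i = ?a i"
      using less.hyps[of ?a "Suc k"] by blast
    then show ?thesis by (intro exI[of _ b] exI[of _ l]) auto
  qed
qed

lemma card_subgrp_power:
  assumes "subgrp H" "finite H" "Factorial_Ring.prime p" "\<And>x. x \<in> H \<Longrightarrow> of_nat (p ^ e) * x = (0::'a::comm_ring_1)"
  obtains k where "card H = p ^ k"
proof -
  obtain b :: "nat \<Rightarrow> 'a" and l where "pchain p b l" "nspan b l = H"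
    using pchain_extend[of p "\<lambda>_. 0::'a" 0 H e] assms by (auto simp: pchain_def subgrp_zero)
  then show ?thesis using that card_nspan[of p b l l] assms by auto
qed

text \<open>The coefficients are arbitrary natural numbers shared by both sequences, so elements of
  two rings can be compared before there is a map between the rings.\<close>

definition same_coords :: "(nat \<Rightarrow> 'a::comm_ring_1) \<Rightarrow> (nat \<Rightarrow> 'b::comm_ring_1) \<Rightarrow> nat \<Rightarrow> 'a \<Rightarrow> 'b \<Rightarrow> bool"
  where "same_coords a b m x y \<longleftrightarrow> (\<exists>v. x = ncomb a m v \<and> y = ncomb b m v)"

text \<open>The power relations present the group. Two expansions of one element have top
  coefficients that differ by a multiple of \<open>p\<close>; rewriting p a_m by its relation moves
  the difference to lower coefficients, and \<open>rel\<close> allows the same rewriting for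
  \<open>b\<close>.\<close>

lemma pchain_kernel:
  assumes a: "pchain p a n" and b: "pchain p b n" and p: "Factorial_Ring.prime p"
    and rel: "\<And>m. m < n \<Longrightarrow> same_coords a b m (of_nat p * a m) (of_nat p * b m)"
    and "m \<le> n" "ncomb a m v = ncomb a m w"
  shows "ncomb b m v = ncomb b m w"
  using assms(5,6)
proof (induction m arbitrary: v w)
  case (Suc m)
  have *: "ncomb b (Suc m) v = ncomb b (Suc m) w"
    if le: "v m \<le> w m" and eq: "ncomb a (Suc m) v = ncomb a (Suc m) w" for v w
  proof -
    have H: "subgrp (nspan a m)"
      using a Suc.prems p subgrp_nspan[of p a n m] prime_gt_0_nat[of p] by auto
    have "of_nat (w m - v m) * a m = ncomb a m v - ncomb a m w"
      using eq le by (simp add: ncomb_Suc of_nat_diff algebra_simps)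
    also have "\<dots> \<in> nspan a m" using H by (intro subgrp_diff) auto
    finally have "p dvd w m - v m" using pchain_dvd_iff[of p a n m] a p Suc.prems by auto
    then obtain q where "w m - v m = p * q" by (auto elim: dvdE)
    then have q: "w m = v m + p * q" using le by simp
    obtain c where c: "of_nat p * a m = ncomb a m c" "of_nat p * b m = ncomb b m c"
      using rel[of m] Suc.prems by (auto simp: same_coords_def)
    have 1: "of_nat (w m) * a m = of_nat (v m) * a m + of_nat q * ncomb a m c"
      by (simp add: q c(1)[symmetric] algebra_simps)
    have 2: "of_nat (w m) * b m = of_nat (v m) * b m + of_nat q * ncomb b m c"
      by (simp add: q c(2)[symmetric] algebra_simps)
    have "ncomb a m v = ncomb a m (\<lambda>i. w i + q * c i)"
      using eq unfolding ncomb_Suc 1 ncomb_add ncomb_times by (simp add: add.left_commute[of _ "of_nat (v m) * a m"] add.commute[of _ "of_nat (v m) * a m"])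
    then have "ncomb b m v = ncomb b m (\<lambda>i. w i + q * c i)" using Suc.prems(1) by (intro Suc.IH) simp_all
    then show ?thesis unfolding ncomb_Suc 2 ncomb_add ncomb_times by (simp add: ac_simps)
  qed
  show ?case
  proof (cases "v m \<le> w m")
    case True
    then show ?thesis by (rule *) (rule Suc.prems(2))
  next
    case False
    then show ?thesis by (intro *[of w v, symmetric]) (simp_all only: Suc.prems(2) nat_le_linear not_le less_imp_le)
  qed
qed simp

lemma same_coords_iso:
  assumes a: "pchain p a n" and b: "pchain p b n" and p: "Factorial_Ring.prime p"
    and rel: "\<And>m. m < n \<Longrightarrow> same_coords a b m (of_nat p * a m) (of_nat p * b m)"
  obtains h where "\<And>v. h (ncomb a n v) = ncomb b n v" "bij_betw h (nspan a n) (nspan b n)"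
    "\<And>x y. x \<in> nspan a n \<Longrightarrow> y \<in> nspan a n \<Longrightarrow> h (x + y) = h x + h y"
proof
  define h where "h x = ncomb b n (SOME v. ncomb a n v = x)" for x
  show hv: "h (ncomb a n v) = ncomb b n v" for v
  proof -
    have "ncomb a n (SOME w. ncomb a n w = ncomb a n v) = ncomb a n v"
      by (rule someI[where P = "\<lambda>w. ncomb a n w = ncomb a n v"]) simp
    then show ?thesis unfolding h_def by (intro pchain_kernel[OF a b p rel order.refl]) auto
  qed
  have rel': "same_coords b a m (of_nat p * b m) (of_nat p * a m)" if "m < n" for m
    using rel[OF that] by (auto simp: same_coords_def)
  show "bij_betw h (nspan a n) (nspan b n)"
    unfolding bij_betw_def
  proof
    show "inj_on h (nspan a n)"
    proof (rule inj_onI)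
      fix x y assume "x \<in> nspan a n" "y \<in> nspan a n" "h x = h y"
      then obtain v w where "x = ncomb a n v" "y = ncomb a n w" "ncomb b n v = ncomb b n w"
        by (auto simp: nspan_def hv)
      then show "x = y" using pchain_kernel[OF b a p rel' order.refl, of v w] by simp
    qed
    show "h ` nspan a n = nspan b n" by (auto simp: nspan_def hv image_image)
  qed
  show "h (x + y) = h x + h y" if xy: "x \<in> nspan a n" "y \<in> nspan a n" for x y
  proof -
    obtain v w where "x = ncomb a n v" "y = ncomb a n w" using xy by (auto simp: nspan_def)
    then show ?thesis using hv[of "\<lambda>i. v i + w i"] by (simp add: ncomb_add hv)
  qed
qed

section \<open>Covering the square of a ring by few multiples\<close>

definition subrng :: "'a::comm_ring set \<Rightarrow> bool"
  where "subrng R \<longleftrightarrow> subgrp R \<and> (\<forall>x\<in>R. \<forall>y\<in>R. x * y \<in> R)"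

lemma subrng_subgrp: "subrng R \<Longrightarrow> subgrp R"
  by (simp add: subrng_def)

lemma subrng_mult: "subrng R \<Longrightarrow> x \<in> R \<Longrightarrow> y \<in> R \<Longrightarrow> x * y \<in> R"
  by (simp add: subrng_def)

definition psum :: "'a::comm_ring_1 list \<Rightarrow> 'a set \<Rightarrow> 'a set"
  where "psum ys V = (\<Sum>y\<leftarrow>ys. (*) y ` V)"

lemma psum_Nil [simp]: "psum [] V = {0}"
  by (simp add: psum_def)

lemma psum_Cons [simp]: "psum (y # ys) V = (*) y ` V + psum ys V"
  by (simp add: psum_def)

lemma psum_append: "psum (ys @ zs) V = psum ys V + psum zs V"
  by (simp add: psum_def)

lemma subgrp_psum: "subgrp V \<Longrightarrow> subgrp (psum ys V)"
  by (induction ys) (auto intro: subgrp_trivial subgrp_plus subgrp_scale)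

lemma psum_mem:
  assumes "subgrp V" "y \<in> set ys" "v \<in> V"
  shows "y * v \<in> psum ys V"
  using assms(2)
proof (induction ys)
  case (Cons z ys)
  have "0 \<in> (*) z ` V" "0 \<in> psum ys V"
    using assms(1) subgrp_scale[of V z] subgrp_psum[of V ys] by (auto simp: subgrp_zero)
  then have "(*) z ` V \<subseteq> psum (z # ys) V" "psum ys V \<subseteq> psum (z # ys) V"
    unfolding psum_Cons by (simp_all only: subset_plus_left subset_plus_right)
  then show ?case using Cons assms(3) by auto
qed simp

lemma psum_least:
  assumes "subgrp H" "\<And>y v. y \<in> set ys \<Longrightarrow> v \<in> V \<Longrightarrow> y * v \<in> H"
  shows "psum ys V \<subseteq> H"
  using assms(2)
proof (induction ys)
  case (Cons y ys)
  then show ?case unfolding psum_Cons by (intro plus_least assms(1)) auto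
qed (simp add: assms(1) subgrp_zero)

lemma subrng_psum_subset: "subrng R \<Longrightarrow> set ys \<subseteq> R \<Longrightarrow> V \<subseteq> R \<Longrightarrow> psum ys V \<subseteq> R"
  by (intro psum_least) (auto intro: subrng_subgrp subrng_mult)

lemma card_finite_subgrp_power:
  assumes "subgrp R" "finite R" "Factorial_Ring.prime p" "card R = p ^ n" "subgrp H" "H \<subseteq> (R::'a::comm_ring_1 set)"
  obtains k where "card H = p ^ k"
proof (rule card_subgrp_power[of H p n])
  show "of_nat (p ^ n) * x = 0" if "x \<in> H" for x
    using card_times_eq_0[of R x] assms that by auto
qed (use assms finite_subset in auto)

lemma subgrp_self_plus: "subgrp W \<Longrightarrow> W + W = W"
  using plus_least[of W W W] subset_plus_left[of W W] by (auto simp: subgrp_zero)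

text \<open>
  If \<open>a\<close> has maximal rank \<open>t\<close> and kernel \<open>K\<close>, then any \<open>z \<in> K\<close> has rank at most \<open>t/2\<close> on \<open>K\<close>
  modulo the image of \<open>a\<close>: modulo \<open>z K\<close> the images of \<open>z\<close> and \<open>a + z\<close> together still cover that of
  \<open>a\<close>, so their ranks add up to at least \<open>2 rank(z|K) + t\<close>. Everything is read modulo \<open>W\<close>.
\<close>

lemma breadth_halves:
  fixes V W :: "'a::comm_ring_1 set"
  assumes V: "subgrp V" "finite V" and W: "subgrp W" "finite W"
    and t: "\<And>z. z \<in> V \<Longrightarrow> card ((*) z ` V + W) \<le> p ^ t * card W"
    and a: "a \<in> V" "card ((*) a ` V + W) = p ^ t * card W"
    and K: "K = {v \<in> V. a * v \<in> W}" and z: "z \<in> K"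
  shows "card ((*) z ` K + ((*) a ` V + W)) ^ 2 \<le> p ^ t * card ((*) a ` V + W) ^ 2"
proof -
  define I where "I = (*) a ` V + W"
  define J where "J = (*) z ` K + W"
  define A1 where "A1 = (*) z ` V + W"
  define A2 where "A2 = (*) (a + z) ` V + W"
  define Q where "Q = (*) z ` K + I"
  have Kg: "subgrp K"
    using V(1) W(1) unfolding K subgrp_def by (auto simp: right_diff_distrib)
  have KV: "K \<subseteq> V" "finite K" using V by (auto simp: K)
  have sg: "subgrp I" "subgrp J" "subgrp A1" "subgrp A2"
    unfolding I_def J_def A1_def A2_def by (intro subgrp_plus subgrp_scale V W Kg)+
  have fin: "finite I" "finite J" "finite A1" "finite A2"
    unfolding I_def J_def A1_def A2_def using V W KV by (auto intro!: finite_plus)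
  have WI: "W \<subseteq> I" and WJ: "W \<subseteq> J" and WA1: "W \<subseteq> A1" and WA2: "W \<subseteq> A2"
    unfolding I_def J_def A1_def A2_def
    by (intro subset_plus_right; use subgrp_scale[OF V(1)] subgrp_scale[OF Kg] subgrp_zero in blast)+
  have A1: "z * v \<in> A1" and A2: "(a + z) * v \<in> A2" if "v \<in> V" for v
    unfolding A1_def A2_def using that W(1) by (auto simp: subgrp_zero intro!: set_mp[OF subset_plus_left])
  have JI: "J + I = Q"
    unfolding J_def I_def Q_def using subgrp_self_plus[OF W(1)] by (metis add.assoc add.left_commute)
  have "card Q * card W \<le> card Q * card (J \<inter> I)"
    using WI WJ fin by (intro mult_left_mono card_mono) auto
  also have "\<dots> = card J * card I"
    using card_plus_Int[of J I] sg fin by (simp add: JI)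
  finally have "card Q * card W \<le> (card J * p ^ t) * card W"
    using a(2) by (simp add: I_def mult.assoc)
  then have 1: "card Q \<le> card J * p ^ t"
    using card_subgrp_pos[OF W] by simp
  have "Q \<subseteq> A1 + A2"
    unfolding Q_def I_def
  proof (intro plus_least subgrp_plus sg; safe?)
    fix k assume "k \<in> K"
    then show "z * k \<in> A1 + A2"
      using A1[of k] KV sg(4) by (intro set_mp[OF subset_plus_left]) (auto simp: subgrp_zero)
  next
    fix v assume "v \<in> V"
    then have "(a + z) * v - z * v \<in> A1 + A2"
      using A1[of v] A2[of v] sg
      by (intro subgrp_diff subgrp_plus set_mp[OF subset_plus_left[of A2 A1]] set_mp[OF subset_plus_right[of A1 A2]])
        (auto simp: subgrp_zero)
    then show "a * v \<in> A1 + A2" by (simp add: distrib_right)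
  next
    fix w assume "w \<in> W"
    then show "w \<in> A1 + A2"
      using WA1 sg(4) by (intro set_mp[OF subset_plus_left]) (auto simp: subgrp_zero)
  qed
  moreover have "J \<subseteq> A1 \<inter> A2"
  proof -
    have "J \<subseteq> A1" unfolding J_def using sg WA1 A1 KV by (intro plus_least) auto
    moreover have "J \<subseteq> A2"
      unfolding J_def
    proof (intro plus_least sg WA2; safe?)
      fix k assume k: "k \<in> K"
      \<comment> \<open>As a k lies in \<open>W\<close>, multiplication by \<open>z\<close> and by
        \<open>a + z\<close> agree on \<open>K\<close> modulo \<open>W\<close>, which puts
        \<open>J\<close> into both images.\<close>
      then have "(a + z) * k - a * k \<in> A2"
        using A2[of k] WA2 sg KV by (intro subgrp_diff) (auto simp: K)
      then show "z * k \<in> A2" by (simp add: distrib_right)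
    qed
    ultimately show ?thesis by simp
  qed
  ultimately have "card Q * card J \<le> card (A1 + A2) * card (A1 \<inter> A2)"
    using fin by (intro mult_mono card_mono finite_plus) auto
  also have "\<dots> = card A1 * card A2" using sg fin by (intro card_plus_Int)
  also have "\<dots> \<le> (p ^ t * card W) * (p ^ t * card W)"
    unfolding A1_def A2_def using z a V KV by (intro mult_mono t subgrp_add) auto
  finally have 2: "card Q * card J \<le> card I * card I" by (simp add: I_def a)
  \<comment> \<open>The first estimate bounds \<open>card J\<close> from below, the second from
    above; \<open>J\<close> is eliminated, and squaring avoids half exponents.\<close>
  have "card Q ^ 2 \<le> card Q * (card J * p ^ t)"
    using 1 by (simp add: power2_eq_square)
  also have "\<dots> = p ^ t * (card Q * card J)" by simp
  also have "\<dots> \<le> p ^ t * card I ^ 2" using 2 by (simp add: power2_eq_square)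
  finally show ?thesis by (simp add: Q_def I_def)
qed

text \<open>Strong induction on \<open>t\<close>. If \<open>a\<close> attains rank \<open>t\<close>,
  its kernel \<open>K\<close> modulo \<open>W\<close> has index p^t in \<open>V\<close>, and on
  \<open>K\<close> modulo \<open>I\<close> = a V + W the ranks are at most t/2 by
  \<open>breadth_halves\<close>. Products within \<open>K\<close> thus need 3 (t div 2) multiples
  besides that of \<open>a\<close>, and t representatives of V/K take care of all other products; 1
  + t + 3 (t div 2) \<le> 3 t for t > 0.\<close>

lemma breadth_cover:
  fixes R V W :: "'a::comm_ring_1 set"
  assumes R: "subrng R" "finite R" "card R = p ^ n" and p: "Factorial_Ring.prime p"
    and "subgrp V" "V \<subseteq> R" "subgrp W" "W \<subseteq> R"
    and "\<And>z. z \<in> V \<Longrightarrow> card ((*) z ` V + W) \<le> p ^ t * card W"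
  shows "\<exists>ys. set ys \<subseteq> V \<and> length ys \<le> 3 * t \<and> (\<forall>x\<in>V. \<forall>y\<in>V. x * y \<in> psum ys V + W)"
  using assms(5-)
proof (induction t arbitrary: V W rule: less_induct)
  case (less t)
  note V = less.prems(1,2) and W = less.prems(3,4) and br = less.prems(5)
  have fin: "finite V" "finite W" using V W R finite_subset by auto
  have R': "subgrp R" using R by (simp add: subrng_def)
  have p1: "1 < p" using p by (rule prime_gt_1_nat)
  have W_le: "W \<subseteq> (*) z ` V + W" for z
    using subgrp_scale[OF V(1), of z] by (intro subset_plus_right) (simp add: subgrp_zero)
  have sub: "(*) z ` V + W \<subseteq> R" if "z \<in> V" for z
    using that V W R by (intro plus_least) (auto simp: subrng_def)
  consider (zero) "t = 0" | (small) "t > 0" "\<And>z. z \<in> V \<Longrightarrow> card ((*) z ` V + W) \<le> p ^ (t - 1) * card W"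
    | (big) a where "t > 0" "a \<in> V" "card ((*) a ` V + W) > p ^ (t - 1) * card W"
    by (meson not_le neq0_conv)
  then show ?case
  proof cases
    case zero
    have "x * y \<in> W" if "x \<in> V" "y \<in> V" for x y
    proof -
      have "W = (*) x ` V + W"
        using br[OF that(1)] W_le fin zero by (intro card_seteq) (auto intro!: finite_plus)
      moreover have "x * y \<in> (*) x ` V + W"
        using that W by (intro set_mp[OF subset_plus_left]) (auto simp: subgrp_zero)
      ultimately show ?thesis by simp
    qed
    then show ?thesis by (intro exI[of _ "[]"]) (auto simp flip: set_zero)
  next
    case small
    then show ?thesis using less.IH[of "t - 1" V W] V W by fastforce
  next
    case big
    note a = \<open>a \<in> V\<close>
    define I where "I = (*) a ` V + W"
    have I: "subgrp I" "I \<subseteq> R" "finite I"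
      unfolding I_def using V W sub a fin by (auto intro!: subgrp_plus subgrp_scale finite_plus)
    obtain i where i: "card I = p ^ i" by (rule card_finite_subgrp_power[OF R' R(2) p R(3) I(1,2)])
    obtain j where j: "card W = p ^ j" by (rule card_finite_subgrp_power[OF R' R(2) p R(3) W])
    \<comment> \<open>Both orders are powers of \<open>p\<close> and their quotient lies above p^(t
      - 1) and not above p^t, so \<open>a\<close> attains the bound exactly.\<close>
    have "p ^ i > p ^ (t - 1 + j)" using big(3) i j by (simp add: I_def power_add)
    then have "i > t - 1 + j" using p1 by (simp add: power_strict_increasing_iff)
    moreover have "p ^ i \<le> p ^ (t + j)" using br[OF a] i j by (simp add: I_def power_add)
    then have "i \<le> t + j" using p1 by (simp add: power_increasing_iff)
    ultimately have it: "i = t + j" by linarith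
    have cI: "card I = p ^ t * card W" using i j it by (simp add: power_add)
    define K where "K = {v \<in> V. a * v \<in> W}"
    have K: "subgrp K" "K \<subseteq> V" "finite K"
      using V(1) W(1) fin unfolding K_def subgrp_def by (auto simp: right_diff_distrib)
    have "card ((*) z ` K + I) \<le> p ^ (t div 2) * card I" if z: "z \<in> K" for z
    proof -
      have Q: "subgrp ((*) z ` K + I)" "(*) z ` K + I \<subseteq> R"
      proof -
        show "subgrp ((*) z ` K + I)" by (intro subgrp_plus subgrp_scale K I)
        have "(*) z ` K \<subseteq> R" using z K V R(1) by (auto intro: subrng_mult)
        then show "(*) z ` K + I \<subseteq> R" by (intro plus_least R' I)
      qed
      obtain q where q: "card ((*) z ` K + I) = p ^ q"
        by (rule card_finite_subgrp_power[OF R' R(2) p R(3) Q])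
      have "(p ^ q) ^ 2 \<le> p ^ t * (p ^ i) ^ 2"
        using breadth_halves[OF V(1) fin(1) W(1) fin(2) br a _ K_def z] cI q i unfolding I_def by simp
      then have "p ^ (q * 2) \<le> p ^ (t + i * 2)"
        by (simp only: power_mult power_add)
      then have "q * 2 \<le> t + i * 2" using p1 by (simp add: power_increasing_iff)
      then have "q \<le> t div 2 + i" by linarith
      then have "p ^ q \<le> p ^ (t div 2 + i)" using p1 by (simp add: power_increasing_iff)
      then show ?thesis by (simp add: q i power_add)
    qed
    then obtain ys where ys: "set ys \<subseteq> K" "length ys \<le> 3 * (t div 2)"
      "\<forall>x\<in>K. \<forall>y\<in>K. x * y \<in> psum ys K + I"
      using less.IH[of "t div 2" K I] big(1) K V I by auto
    have kill: "of_nat (p ^ n) * x = 0" if "x \<in> R" for x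
      using card_times_eq_0[OF R' R(2) that] R(3) by simp
    \<comment> \<open>A chain through \<open>K\<close> up to \<open>V\<close>: its members from
      index \<open>k\<close> on generate \<open>V\<close> modulo \<open>K\<close>.\<close>
    have "\<exists>b l. 0 \<le> l \<and> pchain p b l \<and> nspan b l = K \<and> (\<forall>i<0. b i = (0::'a))"
      using K V by (intro pchain_extend[OF _ _ _ _ p kill]) (auto simp: pchain_def subgrp_zero)
    then obtain b0 k where b0: "pchain p b0 k" "nspan b0 k = K" by blast
    have "\<exists>b l. k \<le> l \<and> pchain p b l \<and> nspan b l = V \<and> (\<forall>i<k. b i = b0 i)"
      using b0 K V fin by (intro pchain_extend[OF _ _ _ _ p kill]) auto
    then obtain b l where bl: "k \<le> l" "pchain p b l" "nspan b l = V" "\<forall>i<k. b i = b0 i" by blast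
    have bk: "nspan b k = K" using bl(4) b0 nspan_cong[of k b b0] by simp
    \<comment> \<open>V/K is isomorphic to a V / (a V \<inter> W), hence to I/W of order p^t.
      Multiplication by \<open>a\<close> has the same kernel on \<open>V\<close> as on
      \<open>K\<close>, which cancels from the two fibre counts.\<close>
    have "l = k + t"
    proof -
      have cV: "card V = p ^ l" "card K = p ^ k"
        using card_nspan[of p b l l] card_nspan[of p b l k] bl bk p by auto
      have "card V = card ((*) a ` V) * card {v\<in>V. a * v = 0}"
        using V fin by (intro card_hom_image) (auto simp: distrib_left)
      moreover have "card K = card ((*) a ` K) * card {v\<in>K. a * v = 0}"
        using K by (intro card_hom_image) (auto simp: distrib_left)
      moreover have "{v\<in>V. a * v = 0} = {v\<in>K. a * v = 0}"
        using W by (auto simp: K_def subgrp_zero)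
      moreover have "(*) a ` K = (*) a ` V \<inter> W" by (auto simp: K_def)
      moreover have "card I * card ((*) a ` V \<inter> W) = card ((*) a ` V) * card W"
        unfolding I_def using V W fin by (intro card_plus_Int subgrp_scale) auto
      ultimately have "card V * card W = p ^ t * card K * card W" using cI by auto
      then have "p ^ l = p ^ (t + k)" using card_subgrp_pos[OF W(1) fin(2)] cV by (simp add: power_add)
      then show ?thesis using p1 by (simp add: power_inject_exp)
    qed
    define zs where "zs = a # map b [k..<l] @ ys"
    define P where "P = psum zs V + W"
    have bV: "b i \<in> V" if "i < l" for i using gen_in_nspan[of i l b] that bl by auto
    have zsV: "set zs \<subseteq> V" using a ys K bV by (auto simp: zs_def)
    have P: "subgrp P" unfolding P_def by (intro subgrp_plus subgrp_psum V W)
    have Pm: "y * v \<in> P" if "y \<in> set zs" "v \<in> V" for y v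
      unfolding P_def using psum_mem[OF V(1) that] W by (auto simp: subgrp_zero intro!: set_mp[OF subset_plus_left])
    have WP: "W \<subseteq> P"
      unfolding P_def using subgrp_psum[OF V(1)] by (intro subset_plus_right) (simp add: subgrp_zero)
    have KP: "x * y \<in> P" if "x \<in> K" "y \<in> K" for x y
    proof -
      have "psum ys K + I \<subseteq> P"
        unfolding I_def using P Pm WP K(2)
        by (intro plus_least psum_least) (auto simp: zs_def)
      then show ?thesis using ys that by auto
    qed
    \<comment> \<open>Membership in \<open>P\<close> is tested on the generators \<open>b\<close>,
      one factor at a time: \<open>S\<close> yields the products of \<open>K\<close> with
      \<open>V\<close>, then \<open>B\<close> those of \<open>V\<close> with
      \<open>V\<close>.\<close>
    define S where "S = {y\<in>V. \<forall>x\<in>K. x * y \<in> P}"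
    have S: "subgrp S"
      using V(1) P unfolding S_def subgrp_def by (auto simp: right_diff_distrib)
    have bS: "b i \<in> S" if "i < l" for i
    proof (cases "i < k")
      case True
      then show ?thesis using gen_in_nspan[of i k b] bk K KP by (auto simp: S_def)
    next
      case False
      then show ?thesis using bV[OF that] Pm[of "b i"] K that by (auto simp: S_def zs_def mult.commute)
    qed
    define B where "B = {x\<in>V. \<forall>y\<in>V. x * y \<in> P}"
    have B: "subgrp B"
      using V(1) P unfolding B_def subgrp_def by (auto simp: left_diff_distrib)
    have "V \<subseteq> S" using nspan_least[of S l b, OF S bS] bl(3) by simp
    then have KB: "K \<subseteq> B" using K(2) unfolding B_def S_def by blast
    have "b i \<in> B" if "i < l" for i
    proof (cases "i < k")
      case True
      then show ?thesis using gen_in_nspan[of i k b] bk KB by auto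
    next
      case False
      then show ?thesis using bV[OF that] Pm[of "b i"] that by (auto simp: B_def zs_def)
    qed
    then have "V \<subseteq> B" using nspan_least[of B l b, OF B] bl(3) by simp
    moreover have "length zs \<le> 3 * t"
      using ys(2) \<open>l = k + t\<close> big(1) by (simp add: zs_def)
    ultimately show ?thesis using zsV by (intro exI[of _ zs]) (auto simp: B_def P_def)
  qed
qed

text \<open>Take a list of maximal length among those whose sum has order at least p to the power
  \<open>T\<close> times the length. An element exceeding the rank bound could be added to it, and
  the order of \<open>N\<close> limits the length to n/T.\<close>

lemma greedy_cover:
  fixes N :: "'a::comm_ring_1 set"
  assumes N: "subrng N" "finite N" "card N = p ^ n" and p: "Factorial_Ring.prime p" and "T > 0"
  shows "\<exists>ys. set ys \<subseteq> N \<and> length ys * T \<le> n \<and>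
    (\<forall>z\<in>N. card ((*) z ` N + psum ys N) \<le> p ^ T * card (psum ys N))"
proof -
  have p1: "1 < p" using p by (rule prime_gt_1_nat)
  define good where "good ys \<longleftrightarrow> set ys \<subseteq> N \<and> p ^ (length ys * T) \<le> card (psum ys N)" for ys
  have len: "length ys * T \<le> n" if "good ys" for ys
  proof -
    have "p ^ (length ys * T) \<le> card (psum ys N)" using that by (simp add: good_def)
    also have "\<dots> \<le> p ^ n"
      using card_mono[OF N(2) subrng_psum_subset[OF N(1), of ys N]] that N(3) by (simp add: good_def)
    finally show ?thesis using p1 by (simp add: power_increasing_iff)
  qed
  have "length ys \<le> n" if "good ys" for ys
    using len[OF that] \<open>T > 0\<close> by (metis le_trans mult_le_mono2 nat_mult_1_right Suc_leI One_nat_def)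
  moreover have "good []" by (simp add: good_def)
  ultimately obtain ys where ys: "good ys" "\<And>zs. good zs \<Longrightarrow> length zs \<le> length ys"
    using ex_has_greatest_nat[of good "[]" length "n + 1"] by (metis less_Suc_eq_le Suc_eq_plus1)
  have "card ((*) z ` N + psum ys N) \<le> p ^ T * card (psum ys N)" if z: "z \<in> N" for z
  proof (rule ccontr)
    assume "\<not> ?thesis"
    then have gt: "card (psum (z # ys) N) > p ^ T * card (psum ys N)" by simp
    have "p ^ (length (z # ys) * T) = p ^ T * p ^ (length ys * T)" by (simp add: power_add)
    also have "\<dots> \<le> p ^ T * card (psum ys N)" using ys(1) by (simp add: good_def)
    finally have "good (z # ys)" using gt ys(1) z by (simp add: good_def)
    then show False using ys(2)[of "z # ys"] by simp
  qed
  then show ?thesis using ys(1) len by (auto simp: good_def)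
qed

text \<open>\<open>4 * T\<close> is T for the greedy list, as n/T \<le> T, plus 3 T for the products
  of \<open>N\<close> modulo the sum over that list.\<close>

lemma square_cover:
  fixes N :: "'a::comm_ring_1 set"
  assumes N: "subrng N" "finite N" "card N = p ^ n" and p: "Factorial_Ring.prime p" and T: "T > 0" "n \<le> T * T"
  shows "\<exists>ys. set ys \<subseteq> N \<and> length ys \<le> 4 * T \<and> (\<forall>x\<in>N. \<forall>y\<in>N. x * y \<in> psum ys N)"
proof -
  obtain ys where ys: "set ys \<subseteq> N" "length ys * T \<le> n"
    "\<forall>z\<in>N. card ((*) z ` N + psum ys N) \<le> p ^ T * card (psum ys N)"
    using greedy_cover[OF N p T(1)] by blast
  have "subgrp (psum ys N)" using N by (intro subgrp_psum) (simp add: subrng_def)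
  moreover have "psum ys N \<subseteq> N" using N ys by (intro subrng_psum_subset) auto
  ultimately obtain zs where zs: "set zs \<subseteq> N" "length zs \<le> 3 * T"
    "\<forall>x\<in>N. \<forall>y\<in>N. x * y \<in> psum zs N + psum ys N"
    using breadth_cover[OF N p _ order.refl, of "psum ys N" T] ys(3) N subrng_subgrp by blast
  have "length ys * T \<le> T * T" using ys T by linarith
  then have "length ys \<le> T" using T by simp
  then show ?thesis using ys zs by (intro exI[of _ "zs @ ys"]) (auto simp: psum_append)
qed

section \<open>Nilradical and generators\<close>

lemma subrng_power:
  assumes "subrng R" "x \<in> R" "k > 0"
  shows "x ^ k \<in> (R::'a::comm_ring_1 set)"
  using assms(3) by (induction k rule: nat_induct_non_zero) (use assms in \<open>auto intro: subrng_mult\<close>)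

lemma power_idempotent_exists:
  assumes "subrng R" "finite R" "x \<in> (R::'a::comm_ring_1 set)"
  obtains k where "k > 0" "x ^ k * x ^ k = x ^ k"
proof -
  have "\<not> inj (\<lambda>k. x ^ Suc k)"
  proof
    assume "inj (\<lambda>k. x ^ Suc k)"
    moreover have "range (\<lambda>k. x ^ Suc k) \<subseteq> R" using assms subrng_power by blast
    ultimately show False using assms(2) finite_subset finite_imageD infinite_UNIV_nat by metis
  qed
  then obtain i d where id: "d > 0" "x ^ Suc i = x ^ Suc (i + d)"
    unfolding inj_def by (metis add_diff_inverse_nat linorder_neqE_nat not_less_iff_gr_or_eq zero_less_diff)
  have step: "x ^ m = x ^ (m + q * d)" if "m \<ge> Suc i" for m q
  proof (induction q)
    case (Suc q)
    obtain r where r: "m + q * d = Suc i + r" using le_Suc_ex[of "Suc i" "m + q * d"] trans_le_add1[OF \<open>m \<ge> Suc i\<close>] by auto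
    have "m + Suc q * d = r + Suc (i + d)" using r by simp
    then have "x ^ (m + Suc q * d) = x ^ r * x ^ Suc (i + d)" by (simp only: power_add)
    also have "\<dots> = x ^ (Suc i + r)"
      unfolding id(2)[symmetric] by (simp only: power_add mult.commute)
    also have "\<dots> = x ^ (m + q * d)" by (simp only: r)
    finally show ?case using Suc by simp
  qed simp
  \<comment> \<open>The exponent is a multiple of the period \<open>d\<close> beyond the preperiod,
    so doubling it does not change the power.\<close>
  have "x ^ (Suc i * d) = x ^ (Suc i * d + Suc i * d)"
    by (rule step) (use id(1) mult_le_mono2[of 1 d "Suc i"] in \<open>simp add: Suc_leI\<close>)
  then show ?thesis
    using id(1) by (intro that[of "Suc i * d"]) (simp_all only: power_add mult_pos_pos zero_less_Suc)
qed

definition nilrad :: "'a::comm_ring_1 set \<Rightarrow> 'a set"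
  where "nilrad R = {x \<in> R. \<exists>k. x ^ k = 0}"

lemma nilradI: "x \<in> R \<Longrightarrow> x ^ k = 0 \<Longrightarrow> x \<in> nilrad R"
  by (auto simp: nilrad_def)

lemma nilrad_subset: "nilrad R \<subseteq> R"
  by (auto simp: nilrad_def)

lemma nilrad_ideal: "subrng R \<Longrightarrow> x \<in> nilrad R \<Longrightarrow> y \<in> R \<Longrightarrow> x * y \<in> nilrad R"
  by (auto simp: nilrad_def subrng_mult power_mult_distrib) (metis mult_zero_left)

lemma subgrp_nilrad:
  assumes "subrng R"
  shows "subgrp (nilrad R)"
  unfolding subgrp_def
proof (intro conjI ballI)
  show "0 \<in> nilrad R" using assms by (intro nilradI[of _ _ 1]) (auto simp: subrng_def subgrp_zero)
next
  fix x y assume "x \<in> nilrad R" "y \<in> nilrad R"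
  then obtain i j where ij: "x \<in> R" "y \<in> R" "x ^ i = 0" "y ^ j = 0" by (auto simp: nilrad_def)
  have "(x + - y) ^ (i + j) = 0"
    unfolding binomial_ring
  proof (intro sum.neutral ballI)
    fix k assume "k \<in> {..i + j}"
    have "x ^ k = 0" if "k \<ge> i" using ij(3) that by (metis le_add_diff_inverse mult_zero_left power_add)
    moreover have "(- y) ^ (i + j - k) = 0" if "k < i"
    proof -
      have "i + j - k = j + (i - k)" using that by simp
      then show ?thesis using ij(4) by (simp only: power_minus[of y] power_add mult_zero_left mult_zero_right)
    qed
    ultimately show "of_nat (i + j choose k) * x ^ k * (- y) ^ (i + j - k) = 0"
      by (cases "k < i") auto
  qed
  then show "x - y \<in> nilrad R"
    using ij assms by (intro nilradI[of _ _ "i + j"]) (auto simp: subrng_def subgrp_diff)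
qed

lemma subrng_nilrad: "subrng R \<Longrightarrow> subrng (nilrad R)"
  using subgrp_nilrad[of R] nilrad_ideal[of R] nilrad_subset[of R] by (auto simp: subrng_def)

text \<open>For finite \<open>R\<close> this means that \<open>R\<close> is nil, or has an identity
  and is local. The condition speaks of the action on \<open>R\<close> because the identity of the
  ambient type need not lie in \<open>R\<close>.\<close>

definition indecomposable :: "'a::comm_ring_1 set \<Rightarrow> bool"
  where "indecomposable R \<longleftrightarrow> (\<forall>e\<in>R. e * e = e \<longrightarrow> e = 0 \<or> (\<forall>x\<in>R. e * x = x))"

lemma nilpotent_or_unit:
  assumes R: "subrng R" "finite R" "indecomposable R" and e: "e \<in> R" "e * e = e" "e \<noteq> 0"
    and x: "x \<in> R" "x \<notin> nilrad R"
  obtains k where "k > 0" "x ^ k = (e::'a::comm_ring_1)"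
proof -
  obtain k where k: "k > 0" "x ^ k * x ^ k = x ^ k"
    using power_idempotent_exists[OF R(1,2) x(1)] by blast
  have "x ^ k \<noteq> 0" using x by (auto simp: nilrad_def)
  moreover have xk: "x ^ k \<in> R" using R x k by (intro subrng_power) auto
  ultimately have "x ^ k * e = e" using R(3) k e by (auto simp: indecomposable_def)
  moreover have "e * x ^ k = x ^ k" using R(3) e xk by (auto simp: indecomposable_def)
  ultimately show ?thesis using that k by (metis mult.commute)
qed

text \<open>For \<open>T\<close> inside \<open>R\<close> and N the nilradical, this says that a
  proper extension T/N of the field S/N has at least |S/N|^2 elements. If s + y t = 0 with t not
  nilpotent, a power of t is the identity \<open>e\<close>, and solving for \<open>y\<close> would
  put it into \<open>S\<close>. So the second component embeds the kernel of (s, t) \<mapsto> s + y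
  t into N.\<close>

lemma card_adjoin:
  assumes R: "subrng R" "finite R" "indecomposable R" and e: "e \<in> R" "e * e = e" "e \<noteq> 0"
    and S: "subrng S" "nilrad R \<subseteq> S" "e \<in> S" "S \<subseteq> R" and y: "y \<in> R" "y \<notin> S"
    and T: "subrng T" "S \<subseteq> T" "y \<in> T" "finite T"
  shows "card S ^ 2 \<le> card T * card (nilrad (R::'a::comm_ring_1 set))"
proof -
  let ?f = "\<lambda>(s, t). s + y * t"
  have fS: "finite S" using R S finite_subset by blast
  have "card (S \<times> S) = card (?f ` (S \<times> S)) * card {x \<in> S \<times> S. ?f x = 0}"
    using S fS by (intro card_hom_image subgrp_Times) (auto simp: subrng_def algebra_simps)
  moreover have "card (?f ` (S \<times> S)) \<le> card T"
    using T by (intro card_mono) (auto simp: subrng_def intro!: subgrp_add)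
  moreover have "card {x \<in> S \<times> S. ?f x = 0} \<le> card (nilrad R)"
  proof (rule card_inj_on_le[of snd])
    show "inj_on snd {x \<in> S \<times> S. ?f x = 0}" by (auto simp: inj_on_def add_eq_0_iff2)
    show "finite (nilrad R)" using R nilrad_subset finite_subset by blast
    show "snd ` {x \<in> S \<times> S. ?f x = 0} \<subseteq> nilrad R"
    proof clarify
      fix s t assume st: "s \<in> S" "t \<in> S" "s + y * t = 0"
      then have yt: "y * t = - s" by (simp add: add_eq_0_iff)
      have "t \<in> nilrad R"
      proof (rule ccontr)
        assume "t \<notin> nilrad R"
        then obtain k where k: "k > 0" "t ^ k = e"
          using nilpotent_or_unit[OF R e, of t] st S by blast
        have ts: "t ^ m * s \<in> S" for m
          using st S(1) by (induction m) (auto intro: subrng_mult simp: mult.assoc)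
        have "e * y = y" using R(3) e y unfolding indecomposable_def by blast
        then have "y = y * e" by (simp add: mult.commute)
        also have "\<dots> = t ^ (k - 1) * (y * t)" using k by (cases k) (auto simp: algebra_simps)
        also have "\<dots> \<in> S" using ts S(1) by (auto simp: yt subrng_def intro: subgrp_uminus)
        finally show False using y by simp
      qed
      then show "snd (s, t) \<in> nilrad R" by simp
    qed
  qed
  ultimately have "card (S \<times> S) \<le> card T * card (nilrad R)" by (simp add: mult_mono)
  then show ?thesis by (simp add: card_cartesian_product power2_eq_square)
qed

definition generates_over :: "'a::comm_ring_1 list \<Rightarrow> 'a set \<Rightarrow> 'a set \<Rightarrow> bool"
  where "generates_over gs N R \<longleftrightarrow> (\<forall>S. subrng S \<longrightarrow> N \<subseteq> S \<longrightarrow> set gs \<subseteq> S \<longrightarrow> S \<subseteq> R \<longrightarrow> S = R)"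

text \<open>By \<open>card_adjoin\<close>, each generator outside the ring obtained so far squares
  the lower bound on the order of its residue field, so m steps give p^(2^m), and about log n
  generators suffice. The weaker bound \<open>2 * T + 1\<close> is stated because \<open>T\<close>
  is the scale of the other lists. Without a nonzero idempotent, \<open>R\<close> is its own
  nilradical.\<close>

lemma few_generators_over_nilrad:
  assumes R: "subrng R" "finite R" "indecomposable R" "card R = p ^ n" and p: "Factorial_Ring.prime p"
    and nT: "n \<le> T * T"
  shows "\<exists>gs. set gs \<subseteq> R \<and> length gs \<le> 2 * T + 1 \<and> generates_over gs (nilrad R) (R::'a::comm_ring_1 set)"
proof (cases "\<exists>e\<in>R. e * e = e \<and> e \<noteq> 0")
  case False
  have "x \<in> nilrad R" if x: "x \<in> R" for x
  proof -
    obtain k where "k > 0" "x ^ k * x ^ k = x ^ k"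
      using power_idempotent_exists[OF R(1,2) x] by blast
    then show ?thesis using False subrng_power[OF R(1) x] x by (auto intro: nilradI)
  qed
  then show ?thesis by (intro exI[of _ "[]"]) (auto simp: generates_over_def)
next
  case True
  then obtain e where e: "e \<in> R" "e * e = e" "e \<noteq> 0" by blast
  let ?N = "nilrad R"
  have N: "subgrp ?N" "finite ?N" using R subgrp_nilrad nilrad_subset finite_subset by blast+
  have p1: "1 < p" using p by (rule prime_gt_1_nat)
  have pow: "\<exists>k. card H = p ^ k" if "subgrp H" "H \<subseteq> R" for H
    using card_finite_subgrp_power[OF subrng_subgrp[OF R(1)] R(2) p R(4) that] by metis
  define big where "big gs m \<longleftrightarrow>
    (\<forall>S. subrng S \<longrightarrow> ?N \<subseteq> S \<longrightarrow> set gs \<subseteq> S \<longrightarrow> S \<subseteq> R \<longrightarrow> p ^ (2 ^ m) * card ?N \<le> card S)" for gs m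
  have "\<exists>gs. set gs \<subseteq> R \<and> length gs \<le> m + 1 \<and> e \<in> set gs \<and> (generates_over gs ?N R \<or> big gs m)" for m
  proof (induction m)
    case 0
    have "big [e] 0"
      unfolding big_def
    proof (intro allI impI)
      fix S assume S: "subrng S" "?N \<subseteq> S" "set [e] \<subseteq> S" "S \<subseteq> R"
      have "e ^ k \<noteq> 0" for k
      proof (cases k)
        case (Suc m)
        have "e ^ Suc m = e" by (induction m) (use e in auto)
        then show ?thesis using Suc e by simp
      qed (use e in auto)
      then have "e \<notin> ?N" by (auto simp: nilrad_def)
      then have "card ?N < card S"
        using S R finite_subset by (intro psubset_card_mono) auto
      moreover obtain i j where ij: "card ?N = p ^ i" "card S = p ^ j"
        using pow N S nilrad_subset subrng_subgrp by metis
      ultimately have "i < j" using p1 by simp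
      then have "p ^ Suc i \<le> p ^ j" using p1 by (intro power_increasing) auto
      then show "p ^ (2 ^ 0) * card ?N \<le> card S" by (simp add: ij)
    qed
    then show ?case using e by (intro exI[of _ "[e]"]) auto
  next
    case (Suc m)
    then obtain gs where gs: "set gs \<subseteq> R" "length gs \<le> m + 1" "e \<in> set gs" "generates_over gs ?N R \<or> big gs m"
      by blast
    show ?case
    proof (cases "generates_over gs ?N R")
      case True
      then show ?thesis using gs by (intro exI[of _ gs]) auto
    next
      case False
      then have b: "big gs m" using gs by simp
      \<comment> \<open>The ring generated by the nilradical and \<open>gs\<close> inside
        \<open>R\<close>: it is proper because \<open>gs\<close> does not generate, and it lies in
        every ring over which \<open>big\<close> quantifies.\<close>
      define S where "S = \<Inter>{S. subrng S \<and> ?N \<subseteq> S \<and> set gs \<subseteq> S \<and> S \<subseteq> R}"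
      obtain S1 where S1: "subrng S1" "?N \<subseteq> S1" "set gs \<subseteq> S1" "S1 \<subseteq> R" "S1 \<noteq> R"
        using False by (auto simp: generates_over_def)
      have S: "subrng S" "?N \<subseteq> S" "set gs \<subseteq> S" "S \<subseteq> S1"
        unfolding S_def using S1 by (auto simp: subrng_def subgrp_def)
      obtain y where y: "y \<in> R" "y \<notin> S" using S S1 by blast
      have "big (y # gs) (Suc m)"
        unfolding big_def
      proof (intro allI impI)
        fix T assume T: "subrng T" "?N \<subseteq> T" "set (y # gs) \<subseteq> T" "T \<subseteq> R"
        have "S \<subseteq> T" unfolding S_def using T by auto
        then have "card S ^ 2 \<le> card T * card ?N"
          using S S1 T gs y R by (intro card_adjoin[OF R(1-3) e, of S y T]) (auto intro: finite_subset)
        moreover have "p ^ (2 ^ m) * card ?N \<le> card S"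
          using b S S1 unfolding big_def by blast
        then have "(p ^ (2 ^ m) * card ?N) ^ 2 \<le> card S ^ 2" by (intro power_mono) auto
        ultimately have "(p ^ (2 ^ m) * card ?N) ^ 2 \<le> card T * card ?N" by linarith
        then have "(p ^ (2 ^ Suc m) * card ?N) * card ?N \<le> card T * card ?N"
          by (simp add: power_mult_distrib power2_eq_square mult_2 power_add ac_simps flip: power_mult)
        then show "p ^ (2 ^ Suc m) * card ?N \<le> card T"
          using card_subgrp_pos[OF N] by simp
      qed
      then show ?thesis using gs y by (intro exI[of _ "y # gs"]) auto
    qed
  qed
  then obtain gs where gs: "set gs \<subseteq> R" "length gs \<le> 2 * T + 1" "generates_over gs ?N R \<or> big gs (2 * T)"
    by blast
  have "\<not> big gs (2 * T)"
  proof
    assume "big gs (2 * T)"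
    then have "p ^ (2 ^ (2 * T)) * card ?N \<le> p ^ n"
      using R gs nilrad_subset unfolding big_def by (metis order.refl)
    then have "p ^ (2 ^ (2 * T)) \<le> p ^ n"
      using card_subgrp_pos[OF N] by (metis One_nat_def Suc_leI le_trans mult_le_mono2 nat_mult_1_right)
    then have "2 ^ (2 * T) \<le> n" using p1 by (simp add: power_increasing_iff)
    moreover have "T * T < 2 ^ (2 * T)"
      using less_exp[of T] by (simp add: mult_2 power_add mult_strict_mono)
    ultimately show False using nT by linarith
  qed
  then show ?thesis using gs by blast
qed

section \<open>Presentations of indecomposable rings\<close>

lemma ncomb_pad: "m \<le> n \<Longrightarrow> ncomb a m v = ncomb a n (\<lambda>i. if i < m then v i else 0)"
  unfolding ncomb_def by (rule sum.mono_neutral_cong_left) auto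

lemma ncomb_unit: "i < n \<Longrightarrow> ncomb a n (\<lambda>j. if j = i then 1 else 0) = a i"
proof -
  have "of_nat (if j = i then 1 else 0) * a j = (if j = i then a j else 0)" for j by simp
  then show "i < n \<Longrightarrow> ?thesis" by (simp add: ncomb_def)
qed

lemma psum_mono: "subgrp V \<Longrightarrow> set ys \<subseteq> set zs \<Longrightarrow> psum ys V \<subseteq> psum zs V"
  by (intro psum_least subgrp_psum psum_mem) auto

lemma psum_closed:
  assumes "subgrp V" "\<And>v. v \<in> V \<Longrightarrow> y * v \<in> V" "w \<in> psum ys V"
  shows "y * w \<in> psum ys V"
proof -
  have "subgrp {w. y * w \<in> psum ys V}"
    using subgrp_psum[OF assms(1), of ys] by (auto simp: subgrp_def right_diff_distrib)
  moreover have "y * (z * v) \<in> psum ys V" if "z \<in> set ys" "v \<in> V" for z v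
    using psum_mem[OF assms(1) that(1), of "y * v"] assms(2) that by (simp add: mult.left_commute)
  ultimately have "psum ys V \<subseteq> {w. y * w \<in> psum ys V}" by (intro psum_least) auto
  then show ?thesis using assms(3) by auto
qed

text \<open>Substituting Z \<subseteq> y Z + P into itself gives Z \<subseteq> y^k Z + P, where P is
  the sum over the rest of the list; a vanishing power of y therefore removes y from the
  list.\<close>

lemma nakayama_nilpotent:
  assumes Z: "subgrp Z" "\<And>y z. y \<in> set ys \<Longrightarrow> z \<in> Z \<Longrightarrow> y * z \<in> Z"
    and nil: "\<And>y. y \<in> set ys \<Longrightarrow> \<exists>k. y ^ k = 0"
    and sub: "Z \<subseteq> psum ys (Z :: 'a::comm_ring_1 set)"
  shows "Z \<subseteq> {0}"
  using Z(2) nil sub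
proof (induction ys)
  case (Cons y ys)
  have P: "subgrp (psum ys Z)" by (intro subgrp_psum Z)
  have yP: "y ^ k * w \<in> psum ys Z" if "w \<in> psum ys Z" for w k
    using that psum_closed[OF Z(1), of y] Cons.prems(1) by (induction k) (auto simp: mult.assoc)
  have iter: "\<exists>q\<in>Z. \<exists>w\<in>psum ys Z. z = y ^ k * q + w" if "z \<in> Z" for z k
  proof (induction k)
    case 0
    have "z = y ^ 0 * z + 0" by simp
    then show ?case using that subgrp_zero[OF P] by blast
  next
    case (Suc k)
    then obtain q w where qw: "q \<in> Z" "w \<in> psum ys Z" "z = y ^ k * q + w" by blast
    have "q \<in> (*) y ` Z + psum ys Z" using Cons.prems(3) qw by auto
    then obtain q' w' where "q' \<in> Z" "w' \<in> psum ys Z" "q = y * q' + w'"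
      by (auto simp: set_plus_def)
    with qw have "z = y ^ Suc k * q' + (y ^ k * w' + w)" "q' \<in> Z" "y ^ k * w' + w \<in> psum ys Z"
      using P yP by (auto simp: algebra_simps intro: subgrp_add)
    then show ?case by blast
  qed
  obtain k where "y ^ k = 0" using Cons.prems(2)[of y] by auto
  then have "Z \<subseteq> psum ys Z" using iter[of _ k] by fastforce
  then show ?case using Cons by auto
qed auto

definition mid_span :: "(nat \<Rightarrow> 'a::comm_ring_1) \<Rightarrow> nat \<Rightarrow> nat \<Rightarrow> 'a set"
  where "mid_span a s r = range (\<lambda>v. \<Sum>i\<in>{s..<s + r}. of_nat (v i) * a i)"

lemma mid_span_least: "subgrp H \<Longrightarrow> (\<And>i. s \<le> i \<Longrightarrow> i < s + r \<Longrightarrow> a i \<in> H) \<Longrightarrow> mid_span a s r \<subseteq> H"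
  by (auto simp: mid_span_def intro!: subgrp_sum subgrp_of_nat)

lemma mid_span_0: "0 \<in> mid_span a s r"
  unfolding mid_span_def by (rule range_eqI[of _ _ "\<lambda>_. 0"]) simp

lemma mid_span_add:
  assumes "x \<in> mid_span a s r" "y \<in> mid_span a s r"
  shows "x + of_nat k * y \<in> mid_span a s r"
proof -
  obtain v w where "x = (\<Sum>i\<in>{s..<s + r}. of_nat (v i) * a i)" "y = (\<Sum>i\<in>{s..<s + r}. of_nat (w i) * a i)"
    using assms by (auto simp: mid_span_def)
  then have "x + of_nat k * y = (\<Sum>i\<in>{s..<s + r}. of_nat (v i + k * w i) * a i)"
    by (simp add: sum.distrib sum_distrib_left algebra_simps)
  then show ?thesis unfolding mid_span_def by (intro range_eqI[where x = "\<lambda>i. v i + k * w i"])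
qed

lemma ncomb_split: "ncomb a (s + r) v = ncomb a s v + (\<Sum>i\<in>{s..<s + r}. of_nat (v i) * a i)"
  unfolding ncomb_def lessThan_atLeast0 by (subst sum.atLeastLessThan_concat) auto

text \<open>
  Intended: \<open>nspan a (s + r)\<close> is the nilradical \<open>N\<close> and \<open>nspan a s\<close> is \<open>N\<^sup>2 + p N\<close>. The first \<open>4 T\<close> of the
  elements \<open>y k\<close> span \<open>N\<^sup>2\<close> as \<open>\<Sum> (y k) N\<close>, and the remaining ones generate \<open>R\<close> over \<open>N\<close>.
\<close>

definition presentation ::
    "nat \<Rightarrow> nat \<Rightarrow> nat \<Rightarrow> nat \<Rightarrow> nat \<Rightarrow> 'a::comm_ring_1 set \<Rightarrow> (nat \<Rightarrow> 'a) \<Rightarrow> (nat \<Rightarrow> 'a) \<Rightarrow> bool"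
  where "presentation p n T s r R a y \<longleftrightarrow>
    subrng R \<and> finite R \<and> s + r \<le> n \<and> pchain p a n \<and> nspan a n = R \<and>
    (\<forall>u\<in>nspan a (s + r). \<forall>v\<in>R. u * v \<in> nspan a (s + r)) \<and>
    (\<forall>k<7 * T. y k \<in> R) \<and>
    (\<forall>k<4 * T. \<exists>m. y k ^ m = 0) \<and>
    nspan a (s + r) \<subseteq> mid_span a s r + psum (map y [0..<4 * T]) (nspan a (s + r)) \<and>
    (\<forall>i\<in>{s..<s + r}. \<forall>j\<in>{s..<s + r}. a i * a j \<in> nspan a s) \<and>
    generates_over (map y [4 * T..<7 * T]) (nspan a (s + r)) R"

lemma presentation_exists:
  assumes R: "subrng R" "finite R" "indecomposable R" "card R = p ^ n" and p: "Factorial_Ring.prime p"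
    and T: "T > 0" "n \<le> T * T"
  shows "\<exists>s r a y. presentation p n T s r (R :: 'a::comm_ring_1 set) a y"
proof -
  let ?N = "nilrad R"
  have p1: "1 < p" using p by (rule prime_gt_1_nat)
  have R': "subgrp R" using R(1) by (rule subrng_subgrp)
  have N: "subrng ?N" "subgrp ?N" "?N \<subseteq> R" "finite ?N"
    using subrng_nilrad[OF R(1)] subgrp_nilrad[OF R(1)] nilrad_subset[of R]
      finite_subset[OF nilrad_subset R(2)] by auto
  have kill: "of_nat (p ^ n) * x = 0" if "x \<in> R" for x
    using card_times_eq_0[OF R' R(2) that] R(4) by simp
  obtain m where m: "card ?N = p ^ m" by (rule card_finite_subgrp_power[OF R' R(2) p R(4) N(2,3)])
  have "p ^ m \<le> p ^ n" using card_mono[OF R(2) N(3)] m R by simp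
  then have "m \<le> T * T" using p1 T by (simp add: power_increasing_iff)
  then obtain ys where ys: "set ys \<subseteq> ?N" "length ys \<le> 4 * T" "\<forall>x\<in>?N. \<forall>y\<in>?N. x * y \<in> psum ys ?N"
    using square_cover[OF N(1,4) m p T(1)] by blast
  obtain gs where gs: "set gs \<subseteq> R" "length gs \<le> 2 * T + 1" "generates_over gs ?N R"
    using few_generators_over_nilrad[OF R p T(2)] by blast
  \<comment> \<open>Both lists are padded with zeros to fixed lengths: 4 T slots for the cover of
    N^2, and 3 T slots for the at most 2 T + 1 generators, enough since T > 0.\<close>
  define y where "y k = (if k < 4 * T then if k < length ys then ys ! k else 0
    else if k - 4 * T < length gs then gs ! (k - 4 * T) else 0)" for k
  have yN: "y k \<in> ?N" if "k < 4 * T" for k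
    using that ys N by (auto simp: y_def subgrp_zero)
  have yR: "y k \<in> R" for k
    using yN[of k] gs(1) N(3) R' nth_mem[of "k - 4 * T" gs] by (auto simp: y_def subgrp_zero)
  have ys': "set ys \<subseteq> set (map y [0..<4 * T])"
  proof
    fix z assume "z \<in> set ys"
    then obtain k where "k < length ys" "z = ys ! k" by (auto simp: in_set_conv_nth)
    then show "z \<in> set (map y [0..<4 * T])" using ys(2) by (auto simp: y_def intro!: image_eqI[of _ _ k])
  qed
  have gs': "set gs \<subseteq> set (map y [4 * T..<7 * T])"
  proof
    fix z assume "z \<in> set gs"
    then obtain k where "k < length gs" "z = gs ! k" by (auto simp: in_set_conv_nth)
    then show "z \<in> set (map y [4 * T..<7 * T])"
      using gs(2) T(1) by (auto simp: y_def intro!: image_eqI[of _ _ "4 * T + k"])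
  qed
  \<comment> \<open>This is N^2 + pN, since \<open>psum ys ?N\<close> contains all products of
    elements of N and consists of sums of such products. The chain is built through it and N up to
    \<open>R\<close>.\<close>
  define \<Phi> where "\<Phi> = psum ys ?N + (*) (of_nat p) ` ?N"
  have Ps: "subgrp (psum ys ?N)" "psum ys ?N \<subseteq> ?N"
    using N ys by (auto intro: subgrp_psum set_mp[OF subrng_psum_subset])
  have \<Phi>: "subgrp \<Phi>" "\<Phi> \<subseteq> ?N"
  proof -
    show "subgrp \<Phi>" unfolding \<Phi>_def by (intro subgrp_plus subgrp_scale Ps N)
    have "(*) (of_nat p) ` ?N \<subseteq> ?N" using N by (auto intro: subgrp_of_nat)
    then show "\<Phi> \<subseteq> ?N" unfolding \<Phi>_def by (intro plus_least Ps N)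
  qed
  have "\<exists>b l. 0 \<le> l \<and> pchain p b l \<and> nspan b l = \<Phi> \<and> (\<forall>i<0. b i = (0::'a))"
    using \<Phi> N by (intro pchain_extend[OF _ _ _ _ p kill]) (auto simp: pchain_def subgrp_zero intro: finite_subset)
  then obtain a0 s where a0: "pchain p a0 s" "nspan a0 s = \<Phi>" by blast
  have "\<exists>b l. s \<le> l \<and> pchain p b l \<and> nspan b l = ?N \<and> (\<forall>i<s. b i = a0 i)"
    using \<Phi> a0 N by (intro pchain_extend[OF _ _ _ _ p kill]) auto
  then obtain a1 l where a1: "s \<le> l" "pchain p a1 l" "nspan a1 l = ?N" "\<forall>i<s. a1 i = a0 i" by blast
  have "\<exists>b n'. l \<le> n' \<and> pchain p b n' \<and> nspan b n' = R \<and> (\<forall>i<l. b i = a1 i)"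
    using a1 N R R' by (intro pchain_extend[OF _ _ _ _ p kill]) auto
  then obtain a n' where a: "l \<le> n'" "pchain p a n'" "nspan a n' = R" "\<forall>i<l. a i = a1 i" by blast
  obtain r where r: "l = s + r" using a1(1) le_Suc_ex by blast
  have "p ^ n' = p ^ n" using card_nspan[OF a(2) p order.refl] a(3) R(4) by simp
  then have n': "n' = n" using p1 by (simp add: power_inject_exp)
  have al: "nspan a (s + r) = ?N" using nspan_cong[of l a a1] a a1 r by simp
  have as: "nspan a s = \<Phi>" using nspan_cong[of s a a0] a a1 a0 r by simp
  let ?X = "mid_span a s r"
  have dec: "\<exists>\<xi>\<in>?X. \<exists>w\<in>psum ys ?N. \<exists>z\<in>?N. x = \<xi> + w + of_nat p * z" if x: "x \<in> ?N" for x
  proof -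
    obtain v where v: "x = ncomb a s v + (\<Sum>i\<in>{s..<s + r}. of_nat (v i) * a i)"
      using x unfolding al[symmetric] by (auto simp: nspan_def ncomb_split)
    have "ncomb a s v \<in> \<Phi>" using as by auto
    then obtain w z where "w \<in> psum ys ?N" "z \<in> ?N" "ncomb a s v = w + of_nat p * z"
      by (auto simp: \<Phi>_def set_plus_def)
    with v show ?thesis by (force simp: mid_span_def ac_simps)
  qed
  \<comment> \<open>The decomposition is substituted into its own last term. After n rounds the
    factor p^n annihilates that term, so pN disappears from the cover.\<close>
  have iter: "\<exists>\<xi>\<in>?X. \<exists>w\<in>psum ys ?N. \<exists>z\<in>?N. x = \<xi> + w + of_nat (p ^ k) * z" if x: "x \<in> ?N" for x k
  proof (induction k)
    case 0
    show ?case
      using x Ps mid_span_0 by (intro bexI[of _ 0] bexI[of _ x]) (auto simp: subgrp_zero)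
  next
    case (Suc k)
    then obtain \<xi> w z where 1: "\<xi> \<in> ?X" "w \<in> psum ys ?N" "z \<in> ?N" "x = \<xi> + w + of_nat (p ^ k) * z"
      by blast
    obtain \<xi>' w' z' where 2: "\<xi>' \<in> ?X" "w' \<in> psum ys ?N" "z' \<in> ?N" "z = \<xi>' + w' + of_nat p * z'"
      using dec[OF 1(3)] by blast
    have "x = (\<xi> + of_nat (p ^ k) * \<xi>') + (w + of_nat (p ^ k) * w') + of_nat (p ^ Suc k) * z'"
      unfolding 1(4) 2(4) by (simp add: algebra_simps)
    moreover have "\<xi> + of_nat (p ^ k) * \<xi>' \<in> ?X" using 1 2 by (intro mid_span_add)
    moreover have "w + of_nat (p ^ k) * w' \<in> psum ys ?N"
      using 1 2 Ps by (intro subgrp_add subgrp_of_nat)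
    ultimately show ?case using 2(3) by blast
  qed
  have cov: "?N \<subseteq> ?X + psum (map y [0..<4 * T]) ?N"
  proof
    fix x assume x: "x \<in> ?N"
    obtain \<xi> w z where xi: "\<xi> \<in> ?X" "w \<in> psum ys ?N" "z \<in> ?N" "x = \<xi> + w + of_nat (p ^ n) * z"
      using iter[OF x, of n] by blast
    then have "x = \<xi> + w" using kill[of z] N by auto
    then show "x \<in> ?X + psum (map y [0..<4 * T]) ?N"
      using xi psum_mono[OF N(2) ys'] by (auto intro: set_plus_intro)
  qed
  have "a i * a j \<in> nspan a s" if "i \<in> {s..<s + r}" "j \<in> {s..<s + r}" for i j
  proof -
    have "a i \<in> ?N" "a j \<in> ?N" using that gen_in_nspan[of _ "s + r" a] al by auto
    then have "a i * a j \<in> psum ys ?N" using ys by auto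
    moreover have "0 \<in> (*) (of_nat p) ` ?N" using N by (intro subgrp_zero subgrp_scale)
    ultimately show ?thesis unfolding as \<Phi>_def by (metis add.right_neutral set_plus_intro)
  qed
  moreover have "generates_over (map y [4 * T..<7 * T]) ?N R"
    using gs(3) gs' unfolding generates_over_def by blast
  moreover have "\<exists>m. y k ^ m = 0" if "k < 4 * T" for k
    using yN[OF that] by (auto simp: nilrad_def)
  ultimately have "presentation p n T s r R a y"
    unfolding presentation_def al using R a n' r yR cov nilrad_ideal[OF R(1)] by auto
  then show ?thesis by blast
qed

text \<open>Equal power relations give an additive isomorphism \<open>h\<close>; its multiplicative
  defect \<open>D\<close> has to vanish. The data make \<open>D\<close> vanish if one argument is a
  y_k, or if both lie in the span of the x_i. On N this forces the values of \<open>D\<close> into a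
  subgroup \<open>Z\<close> that equals the sum of its multiples by the y'_k and hence is 0. From N
  the vanishing spreads to \<open>R\<close>, because the elements whose defect with all of
  \<open>R\<close> is zero form a subring containing the generators over N.\<close>

lemma presentation_determines:
  fixes R R' :: "'a::comm_ring_1 set"
  assumes P: "presentation p n T s r R a y" and P': "presentation p n T s r R' a' y'"
    and p: "Factorial_Ring.prime p"
    and rel: "\<And>m. m < n \<Longrightarrow> same_coords a a' m (of_nat p * a m) (of_nat p * a' m)"
    and y: "\<And>k. k < 7 * T \<Longrightarrow> same_coords a a' n (y k) (y' k)"
    and ya: "\<And>k j. k < 7 * T \<Longrightarrow> j < n \<Longrightarrow> same_coords a a' n (y k * a j) (y' k * a' j)"
    and aa: "\<And>i j. s \<le> i \<Longrightarrow> i \<le> j \<Longrightarrow> j < s + r \<Longrightarrow> same_coords a a' s (a i * a j) (a' i * a' j)"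
  shows "\<exists>h. bij_betw h R R' \<and> (\<forall>u\<in>R. \<forall>v\<in>R. h (u + v) = h u + h v \<and> h (u * v) = h u * h v)"
proof -
  let ?N = "nspan a (s + r)" and ?N' = "nspan a' (s + r)"
  have R: "subrng R" "subgrp R" "s + r \<le> n" "pchain p a n" "nspan a n = R"
    using P by (auto simp: presentation_def subrng_def)
  have R': "subrng R'" "subgrp R'" "finite R'" "pchain p a' n" "nspan a' n = R'"
    using P' by (auto simp: presentation_def subrng_def)
  have NR: "?N \<subseteq> R" and N'R': "?N' \<subseteq> R'"
    using nspan_mono[OF R(3), of a] nspan_mono[OF R(3), of a'] R R' by auto
  have N: "subgrp ?N"
    using subgrp_nspan[OF R(4) R(3)] p prime_gt_0_nat by blast
  have id: "u * v \<in> ?N" if "u \<in> ?N" "v \<in> R" for u v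
    using P that by (auto simp: presentation_def)
  obtain h where h: "\<And>v. h (ncomb a n v) = ncomb a' n v" "bij_betw h R R'"
    and add: "\<And>u v. u \<in> R \<Longrightarrow> v \<in> R \<Longrightarrow> h (u + v) = h u + h v"
    using same_coords_iso[OF R(4) R'(4) p rel] R(5) R'(5) by metis
  have sc: "h u = u'" if m: "same_coords a a' m u u'" "m \<le> n" for u u' m
  proof -
    obtain v where "u = ncomb a m v" "u' = ncomb a' m v" using m(1) unfolding same_coords_def by blast
    then show ?thesis using h(1) ncomb_pad[OF m(2), of a v] ncomb_pad[OF m(2), of a' v] by metis
  qed
  have aR: "a i \<in> R" if "i < n" for i using gen_in_nspan[OF that, of a] R by simp
  have yR: "y k \<in> R" if "k < 7 * T" for k using P that by (auto simp: presentation_def)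
  have hR: "h u \<in> R'" if "u \<in> R" for u using h(2) that by (auto simp: bij_betw_def)
  have hN: "h u \<in> ?N'" if "u \<in> ?N" for u
    using that sc R(3) by (fastforce simp: nspan_def same_coords_def)
  have ha: "h (a i) = a' i" if "i < n" for i
    using h(1)[of "\<lambda>j. if j = i then 1 else 0"] ncomb_unit[OF that] by metis
  have hy: "h (y k) = y' k" if "k < 7 * T" for k using sc[OF y[OF that]] by simp
  have diff: "h (u - v) = h u - h v" if "u \<in> R" "v \<in> R" for u v
    using add[of "u - v" v] that R(2) by (simp add: subgrp_diff)
  have h0: "h 0 = 0" using diff[of 0 0] R(2) by (simp add: subgrp_zero)
  define D where "D u v = h (u * v) - h u * h v" for u v
  have Dc: "D u v = D v u" for u v by (simp add: D_def mult.commute)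
  have Dd: "D (u - u') v = D u v - D u' v" if "u \<in> R" "u' \<in> R" "v \<in> R" for u u' v
    using that R(1) by (simp add: D_def diff left_diff_distrib subrng_mult)
  have Da: "D (u + u') v = D u v + D u' v" if "u \<in> R" "u' \<in> R" "v \<in> R" for u u' v
    using that R(1) by (simp add: D_def add distrib_right subrng_mult)
  have D0: "D 0 v = 0" for v by (simp add: D_def h0)
  have sgD: "subgrp {u\<in>R. D u v = 0}" if "v \<in> R" for v
    using R(2) that by (auto simp: subgrp_def Dd D0)
  have Dy: "D (y k) v = 0" if k: "k < 7 * T" and v: "v \<in> R" for k v
  proof -
    have "nspan a n \<subseteq> {u\<in>R. D u (y k) = 0}"
    proof (intro nspan_least sgD yR k)
      fix j assume "j < n"
      then have "D (y k) (a j) = 0"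
        using sc[OF ya[OF k]] by (simp add: D_def ha hy k)
      then show "a j \<in> {u\<in>R. D u (y k) = 0}" using aR \<open>j < n\<close> Dc by simp
    qed
    then show ?thesis using v R(5) Dc by auto
  qed
  have DX: "D u v = 0" if uX: "u \<in> mid_span a s r" and vX: "v \<in> mid_span a s r" for u v
  proof -
    have aa': "D (a i) (a j) = 0" if "s \<le> i" "i < s + r" "s \<le> j" "j < s + r" for i j
    proof -
      have *: "D (a i) (a j) = 0" if "s \<le> i" "i \<le> j" "j < s + r" for i j
        using sc[OF aa[OF that]] that R(3) by (simp add: D_def ha)
      show ?thesis using *[of i j] *[of j i] that Dc[of "a i" "a j"] by (metis nle_le)
    qed
    have mid: "mid_span a s r \<subseteq> {u\<in>R. D u v = 0}"
      if "v \<in> R" "\<And>i. s \<le> i \<Longrightarrow> i < s + r \<Longrightarrow> D (a i) v = 0" for v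
      using that aR R(3) by (intro mid_span_least sgD) auto
    have "u \<in> {u\<in>R. D u (a j) = 0}" if "s \<le> j" "j < s + r" for j
      using uX mid[of "a j"] that R(3) aa' aR by auto
    then have uj: "D (a j) u = 0" if "s \<le> j" "j < s + r" for j using that Dc[of u "a j"] by auto
    have uR: "u \<in> R"
      using uX R(3) aR mid_span_least[OF R(2), of s r a] by auto
    have "v \<in> {v\<in>R. D v u = 0}"
      using vX mid[OF uR] uj by auto
    then show ?thesis using Dc[of u v] by simp
  qed
  let ?ys = "map y [0..<4 * T]" and ?hs = "map y' [0..<4 * T]"
  define good where "good Z \<longleftrightarrow> subgrp Z \<and> Z \<subseteq> R' \<and> (\<forall>x\<in>set ?hs. \<forall>z\<in>Z. x * z \<in> Z) \<and>
    (\<forall>u\<in>?N. \<forall>v\<in>?N. D u v \<in> Z)" for Z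
  have y'R: "y' k \<in> R'" if "k < 7 * T" for k using P' that by (auto simp: presentation_def)
  have gR': "good R'"
    unfolding good_def
  proof (intro conjI ballI)
    show "x * z \<in> R'" if "x \<in> set ?hs" "z \<in> R'" for x z
      using that y'R R'(1) by (auto intro: subrng_mult)
    show "D u v \<in> R'" if "u \<in> ?N" "v \<in> ?N" for u v
    proof -
      have "u \<in> R" "v \<in> R" using that NR by auto
      then show ?thesis
        unfolding D_def by (intro subgrp_diff R' hR subrng_mult[OF R'(1)] subrng_mult[OF R(1)])
    qed
  qed (use R' in auto)
  \<comment> \<open>A good subgroup of least order is taken: \<open>psum ?hs Z\<close> will be good
    as well and is contained in \<open>Z\<close>, so the two coincide, which is the input of
    \<open>nakayama_nilpotent\<close>.\<close>
  have "\<exists>Z. good Z \<and> (\<forall>Z'. good Z' \<longrightarrow> card Z \<le> card Z')"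
    by (rule ex_has_least_nat) (rule gR')
  then obtain Z where Z0: "good Z \<and> (\<forall>Z'. good Z' \<longrightarrow> card Z \<le> card Z')" ..
  then have Z: "good Z" "\<And>Z'. good Z' \<Longrightarrow> card Z \<le> card Z'" by simp_all
  then have Zs: "subgrp Z" "Z \<subseteq> R'" "finite Z" using R' finite_subset by (auto simp: good_def)
  have Zc: "x * z \<in> Z" if "x \<in> set ?hs" "z \<in> Z" for x z using Z that by (auto simp: good_def)
  have PZ: "psum ?hs Z \<subseteq> Z" using Zs Zc by (intro psum_least) auto
  have "good (psum ?hs Z)"
    unfolding good_def
  proof (intro conjI ballI)
    show "subgrp (psum ?hs Z)" by (intro subgrp_psum Zs)
    then have P0: "0 \<in> psum ?hs Z" by (rule subgrp_zero)
    show "psum ?hs Z \<subseteq> R'" using PZ Zs by auto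
    show "x * z \<in> psum ?hs Z" if "x \<in> set ?hs" "z \<in> psum ?hs Z" for x z
      using Zc that by (intro psum_closed Zs)
    have DP: "D w v \<in> psum ?hs Z" if w: "w \<in> psum ?ys ?N" and v: "v \<in> ?N" for w v
    proof -
      have "psum ?ys ?N \<subseteq> {w\<in>R. D w v \<in> psum ?hs Z}"
      proof (rule psum_least)
        show "subgrp {w\<in>R. D w v \<in> psum ?hs Z}"
          using R(2) subgrp_psum[OF Zs(1), of ?hs] v NR by (auto simp: subgrp_def Dd D0)
        fix x c assume "x \<in> set ?ys" and c: "c \<in> ?N"
        then obtain k where k: "k < 4 * T" "x = y k" by auto
        have cR: "c \<in> R" "v \<in> R" "c * v \<in> R" using c v NR R(1) by (auto intro: subrng_mult)
        have k7: "k < 7 * T" using k by simp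
        have "h (y k * u) = y' k * h u" if "u \<in> R" for u
          using Dy[OF k7 that] by (simp add: D_def hy[OF k7])
        \<comment> \<open>Associativity in both rings pulls y'_k out of the defect, so a defect with
          an argument in \<Sum> y_k N lies in \<Sum> y'_k Z and not merely in
          \<open>Z\<close>.\<close>
        then have "D (y k * c) v = y' k * D c v"
          using cR by (simp add: D_def right_diff_distrib mult.assoc)
        moreover have "D c v \<in> Z" using Z c v by (auto simp: good_def)
        ultimately have "D (x * c) v \<in> psum ?hs Z"
          using psum_mem[OF Zs(1), of "y' k" ?hs "D c v"] k by auto
        then show "x * c \<in> {w\<in>R. D w v \<in> psum ?hs Z}"
          using k cR yR[OF k7] R(1) by (auto intro: subrng_mult)
      qed
      then show ?thesis using w by auto
    qed
    fix u v assume u: "u \<in> ?N" and v: "v \<in> ?N"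
    have dec: "\<exists>\<xi> w. \<xi> \<in> mid_span a s r \<and> w \<in> psum ?ys ?N \<and> x = \<xi> + w" if "x \<in> ?N" for x
      using P that unfolding presentation_def set_plus_def by blast
    obtain \<xi> w where uw: "\<xi> \<in> mid_span a s r" "w \<in> psum ?ys ?N" "u = \<xi> + w" using dec[OF u] by blast
    obtain \<xi>' w' where vw: "\<xi>' \<in> mid_span a s r" "w' \<in> psum ?ys ?N" "v = \<xi>' + w'" using dec[OF v] by blast
    have XN: "mid_span a s r \<subseteq> ?N" by (intro mid_span_least N gen_in_nspan)
    have "psum ?ys ?N \<subseteq> ?N"
      using id yR by (intro psum_least N) (auto simp: mult.commute)
    then have inR: "\<xi> \<in> R" "\<xi>' \<in> R" "w \<in> R" "w' \<in> R" using XN NR uw vw by auto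
    \<comment> \<open>Two terms have an argument in \<Sum> y_k N; in the third, both arguments lie
      in the span of the x_i, where the recorded products make \<open>D\<close> vanish.\<close>
    then have "D u v = D w v + (D w' \<xi> + D \<xi>' \<xi>)"
      unfolding uw(3) vw(3) using Da Dc R(2) by (simp add: subgrp_add)
    also have "\<dots> \<in> psum ?hs Z"
      using DP uw vw v XN P0 DX[OF vw(1) uw(1)]
      by (intro subgrp_add subgrp_psum Zs) auto
    finally show "D u v \<in> psum ?hs Z" .
  qed
  then have "psum ?hs Z = Z"
    using Z(2) PZ Zs(3) card_seteq by blast
  moreover have "\<exists>k. x ^ k = 0" if "x \<in> set ?hs" for x
    using that P' by (auto simp: presentation_def)
  ultimately have "Z \<subseteq> {0}"
    using Zs Zc by (intro nakayama_nilpotent[of Z ?hs]) auto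
  then have DN: "D u v = 0" if "u \<in> ?N" "v \<in> ?N" for u v
    using Z(1) that unfolding good_def by blast
  define G where "G = {u\<in>R. \<forall>v\<in>R. D u v = 0}"
  have G: "subgrp G" "G \<subseteq> R"
    using R(2) by (auto simp: G_def subgrp_def Dd D0)
  \<comment> \<open>Bracketing as u (v w) needs only defects of u and of v, so \<open>h\<close> is
    multiplicative there; associativity in both rings transfers this to (u v) w.\<close>
  have GG: "u * v \<in> G" if "u \<in> G" "v \<in> G" for u v
  proof -
    have "D (u * v) w = 0" if w: "w \<in> R" for w
    proof -
      have "v * w \<in> R" using \<open>v \<in> G\<close> w G R(1) by (auto intro: subrng_mult)
      then have "h (u * (v * w)) = h u * h (v * w)" "h (v * w) = h v * h w" "h (u * v) = h u * h v"
        using \<open>u \<in> G\<close> \<open>v \<in> G\<close> w by (auto simp: G_def D_def)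
      then show ?thesis by (simp add: D_def mult.assoc)
    qed
    then show ?thesis using that R(1) by (auto simp: G_def intro: subrng_mult)
  qed
  have "subrng (?N + G)"
    unfolding subrng_def
  proof (intro conjI ballI)
    show "subgrp (?N + G)" by (intro subgrp_plus N G)
    fix x x' assume "x \<in> ?N + G" "x' \<in> ?N + G"
    then obtain u g u' g' where ug: "u \<in> ?N" "g \<in> G" "u' \<in> ?N" "g' \<in> G" "x = u + g" "x' = u' + g'"
      by (auto simp: set_plus_def)
    then have "x * x' = (u * u' + u * g' + u' * g) + g * g'" by (simp add: algebra_simps)
    moreover have "u * u' + u * g' + u' * g \<in> ?N"
      using ug NR G by (intro subgrp_add N id) auto
    ultimately show "x * x' \<in> ?N + G" using GG ug by auto
  qed
  moreover have "?N \<subseteq> ?N + G" using G by (intro subset_plus_left) (simp add: subgrp_zero)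
  moreover have "set (map y [4 * T..<7 * T]) \<subseteq> ?N + G"
  proof -
    have "set (map y [4 * T..<7 * T]) \<subseteq> G" using Dy yR by (auto simp: G_def)
    also have "G \<subseteq> ?N + G" using N by (intro subset_plus_right) (simp add: subgrp_zero)
    finally show ?thesis .
  qed
  moreover have "?N + G \<subseteq> R" using NR G R by (intro plus_least)
  ultimately have RNG: "R = ?N + G" using P unfolding presentation_def generates_over_def by blast
  have "D u v = 0" if u: "u \<in> R" and v: "v \<in> R" for u v
  proof -
    obtain x g where x: "x \<in> ?N" "g \<in> G" "u = x + g" using u RNG by (auto simp: set_plus_def)
    obtain x' g' where x': "x' \<in> ?N" "g' \<in> G" "v = x' + g'" using v RNG by (auto simp: set_plus_def)
    have "D u v = D x v + D g v" unfolding x(3) using x v NR G by (intro Da) auto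
    also have "\<dots> = D v x" using x(2) v Dc[of v x] by (simp add: G_def)
    also have "\<dots> = D x' x + D g' x" unfolding x'(3) using x x' NR G by (intro Da) auto
    also have "\<dots> = 0" using x x' NR DN by (auto simp: G_def)
    finally show ?thesis .
  qed
  then show ?thesis using h(2) add by (auto simp: D_def)
qed

section \<open>Codes\<close>

definition subrng_isom :: "'a::comm_ring_1 set \<Rightarrow> 'b::comm_ring_1 set \<Rightarrow> bool"
  where "subrng_isom R S \<longleftrightarrow>
    (\<exists>h. bij_betw h R S \<and> (\<forall>u\<in>R. \<forall>v\<in>R. h (u + v) = h u + h v \<and> h (u * v) = h u * h v))"

lemma subrng_isom_trans: "subrng_isom R S \<Longrightarrow> subrng_isom S T \<Longrightarrow> subrng_isom R T"
  unfolding subrng_isom_def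
proof (elim exE conjE)
  fix h k assume "bij_betw h R S" "bij_betw k S T"
    "\<forall>u\<in>R. \<forall>v\<in>R. h (u + v) = h u + h v \<and> h (u * v) = h u * h v"
    "\<forall>u\<in>S. \<forall>v\<in>S. k (u + v) = k u + k v \<and> k (u * v) = k u * k v"
  then show "\<exists>h. bij_betw h R T \<and> (\<forall>u\<in>R. \<forall>v\<in>R. h (u + v) = h u + h v \<and> h (u * v) = h u * h v)"
    by (intro exI[of _ "k \<circ> h"]) (auto intro: bij_betw_trans dest: bij_betwE)
qed

lemma subrng_isom_sym:
  assumes "subrng_isom R S" "subrng R"
  shows "subrng_isom S R"
proof -
  obtain h where h: "bij_betw h R S" "\<And>u v. u \<in> R \<Longrightarrow> v \<in> R \<Longrightarrow> h (u + v) = h u + h v \<and> h (u * v) = h u * h v"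
    using assms(1) by (auto simp: subrng_isom_def)
  let ?g = "inv_into R h"
  have g: "bij_betw ?g S R" using h(1) by (rule bij_betw_inv_into)
  have gh: "?g (h x) = x" if "x \<in> R" for x using h(1) that by (rule bij_betw_inv_into_left)
  have "?g (u + v) = ?g u + ?g v \<and> ?g (u * v) = ?g u * ?g v" if uv: "u \<in> S" "v \<in> S" for u v
  proof -
    obtain x y where xy: "x \<in> R" "y \<in> R" "u = h x" "v = h y"
      using h(1) uv by (auto simp: bij_betw_def)
    have "x + y \<in> R" "x * y \<in> R" using xy assms(2) by (auto simp: subrng_def intro: subgrp_add)
    then have "?g (h (x + y)) = x + y" "?g (h (x * y)) = x * y" by (simp_all add: gh)
    then show ?thesis using xy h(2) by (simp add: gh)
  qed
  then show ?thesis using g by (auto simp: subrng_isom_def)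
qed

text \<open>Expansions along the first \<open>m\<close> generators are padded with zeros to
  \<open>n\<close> entries, so that expansions of different lengths fit into one table.\<close>

definition digits :: "nat \<Rightarrow> (nat \<Rightarrow> 'a::comm_ring_1) \<Rightarrow> nat \<Rightarrow> nat \<Rightarrow> 'a \<Rightarrow> nat \<Rightarrow> nat"
  where "digits p a n m x =
    (\<lambda>i\<in>{..<n}. if i < m then (SOME v. v \<in> {..<m} \<rightarrow>\<^sub>E {..<p} \<and> ncomb a m v = x) i else 0)"

lemma
  assumes a: "pchain p a k" "m \<le> k" and p: "Factorial_Ring.prime p" and "m \<le> n" and x: "x \<in> nspan a m"
  shows digits_mem: "digits p a n m x \<in> {..<n} \<rightarrow>\<^sub>E {..<p}"
    and ncomb_digits: "ncomb a m (digits p a n m x) = x"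
proof -
  let ?v = "SOME v. v \<in> {..<m} \<rightarrow>\<^sub>E {..<p} \<and> ncomb a m v = x"
  have "\<exists>v. v \<in> {..<m} \<rightarrow>\<^sub>E {..<p} \<and> ncomb a m v = x"
    using digits_exist[OF a p x] by blast
  then have v: "?v \<in> {..<m} \<rightarrow>\<^sub>E {..<p} \<and> ncomb a m ?v = x" by (rule someI_ex)
  then show "digits p a n m x \<in> {..<n} \<rightarrow>\<^sub>E {..<p}"
    using prime_gt_0_nat[OF p] by (auto simp: digits_def PiE_def Pi_def)
  have "ncomb a m (digits p a n m x) = ncomb a m ?v"
    using \<open>m \<le> n\<close> by (intro ncomb_cong) (auto simp: digits_def)
  then show "ncomb a m (digits p a n m x) = x" using v by simp
qed

lemma digits_same_coords:
  assumes "pchain p a k" "pchain p b k" "m \<le> k" "Factorial_Ring.prime p" "m \<le> n"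
    and "x \<in> nspan a m" "y \<in> nspan b m" "digits p a n m x = digits p b n m y"
  shows "same_coords a b m x y"
proof -
  have "ncomb a m (digits p a n m x) = x" by (rule ncomb_digits[OF assms(1,3,4,5,6)])
  moreover have "ncomb b m (digits p a n m x) = y"
    unfolding assms(8) by (rule ncomb_digits[OF assms(2,3,4,5,7)])
  ultimately show ?thesis unfolding same_coords_def by metis
qed

type_synonym code = "(nat \<times> nat) \<times> (nat \<times> nat \<Rightarrow> nat \<Rightarrow> nat) \<times> (nat \<times> nat \<Rightarrow> nat \<Rightarrow> nat)"

text \<open>The first table has 7 T + 1 rows of n + 1 vectors of n digits. Row k < 7 T is meant for
  y_k a_j in the columns j < n and y_k itself in column n; the last row for the power relations p
  a_j, with a filler in column n. The second table is meant for the products x_i x_j with i \<le> j,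
  in \<open>s\<close> digits each, and carries the main term.\<close>

definition codes :: "nat \<Rightarrow> nat \<Rightarrow> nat \<Rightarrow> code set"
  where "codes p n T = (SIGMA (s, r) : {(s, r). s + r \<le> n}.
    ({..7 * T} \<times> {..n} \<rightarrow>\<^sub>E ({..<n} \<rightarrow>\<^sub>E {..<p})) \<times>
    ((SIGMA j : {..<r}. {..j}) \<rightarrow>\<^sub>E ({..<s} \<rightarrow>\<^sub>E {..<p})))"

definition code_of :: "nat \<Rightarrow> nat \<Rightarrow> nat \<Rightarrow> nat \<Rightarrow> nat \<Rightarrow> (nat \<Rightarrow> 'a::comm_ring_1) \<Rightarrow> (nat \<Rightarrow> 'a) \<Rightarrow> code"
  where "code_of p n T s r a y = ((s, r),
    (\<lambda>(k, j)\<in>{..7 * T} \<times> {..n}.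
       if k < 7 * T then digits p a n n (if j < n then y k * a j else y k)
       else if j < n then digits p a n j (of_nat p * a j) else digits p a n n 0),
    (\<lambda>(j, i)\<in>(SIGMA j : {..<r}. {..j}). digits p a s s (a (s + i) * a (s + j))))"

lemma code_of_mem:
  assumes P: "presentation p n T s r R a y" and p: "Factorial_Ring.prime p"
  shows "code_of p n T s r a y \<in> codes p n T"
proof -
  have R: "subrng R" "s + r \<le> n" "pchain p a n" "nspan a n = R"
    and y: "\<And>k. k < 7 * T \<Longrightarrow> y k \<in> R"
    and aa: "\<And>i j. i \<in> {s..<s + r} \<Longrightarrow> j \<in> {s..<s + r} \<Longrightarrow> a i * a j \<in> nspan a s"
    using P by (auto simp: presentation_def)
  have aR: "a i \<in> R" if "i < n" for i using gen_in_nspan[OF that, of a] R by simp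
  have d: "digits p a n m x \<in> {..<n} \<rightarrow>\<^sub>E {..<p}" if "m \<le> n" "x \<in> nspan a m" for m x
    by (rule digits_mem[OF R(3) that(1) p that])
  have ds: "digits p a s s x \<in> {..<s} \<rightarrow>\<^sub>E {..<p}" if "x \<in> nspan a s" for x
    using R(2) that by (intro digits_mem[OF R(3) _ p]) auto
  have n0: "0 \<in> nspan a n" using R by (simp add: subrng_def subgrp_zero)
  have ya: "y k * a j \<in> nspan a n" if "k < 7 * T" "j < n" for k j
    using that y aR R by (simp add: subrng_mult)
  have pa: "of_nat p * a j \<in> nspan a j" if "j < n" for j using R that by (auto simp: pchain_def)
  show ?thesis
    unfolding codes_def code_of_def mem_Sigma_iff prod.case
  proof (intro conjI)
    show "(s, r) \<in> {(s, r). s + r \<le> n}" using R(2) by simp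
    show "(\<lambda>(k, j)\<in>{..7 * T} \<times> {..n}.
       if k < 7 * T then digits p a n n (if j < n then y k * a j else y k)
       else if j < n then digits p a n j (of_nat p * a j) else digits p a n n 0)
      \<in> {..7 * T} \<times> {..n} \<rightarrow>\<^sub>E ({..<n} \<rightarrow>\<^sub>E {..<p})"
      unfolding restrict_PiE_iff using y R(4) by (clarsimp simp: d n0 ya pa)
    show "(\<lambda>(j, i)\<in>(SIGMA j : {..<r}. {..j}). digits p a s s (a (s + i) * a (s + j)))
      \<in> (SIGMA j : {..<r}. {..j}) \<rightarrow>\<^sub>E ({..<s} \<rightarrow>\<^sub>E {..<p})"
      unfolding restrict_PiE_iff by (clarsimp simp: ds aa)
  qed
qed

lemma code_of_isom:
  fixes R R' :: "'a::comm_ring_1 set"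
  assumes P: "presentation p n T s r R a y" and P': "presentation p n T s' r' R' a' y'"
    and p: "Factorial_Ring.prime p"
    and eq: "code_of p n T s r a y = code_of p n T s' r' a' y'"
  shows "subrng_isom R R'"
proof -
  have sr: "s' = s" "r' = r" using eq by (auto simp: code_of_def)
  note P' = P'[unfolded sr] and eq = eq[unfolded sr]
  have R: "subrng R" "s + r \<le> n" "pchain p a n" "nspan a n = R"
    and y: "\<And>k. k < 7 * T \<Longrightarrow> y k \<in> R"
    and aa: "\<And>i j. i \<in> {s..<s + r} \<Longrightarrow> j \<in> {s..<s + r} \<Longrightarrow> a i * a j \<in> nspan a s"
    using P by (auto simp: presentation_def)
  have R': "subrng R'" "pchain p a' n" "nspan a' n = R'"
    and y': "\<And>k. k < 7 * T \<Longrightarrow> y' k \<in> R'"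
    and aa': "\<And>i j. i \<in> {s..<s + r} \<Longrightarrow> j \<in> {s..<s + r} \<Longrightarrow> a' i * a' j \<in> nspan a' s"
    using P' by (auto simp: presentation_def)
  have aR: "a i \<in> R" "a' i \<in> R'" if "i < n" for i
    using gen_in_nspan[OF that, of a] gen_in_nspan[OF that, of a'] R R' by simp_all
  have 1: "(if k < 7 * T then digits p a n n (if j < n then y k * a j else y k)
       else if j < n then digits p a n j (of_nat p * a j) else digits p a n n 0) =
      (if k < 7 * T then digits p a' n n (if j < n then y' k * a' j else y' k)
       else if j < n then digits p a' n j (of_nat p * a' j) else digits p a' n n 0)"
    if "k \<le> 7 * T" "j \<le> n" for k j
    using eq that unfolding code_of_def by (auto dest!: fun_cong[of _ _ "(k, j)"])
  have 2: "digits p a s s (a (s + i) * a (s + j)) = digits p a' s s (a' (s + i) * a' (s + j))"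
    if "i \<le> j" "j < r" for i j
    using eq that unfolding code_of_def by (auto dest!: fun_cong[of _ _ "(j, i)"])
  note dsc = digits_same_coords[OF R(3) R'(2) _ p]
  show ?thesis
    unfolding subrng_isom_def
  proof (rule presentation_determines[OF P P' p])
    show "same_coords a a' m (of_nat p * a m) (of_nat p * a' m)" if "m < n" for m
      using 1[of "7 * T" m] that R R' by (intro dsc[of m n]) (auto simp: pchain_def)
    show "same_coords a a' n (y k) (y' k)" if "k < 7 * T" for k
      using 1[of k n] that y y' R R' by (intro dsc[of n n]) auto
    show "same_coords a a' n (y k * a j) (y' k * a' j)" if "k < 7 * T" "j < n" for k j
      using 1[of k j] that y y' aR R R' by (intro dsc[of n n]) (auto intro: subrng_mult)
    show "same_coords a a' s (a i * a j) (a' i * a' j)" if "s \<le> i" "i \<le> j" "j < s + r" for i j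
      using 2[of "i - s" "j - s"] that aa aa' R by (intro dsc[of s s]) auto
  qed
qed

lemma finite_codes: "finite (codes p n T)"
proof -
  have "finite {(s, r). s + r \<le> n}"
    by (rule finite_subset[of _ "{..n} \<times> {..n}"]) auto
  then show ?thesis
    unfolding codes_def by (intro finite_SigmaI) (auto intro!: finite_PiE)
qed

lemma card_triangle: "card (SIGMA j : {..<r}. {..j}) = r * (r + 1) div 2"
  by (induction r) (simp_all add: card_SigmaI lessThan_Suc)

lemma card_codes:
  "card (codes p n T) = (\<Sum>(s, r)\<in>{(s, r). s + r \<le> n}. p ^ (n * ((7 * T + 1) * (n + 1))) * p ^ (s * (r * (r + 1) div 2)))"
proof -
  have fin: "finite {(s, r). s + r \<le> n}"
    by (rule finite_subset[of _ "{..n} \<times> {..n}"]) auto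
  have "card (codes p n T) = (\<Sum>(s, r)\<in>{(s, r). s + r \<le> n}.
      (p ^ n) ^ ((7 * T + 1) * (n + 1)) * (p ^ s) ^ (r * (r + 1) div 2))"
    unfolding codes_def using fin
    by (subst card_SigmaI)
      (auto intro!: finite_PiE sum.cong simp: card_PiE card_cartesian_product card_triangle simp del: power_Suc mult_Suc mult_Suc_right)
  then show ?thesis by (simp only: power_mult[symmetric])
qed

section \<open>A universal commutative ring\<close>

text \<open>
  Every commutative ring with carrier in \<open>nat\<close> embeds into the single type \<open>rng_prod dorroh\<close> of class
  \<open>comm_ring_1\<close>: the product of all of them, with an identity adjoined.
\<close>

typedef rng_prod = "{f :: nat ring \<Rightarrow> nat. \<forall>R. if comm_rng R then f R \<in> carrier R else f R = 0}"
proof -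
  have "(if comm_rng R then \<zero>\<^bsub>R\<^esub> else 0) \<in> carrier R" if "comm_rng R" for R :: "nat ring"
  proof -
    interpret comm_rng R by fact
    show ?thesis using that by simp
  qed
  then show ?thesis by (intro exI[of _ "\<lambda>R. if comm_rng R then \<zero>\<^bsub>R\<^esub> else 0"]) simp
qed

setup_lifting type_definition_rng_prod

lemma comm_rng_closed:
  assumes "comm_rng R"
  shows "\<zero>\<^bsub>R\<^esub> \<in> carrier R" "x \<in> carrier R \<Longrightarrow> \<ominus>\<^bsub>R\<^esub> x \<in> carrier R"
    "x \<in> carrier R \<Longrightarrow> y \<in> carrier R \<Longrightarrow> x \<oplus>\<^bsub>R\<^esub> y \<in> carrier R"
    "x \<in> carrier R \<Longrightarrow> y \<in> carrier R \<Longrightarrow> x \<otimes>\<^bsub>R\<^esub> y \<in> carrier R"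
proof -
  interpret comm_rng R by fact
  show "\<zero>\<^bsub>R\<^esub> \<in> carrier R" "x \<in> carrier R \<Longrightarrow> \<ominus>\<^bsub>R\<^esub> x \<in> carrier R"
    "x \<in> carrier R \<Longrightarrow> y \<in> carrier R \<Longrightarrow> x \<oplus>\<^bsub>R\<^esub> y \<in> carrier R"
    "x \<in> carrier R \<Longrightarrow> y \<in> carrier R \<Longrightarrow> x \<otimes>\<^bsub>R\<^esub> y \<in> carrier R"
    by (simp_all add: m_closed)
qed

lemma comm_rng_laws:
  assumes "comm_rng R" "x \<in> carrier R"
  shows "\<zero>\<^bsub>R\<^esub> \<oplus>\<^bsub>R\<^esub> x = x" "\<ominus>\<^bsub>R\<^esub> x \<oplus>\<^bsub>R\<^esub> x = \<zero>\<^bsub>R\<^esub>" "\<zero>\<^bsub>R\<^esub> \<otimes>\<^bsub>R\<^esub> x = \<zero>\<^bsub>R\<^esub>"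
    "y \<in> carrier R \<Longrightarrow> x \<oplus>\<^bsub>R\<^esub> y = y \<oplus>\<^bsub>R\<^esub> x"
    "y \<in> carrier R \<Longrightarrow> x \<otimes>\<^bsub>R\<^esub> y = y \<otimes>\<^bsub>R\<^esub> x"
    "y \<in> carrier R \<Longrightarrow> z \<in> carrier R \<Longrightarrow> x \<oplus>\<^bsub>R\<^esub> y \<oplus>\<^bsub>R\<^esub> z = x \<oplus>\<^bsub>R\<^esub> (y \<oplus>\<^bsub>R\<^esub> z)"
    "y \<in> carrier R \<Longrightarrow> z \<in> carrier R \<Longrightarrow> x \<otimes>\<^bsub>R\<^esub> y \<otimes>\<^bsub>R\<^esub> z = x \<otimes>\<^bsub>R\<^esub> (y \<otimes>\<^bsub>R\<^esub> z)"
    "y \<in> carrier R \<Longrightarrow> z \<in> carrier R \<Longrightarrow> (x \<oplus>\<^bsub>R\<^esub> y) \<otimes>\<^bsub>R\<^esub> z = x \<otimes>\<^bsub>R\<^esub> z \<oplus>\<^bsub>R\<^esub> y \<otimes>\<^bsub>R\<^esub> z"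
proof -
  interpret comm_rng R by fact
  show "\<zero>\<^bsub>R\<^esub> \<oplus>\<^bsub>R\<^esub> x = x" "\<ominus>\<^bsub>R\<^esub> x \<oplus>\<^bsub>R\<^esub> x = \<zero>\<^bsub>R\<^esub>"
    "y \<in> carrier R \<Longrightarrow> x \<oplus>\<^bsub>R\<^esub> y = y \<oplus>\<^bsub>R\<^esub> x"
    "y \<in> carrier R \<Longrightarrow> x \<otimes>\<^bsub>R\<^esub> y = y \<otimes>\<^bsub>R\<^esub> x"
    "y \<in> carrier R \<Longrightarrow> z \<in> carrier R \<Longrightarrow> x \<oplus>\<^bsub>R\<^esub> y \<oplus>\<^bsub>R\<^esub> z = x \<oplus>\<^bsub>R\<^esub> (y \<oplus>\<^bsub>R\<^esub> z)"
    "y \<in> carrier R \<Longrightarrow> z \<in> carrier R \<Longrightarrow> x \<otimes>\<^bsub>R\<^esub> y \<otimes>\<^bsub>R\<^esub> z = x \<otimes>\<^bsub>R\<^esub> (y \<otimes>\<^bsub>R\<^esub> z)"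
    "y \<in> carrier R \<Longrightarrow> z \<in> carrier R \<Longrightarrow> (x \<oplus>\<^bsub>R\<^esub> y) \<otimes>\<^bsub>R\<^esub> z = x \<otimes>\<^bsub>R\<^esub> z \<oplus>\<^bsub>R\<^esub> y \<otimes>\<^bsub>R\<^esub> z"
    by (use assms(2) in \<open>simp; fail\<close>, rule l_neg[OF assms(2)], (rule a_comm[OF assms(2)], assumption),
      (rule m_comm[OF assms(2)], assumption), (rule a_assoc[OF assms(2)], assumption+),
      (rule m_assoc[OF assms(2)], assumption+), rule l_distr[OF assms(2)])
  have "\<zero>\<^bsub>R\<^esub> \<otimes>\<^bsub>R\<^esub> x \<oplus>\<^bsub>R\<^esub> \<zero>\<^bsub>R\<^esub> \<otimes>\<^bsub>R\<^esub> x = \<zero>\<^bsub>R\<^esub> \<otimes>\<^bsub>R\<^esub> x"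
    using l_distr[of "\<zero>\<^bsub>R\<^esub>" "\<zero>\<^bsub>R\<^esub>" x] assms(2) by simp
  then show "\<zero>\<^bsub>R\<^esub> \<otimes>\<^bsub>R\<^esub> x = \<zero>\<^bsub>R\<^esub>"
    using assms(2) m_closed[of "\<zero>\<^bsub>R\<^esub>" x] add.l_cancel_one by simp
qed

instantiation rng_prod :: comm_ring
begin

lift_definition zero_rng_prod :: rng_prod is "\<lambda>R. if comm_rng R then \<zero>\<^bsub>R\<^esub> else 0"
  by (simp add: comm_rng_closed)

lift_definition plus_rng_prod :: "rng_prod \<Rightarrow> rng_prod \<Rightarrow> rng_prod"
  is "\<lambda>f g R. if comm_rng R then f R \<oplus>\<^bsub>R\<^esub> g R else 0"
  by (auto simp: comm_rng_closed)

lift_definition uminus_rng_prod :: "rng_prod \<Rightarrow> rng_prod"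
  is "\<lambda>f R. if comm_rng R then \<ominus>\<^bsub>R\<^esub> f R else 0"
  by (auto simp: comm_rng_closed)

lift_definition times_rng_prod :: "rng_prod \<Rightarrow> rng_prod \<Rightarrow> rng_prod"
  is "\<lambda>f g R. if comm_rng R then f R \<otimes>\<^bsub>R\<^esub> g R else 0"
  by (auto simp: comm_rng_closed)

definition minus_rng_prod :: "rng_prod \<Rightarrow> rng_prod \<Rightarrow> rng_prod"
  where "minus_rng_prod f g = f + - g"

instance
proof
  fix a b c :: rng_prod
  show "a + b + c = a + (b + c)"
    by transfer (auto simp: fun_eq_iff comm_rng_laws(6))
  show "a + b = b + a"
    by transfer (auto simp: fun_eq_iff intro: comm_rng_laws(4))
  show "0 + a = a"
    by transfer (auto simp: fun_eq_iff comm_rng_laws(1))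
  show "- a + a = 0"
    by transfer (auto simp: fun_eq_iff comm_rng_laws(2))
  show "a - b = a + - b"
    by (simp add: minus_rng_prod_def)
  show "a * b * c = a * (b * c)"
    by transfer (auto simp: fun_eq_iff comm_rng_laws(7))
  show "a * b = b * a"
    by transfer (auto simp: fun_eq_iff intro: comm_rng_laws(5))
  show "(a + b) * c = a * c + b * c"
    by transfer (auto simp: fun_eq_iff comm_rng_laws(8))
qed

end

lift_definition in_rng_prod :: "nat ring \<Rightarrow> nat \<Rightarrow> rng_prod"
  is "\<lambda>R x S. if comm_rng S then if S = R \<and> x \<in> carrier R then x else \<zero>\<^bsub>S\<^esub> else 0"
  by (simp add: comm_rng_closed)

lemma in_rng_prod:
  assumes R: "comm_rng R"
  shows "inj_on (in_rng_prod R) (carrier R)"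
    and "x \<in> carrier R \<Longrightarrow> y \<in> carrier R \<Longrightarrow> in_rng_prod R (x \<oplus>\<^bsub>R\<^esub> y) = in_rng_prod R x + in_rng_prod R y"
    and "x \<in> carrier R \<Longrightarrow> y \<in> carrier R \<Longrightarrow> in_rng_prod R (x \<otimes>\<^bsub>R\<^esub> y) = in_rng_prod R x * in_rng_prod R y"
proof -
  show "inj_on (in_rng_prod R) (carrier R)"
  proof (rule inj_onI)
    fix x y assume "x \<in> carrier R" "y \<in> carrier R" "in_rng_prod R x = in_rng_prod R y"
    then have "Rep_rng_prod (in_rng_prod R x) R = Rep_rng_prod (in_rng_prod R y) R" by (simp only:)
    then show "x = y" using R \<open>x \<in> carrier R\<close> \<open>y \<in> carrier R\<close> by (simp add: in_rng_prod.rep_eq)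
  qed
  show "in_rng_prod R (x \<oplus>\<^bsub>R\<^esub> y) = in_rng_prod R x + in_rng_prod R y" if "x \<in> carrier R" "y \<in> carrier R"
  proof (rule Rep_rng_prod_inject[THEN iffD1], rule ext)
    fix S :: "nat ring"
    show "Rep_rng_prod (in_rng_prod R (x \<oplus>\<^bsub>R\<^esub> y)) S = Rep_rng_prod (in_rng_prod R x + in_rng_prod R y) S"
      using that comm_rng_closed(3)[OF R that] comm_rng_laws(1)[OF _ comm_rng_closed(1), of S]
      by (cases "S = R") (simp_all add: in_rng_prod.rep_eq plus_rng_prod.rep_eq)
  qed
  show "in_rng_prod R (x \<otimes>\<^bsub>R\<^esub> y) = in_rng_prod R x * in_rng_prod R y" if "x \<in> carrier R" "y \<in> carrier R"
  proof (rule Rep_rng_prod_inject[THEN iffD1], rule ext)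
    fix S :: "nat ring"
    show "Rep_rng_prod (in_rng_prod R (x \<otimes>\<^bsub>R\<^esub> y)) S = Rep_rng_prod (in_rng_prod R x * in_rng_prod R y) S"
      using that comm_rng_closed(4)[OF R that] comm_rng_laws(3)[OF _ comm_rng_closed(1), of S]
      by (cases "S = R") (simp_all add: in_rng_prod.rep_eq times_rng_prod.rep_eq)
  qed
qed

section \<open>Integer multiples and adjoining an identity\<close>

definition zmul :: "int \<Rightarrow> 'a::ab_group_add \<Rightarrow> 'a"
  where "zmul m x = (if m \<ge> 0 then ((+) x ^^ nat m) 0 else - ((+) x ^^ nat (- m)) 0)"

lemma zmul_0 [simp]: "zmul 0 x = 0" and zmul_1 [simp]: "zmul 1 x = x"
  by (simp_all add: zmul_def)

lemma zmul_add_1: "zmul (m + 1) x = zmul m x + x"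
proof (cases "m \<ge> 0")
  case True
  then have "nat (m + 1) = Suc (nat m)" by simp
  then show ?thesis using True by (simp add: zmul_def add.commute)
next
  case False
  then have "nat (- m) = Suc (nat (- (m + 1)))" by simp
  then have "((+) x ^^ nat (- m)) 0 = x + ((+) x ^^ nat (- (m + 1))) 0" by simp
  then show ?thesis using False by (cases "m = -1") (simp_all add: zmul_def)
qed

lemma zmul_diff_1: "zmul (m - 1) x = zmul m x - x"
  using zmul_add_1[of "m - 1" x] by simp

lemma zmul_add_left: "zmul (m + n) x = zmul m x + zmul n x"
proof (induction n rule: int_induct[of _ 0])
  case (step1 n)
  then show ?case using zmul_add_1[of "m + n" x] by (simp add: zmul_add_1 add.assoc)
next
  case (step2 n)
  then show ?case using zmul_diff_1[of "m + n" x] by (simp add: zmul_diff_1 algebra_simps)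
qed simp

lemma zmul_diff_left: "zmul (m - n) x = zmul m x - zmul n x"
  using zmul_add_left[of "m - n" n x] by simp

lemma zmul_add_right: "zmul m (x + y) = zmul m x + zmul m y"
  by (induction m rule: int_induct[of _ 0]) (simp_all add: zmul_add_1 zmul_diff_1)

lemma zmul_zero_right [simp]: "zmul m 0 = 0"
  using zmul_add_right[of m 0 0] by simp

lemma zmul_mult_left: "zmul (m * n) x = zmul m (zmul n x)"
  by (induction m rule: int_induct[of _ 0])
    (simp_all add: zmul_add_1 zmul_diff_1 distrib_right left_diff_distrib zmul_add_left zmul_diff_left)

lemma zmul_mult_right: "zmul m (x * y) = zmul m x * (y :: 'a::comm_ring)"
  by (induction m rule: int_induct[of _ 0]) (simp_all add: zmul_add_1 zmul_diff_1 algebra_simps)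

text \<open>The pair (m, x) stands for m + x. All integers are adjoined, not residues modulo a power
  of p, because \<open>rng_prod\<close> has factors of every characteristic.\<close>

typedef 'a dorroh = "UNIV :: (int \<times> 'a) set"
  by simp

setup_lifting type_definition_dorroh

instantiation dorroh :: (comm_ring) comm_ring_1
begin

lift_definition zero_dorroh :: "'a dorroh" is "(0, 0)" .

lift_definition one_dorroh :: "'a dorroh" is "(1, 0)" .

lift_definition plus_dorroh :: "'a dorroh \<Rightarrow> 'a dorroh \<Rightarrow> 'a dorroh" is "\<lambda>(m, x) (n, y). (m + n, x + y)" .

lift_definition uminus_dorroh :: "'a dorroh \<Rightarrow> 'a dorroh" is "\<lambda>(m, x). (- m, - x)" .

lift_definition minus_dorroh :: "'a dorroh \<Rightarrow> 'a dorroh \<Rightarrow> 'a dorroh" is "\<lambda>(m, x) (n, y). (m - n, x - y)" .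

lift_definition times_dorroh :: "'a dorroh \<Rightarrow> 'a dorroh \<Rightarrow> 'a dorroh"
  is "\<lambda>(m, x) (n, y). (m * n, zmul m y + zmul n x + x * y)" .

instance
proof
  fix a b c :: "'a dorroh"
  show "a * b * c = a * (b * c)"
  proof (transfer, clarsimp)
    fix l m n :: int and x y z :: 'a
    have c: "zmul l (z * x) = x * zmul l z" for l and x z :: 'a
      using zmul_mult_right[of l z x] by (simp add: mult.commute)
    show "zmul (l * m) z + zmul n (zmul l y + zmul m x + x * y) + (zmul l y + zmul m x + x * y) * z =
        zmul l (zmul m z + zmul n y + y * z) + zmul (m * n) x + x * (zmul m z + zmul n y + y * z)"
      using c[of m z x] c[of n y x]
      by (simp add: zmul_mult_left zmul_add_right zmul_mult_right algebra_simps)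
        (simp add: zmul_mult_left[symmetric] mult.commute)
  qed
  show "a * b = b * a" by transfer (auto simp: ac_simps)
  show "1 * a = a" by transfer auto
  show "(a + b) * c = a * c + b * c"
    by transfer (auto simp: zmul_add_left zmul_add_right algebra_simps)
  show "(0 :: 'a dorroh) \<noteq> 1" by transfer simp
qed (transfer; auto)+

end

lift_definition in_dorroh :: "'a::comm_ring \<Rightarrow> 'a dorroh" is "\<lambda>x. (0, x)" .

lemma in_dorroh:
  "in_dorroh x = in_dorroh y \<longleftrightarrow> x = y" "in_dorroh (x + y) = in_dorroh x + in_dorroh y"
  "in_dorroh (x * y) = in_dorroh x * in_dorroh y"
  by (transfer, simp)+

definition embed :: "nat ring \<Rightarrow> nat \<Rightarrow> rng_prod dorroh"
  where "embed R x = in_dorroh (in_rng_prod R x)"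

lemma embed:
  assumes R: "comm_rng R"
  shows "inj_on (embed R) (carrier R)"
    and "x \<in> carrier R \<Longrightarrow> y \<in> carrier R \<Longrightarrow> embed R (x \<oplus>\<^bsub>R\<^esub> y) = embed R x + embed R y"
    and "x \<in> carrier R \<Longrightarrow> y \<in> carrier R \<Longrightarrow> embed R (x \<otimes>\<^bsub>R\<^esub> y) = embed R x * embed R y"
  using in_rng_prod[OF R] by (auto simp: embed_def in_dorroh inj_on_def)

definition emb :: "nat ring \<Rightarrow> rng_prod dorroh set"
  where "emb R = embed R ` carrier R"

lemma bij_betw_embed: "comm_rng R \<Longrightarrow> bij_betw (embed R) (carrier R) (emb R)"
  by (simp add: bij_betw_def emb_def embed)

lemma subrng_emb:
  assumes R: "comm_rng R"
  shows "subrng (emb R)"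
proof -
  interpret comm_rng R by fact
  note e = embed[OF R]
  have z: "embed R \<zero>\<^bsub>R\<^esub> = 0" using e(2)[of "\<zero>\<^bsub>R\<^esub>" "\<zero>\<^bsub>R\<^esub>"] by simp
  have "embed R x - embed R y = embed R (x \<oplus>\<^bsub>R\<^esub> \<ominus>\<^bsub>R\<^esub> y)" if "x \<in> carrier R" "y \<in> carrier R" for x y
    using e(2)[of "x \<oplus>\<^bsub>R\<^esub> \<ominus>\<^bsub>R\<^esub> y" y] that by (simp add: a_assoc l_neg)
  moreover have "0 \<in> emb R" unfolding emb_def by (rule image_eqI[of _ _ "\<zero>\<^bsub>R\<^esub>"]) (simp_all add: z)
  ultimately show ?thesis
    unfolding subrng_def subgrp_def by (auto simp: emb_def m_closed simp flip: e(3))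
qed

lemma emb_finite_card:
  assumes "R \<in> comm_rngs_of_card N"
  shows "comm_rng R" "subrng (emb R)" "finite (emb R)" "card (emb R) = N"
  using assms embed(1)[of R] subrng_emb[of R]
  by (auto simp: comm_rngs_of_card_def emb_def card_image)

lemma comm_rng_iso_rel_emb:
  assumes R: "R \<in> comm_rngs_of_card N" and S: "S \<in> comm_rngs_of_card N" and "subrng_isom (emb R) (emb S)"
  shows "(R, S) \<in> comm_rng_iso_rel N"
proof -
  note R' = emb_finite_card[OF R] and S' = emb_finite_card[OF S]
  obtain h where h: "bij_betw h (emb R) (emb S)"
    "\<And>u v. u \<in> emb R \<Longrightarrow> v \<in> emb R \<Longrightarrow> h (u + v) = h u + h v \<and> h (u * v) = h u * h v"
    using assms(3) by (auto simp: subrng_isom_def)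
  have bS: "bij_betw (embed S) (carrier S) (emb S)" by (rule bij_betw_embed[OF S'(1)])
  let ?g = "inv_into (carrier S) (embed S)"
  define k where "k = ?g \<circ> (h \<circ> embed R)"
  have k: "bij_betw k (carrier R) (carrier S)"
    unfolding k_def using bij_betw_embed[OF R'(1)] h(1) bij_betw_inv_into[OF bS]
    by (intro bij_betw_trans)
  have kS: "k x \<in> carrier S" if "x \<in> carrier R" for x using k that by (auto simp: bij_betw_def)
  have ek: "embed S (k x) = h (embed R x)" if "x \<in> carrier R" for x
  proof -
    have "h (embed R x) \<in> emb S" using h(1) that by (auto simp: bij_betw_def emb_def)
    then show ?thesis unfolding k_def using bij_betw_inv_into_right[OF bS] by simp
  qed
  have eR: "embed R x \<in> emb R" if "x \<in> carrier R" for x using that by (simp add: emb_def)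
  have "k (x \<oplus>\<^bsub>R\<^esub> y) = k x \<oplus>\<^bsub>S\<^esub> k y" "k (x \<otimes>\<^bsub>R\<^esub> y) = k x \<otimes>\<^bsub>S\<^esub> k y"
    if "x \<in> carrier R" "y \<in> carrier R" for x y
  proof -
    note cR = comm_rng_closed(3,4)[OF R'(1) that]
      and cS = comm_rng_closed(3,4)[OF S'(1) kS[OF that(1)] kS[OF that(2)]]
    have "embed S (k (x \<oplus>\<^bsub>R\<^esub> y)) = embed S (k x \<oplus>\<^bsub>S\<^esub> k y)"
      "embed S (k (x \<otimes>\<^bsub>R\<^esub> y)) = embed S (k x \<otimes>\<^bsub>S\<^esub> k y)"
      using that cR kS eR h(2) by (simp_all add: ek embed(2,3)[OF R'(1)] embed(2,3)[OF S'(1)])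
    then show "k (x \<oplus>\<^bsub>R\<^esub> y) = k x \<oplus>\<^bsub>S\<^esub> k y" "k (x \<otimes>\<^bsub>R\<^esub> y) = k x \<otimes>\<^bsub>S\<^esub> k y"
      using inj_onD[OF embed(1)[OF S'(1)]] cR cS kS by blast+
  qed
  then have "k \<in> rng_iso R S" using k by (simp add: rng_iso_iff)
  then show ?thesis using R S by (auto simp: comm_rng_iso_rel_def)
qed

text \<open>The parts into which an idempotent splits a ring arise as subsets of the universal ring,
  not as images under \<open>emb\<close>; this returns them to rings on the natural numbers, whose
  classes are counted.\<close>

lemma subrng_representative:
  assumes A: "subrng A" "finite (A :: 'a::comm_ring_1 set)"
  shows "\<exists>S\<in>comm_rngs_of_card (card A). subrng_isom A (emb S)"
proof -
  let ?R = "\<lparr>carrier = A, mult = (*), one = 0, zero = 0, add = (+)\<rparr>"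
  have "abelian_group ?R"
  proof (rule abelian_groupI)
    fix x assume "x \<in> carrier ?R"
    then show "\<exists>y\<in>carrier ?R. y \<oplus>\<^bsub>?R\<^esub> x = \<zero>\<^bsub>?R\<^esub>"
      using A by (intro bexI[of _ "- x"]) (auto simp: subrng_def subgrp_uminus)
  qed (use A in \<open>auto simp: subrng_def subgrp_add subgrp_zero ac_simps\<close>)
  then have "rng ?R"
    using A unfolding rng_def rng_axioms_def by (auto simp: subrng_def algebra_simps)
  then have "comm_rng ?R"
    unfolding comm_rng_def comm_rng_axioms_def by (auto simp: mult.commute)
  then obtain S where S: "S \<in> comm_rngs_of_card (card A)" "rng_iso ?R S \<noteq> {}"
    using comm_rng_nat_representative[of ?R] A by auto
  then obtain h where h: "bij_betw h A (carrier S)"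
    "\<forall>x\<in>A. \<forall>y\<in>A. h (x * y) = h x \<otimes>\<^bsub>S\<^esub> h y" "\<forall>x\<in>A. \<forall>y\<in>A. h (x + y) = h x \<oplus>\<^bsub>S\<^esub> h y"
    by (auto simp: rng_iso_iff)
  note S' = emb_finite_card[OF S(1)]
  have hS: "h x \<in> carrier S" if "x \<in> A" for x using h(1) that by (auto simp: bij_betw_def)
  have "bij_betw (embed S \<circ> h) A (emb S)"
    by (rule bij_betw_trans[OF h(1) bij_betw_embed[OF S'(1)]])
  then have "subrng_isom A (emb S)"
    unfolding subrng_isom_def using h(2,3) hS embed(2,3)[OF S'(1)]
    by (intro exI[of _ "embed S \<circ> h"]) auto
  then show ?thesis using S by blast
qed

section \<open>The upper bound\<close>

lemma emb_isom:
  assumes R: "comm_rng R" and S: "comm_rng S" and "rng_iso R S \<noteq> {}"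
  shows "subrng_isom (emb R) (emb S)"
proof -
  obtain h where "h \<in> rng_iso R S" using assms(3) by blast
  then have h: "bij_betw h (carrier R) (carrier S)"
    "\<And>x y. x \<in> carrier R \<Longrightarrow> y \<in> carrier R \<Longrightarrow> h (x \<otimes>\<^bsub>R\<^esub> y) = h x \<otimes>\<^bsub>S\<^esub> h y"
    "\<And>x y. x \<in> carrier R \<Longrightarrow> y \<in> carrier R \<Longrightarrow> h (x \<oplus>\<^bsub>R\<^esub> y) = h x \<oplus>\<^bsub>S\<^esub> h y"
    by (auto simp: rng_iso_iff)
  have bR: "bij_betw (embed R) (carrier R) (emb R)" by (rule bij_betw_embed[OF R])
  let ?g = "inv_into (carrier R) (embed R)"
  have ge: "?g (embed R x) = x" if "x \<in> carrier R" for x using bR that by (rule bij_betw_inv_into_left)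
  have hS: "h x \<in> carrier S" if "x \<in> carrier R" for x using h(1) that by (auto simp: bij_betw_def)
  define k where "k = (embed S \<circ> h) \<circ> ?g"
  have ke: "k (embed R x) = embed S (h x)" if "x \<in> carrier R" for x using ge[OF that] by (simp add: k_def)
  have "bij_betw k (emb R) (emb S)"
    unfolding k_def using bij_betw_inv_into[OF bR] h(1) bij_betw_embed[OF S] by (intro bij_betw_trans)
  moreover have "k (u + v) = k u + k v \<and> k (u * v) = k u * k v" if uv: "u \<in> emb R" "v \<in> emb R" for u v
  proof -
    obtain x y where xy: "x \<in> carrier R" "y \<in> carrier R" "u = embed R x" "v = embed R y"
      using uv by (auto simp: emb_def)
    show ?thesis
      using xy comm_rng_closed(3,4)[OF R xy(1,2)] hS
      by (simp add: ke h embed(2,3)[OF S] flip: embed(2,3)[OF R])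
  qed
  ultimately show ?thesis by (auto simp: subrng_isom_def)
qed

text \<open>A ring may have many invariants, depending on the chosen presentation or idempotent. A
  relation \<open>\<phi>\<close> suffices for which a shared value forces equivalence; one value is
  then picked for each class.\<close>

lemma card_quotient_le:
  assumes r: "equiv A r" and C: "finite C" and ex: "\<And>x. x \<in> A \<Longrightarrow> \<exists>t\<in>C. \<phi> x t"
    and rel: "\<And>x y t. x \<in> A \<Longrightarrow> y \<in> A \<Longrightarrow> t \<in> C \<Longrightarrow> \<phi> x t \<Longrightarrow> \<phi> y t \<Longrightarrow> (x, y) \<in> r"
  shows "finite (A // r)" "card (A // r) \<le> card C"
proof -
  define f where "f c = (SOME t. t \<in> C \<and> (\<exists>x\<in>c. \<phi> x t))" for c
  have f: "f c \<in> C \<and> (\<exists>x\<in>c. \<phi> x (f c))" if c: "c \<in> A // r" for c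
  proof -
    obtain x where x: "x \<in> A" "c = r `` {x}" using c by (auto elim: quotientE)
    then have "x \<in> c" using equiv_class_self[OF r] by auto
    then have "\<exists>t. t \<in> C \<and> (\<exists>x\<in>c. \<phi> x t)" using ex[OF x(1)] by blast
    then show ?thesis unfolding f_def by (rule someI_ex)
  qed
  have inj: "inj_on f (A // r)"
  proof (rule inj_onI)
    fix c d assume cd: "c \<in> A // r" "d \<in> A // r" "f c = f d"
    obtain x y where xy: "x \<in> c" "y \<in> d" "\<phi> x (f c)" "\<phi> y (f c)"
      using f[OF cd(1)] f[OF cd(2)] cd(3) by auto
    moreover have "x \<in> A" "y \<in> A" using xy cd in_quotient_imp_subset[OF r] by blast+
    ultimately have "(x, y) \<in> r" using f[OF cd(1)] by (intro rel) auto
    then show "c = d" using quotient_eqI[OF r cd(1,2) xy(1,2)] by simp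
  qed
  have "f ` (A // r) \<subseteq> C" using f by auto
  then show "finite (A // r)" "card (A // r) \<le> card C"
    using inj C by (auto intro: inj_on_finite card_inj_on_le)
qed

text \<open>Each ring is the direct product of the part on which its idempotent acts as identity and
  the part that it annihilates. The isomorphisms of the parts are added up; products across the
  parts vanish.\<close>

lemma subrng_isom_split:
  assumes A: "subrng (A::'a::comm_ring_1 set)" "e \<in> A" "e * e = e"
    and B: "subrng (B::'a set)" "d \<in> B" "d * d = d"
    and i1: "subrng_isom ((*) e ` A) ((*) d ` B)" and i2: "subrng_isom ((\<lambda>x. x - e * x) ` A) ((\<lambda>x. x - d * x) ` B)"
  shows "subrng_isom A B"
proof -
  let ?A1 = "(*) e ` A" and ?A2 = "(\<lambda>x. x - e * x) ` A" and ?B1 = "(*) d ` B" and ?B2 = "(\<lambda>x. x - d * x) ` B"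
  obtain f where f: "bij_betw f ?A1 ?B1"
    "\<And>u v. u \<in> ?A1 \<Longrightarrow> v \<in> ?A1 \<Longrightarrow> f (u + v) = f u + f v \<and> f (u * v) = f u * f v"
    using i1 unfolding subrng_isom_def by blast
  obtain g where g: "bij_betw g ?A2 ?B2"
    "\<And>u v. u \<in> ?A2 \<Longrightarrow> v \<in> ?A2 \<Longrightarrow> g (u + v) = g u + g v \<and> g (u * v) = g u * g v"
    using i2 unfolding subrng_isom_def by blast
  have ee: "e * (e * x) = e * x" "d * (d * x) = d * x" for x
    using A(3) B(3) by (simp_all add: mult.assoc[symmetric])
  have B1: "d * y = y" if "y \<in> ?B1" for y using that ee by auto
  have B2: "d * y = 0" if "y \<in> ?B2" for y using that ee by (auto simp: right_diff_distrib)
  have A1: "e * y = y" if "y \<in> ?A1" for y using that ee by auto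
  have A2: "e * y = 0" if "y \<in> ?A2" for y using that ee by (auto simp: right_diff_distrib)
  have BB: "y * z = 0" if "y \<in> ?B1" "z \<in> ?B2" for y z
    using B1[OF that(1)] B2[OF that(2)] by (metis mult.assoc mult.commute mult_zero_right)
  define h where "h x = f (e * x) + g (x - e * x)" for x
  have f1: "f (e * x) \<in> ?B1" if "x \<in> A" for x using f(1) that by (auto simp: bij_betw_def)
  have g2: "g (x - e * x) \<in> ?B2" if "x \<in> A" for x using g(1) that by (auto simp: bij_betw_def)
  have subA: "?A1 \<subseteq> A" "?A2 \<subseteq> A" using A by (auto simp: subrng_def intro: subgrp_diff)
  have subB: "?B1 \<subseteq> B" "?B2 \<subseteq> B" using B by (auto simp: subrng_def intro: subgrp_diff)
  have dh: "d * h x = f (e * x)" "h x - d * h x = g (x - e * x)" if "x \<in> A" for x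
    using B1[OF f1[OF that]] B2[OF g2[OF that]] by (simp_all add: h_def distrib_left)
  have "bij_betw h A B"
    unfolding bij_betw_def
  proof
    show "inj_on h A"
    proof (rule inj_onI)
      fix x y assume xy: "x \<in> A" "y \<in> A" "h x = h y"
      then have "f (e * x) = f (e * y)" "g (x - e * x) = g (y - e * y)"
        using dh[OF xy(1)] dh[OF xy(2)] by metis+
      then have "e * x = e * y" "x - e * x = y - e * y"
        using f(1) g(1) xy by (auto simp: bij_betw_def inj_on_def)
      then show "x = y" by simp
    qed
    show "h ` A = B"
    proof
      show "h ` A \<subseteq> B"
        using f1 g2 subB B(1) by (auto simp: h_def subrng_def intro!: subgrp_add)
      show "B \<subseteq> h ` A"
      proof
        fix y assume y: "y \<in> B"
        then obtain u where u: "u \<in> ?A1" "f u = d * y" using f(1) by (force simp: bij_betw_def)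
        from y have "y - d * y \<in> g ` ?A2" using g(1) by (simp add: bij_betw_def)
        then obtain v where v': "y - d * y = g v" "v \<in> ?A2" by (rule imageE)
        note v = v'(2) v'(1)[symmetric]
        have "h (u + v) = y" using A1[OF u(1)] A2[OF v(1)] u v by (simp add: h_def distrib_left)
        moreover have "u + v \<in> A" using u v subA A(1) by (auto simp: subrng_def intro!: subgrp_add)
        ultimately show "y \<in> h ` A" by blast
      qed
    qed
  qed
  moreover have "h (x + y) = h x + h y \<and> h (x * y) = h x * h y" if xy: "x \<in> A" "y \<in> A" for x y
  proof -
    have 1: "e * (x + y) = e * x + e * y" "x + y - e * (x + y) = (x - e * x) + (y - e * y)"
      by (simp_all add: algebra_simps)
    have 2: "e * (x * y) = (e * x) * (e * y)" "x * y - e * (x * y) = (x - e * x) * (y - e * y)"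
      using ee(1)[of "x * y"] by (simp_all add: algebra_simps)
    have fg: "f (e * x + e * y) = f (e * x) + f (e * y)" "f (e * x * (e * y)) = f (e * x) * f (e * y)"
      "g (x - e * x + (y - e * y)) = g (x - e * x) + g (y - e * y)"
      "g ((x - e * x) * (y - e * y)) = g (x - e * x) * g (y - e * y)"
      using f(2)[of "e * x" "e * y"] g(2)[of "x - e * x" "y - e * y"] xy by blast+
    have "h (x + y) = h x + h y"
      unfolding h_def 1(2) unfolding 1(1) fg by (simp only: ac_simps)
    moreover have "h (x * y) = f (e * x) * f (e * y) + g (x - e * x) * g (y - e * y)"
      unfolding h_def 2(2) unfolding 2(1) fg ..
    then have "h (x * y) = h x * h y"
      using BB[OF f1 g2, of x y] BB[OF f1 g2, of y x] xy by (simp add: h_def algebra_simps)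
    ultimately show ?thesis by simp
  qed
  ultimately show ?thesis by (auto simp: subrng_isom_def)
qed

lemma idempotent_parts:
  assumes A: "subrng (A::'a::comm_ring_1 set)" "e \<in> A" "e * e = e"
  shows "subrng ((*) e ` A)" "subrng ((\<lambda>x. x - e * x) ` A)"
    and "(*) e ` A \<subseteq> A" "(\<lambda>x. x - e * x) ` A \<subseteq> A"
    and "finite A \<Longrightarrow> card A = card ((*) e ` A) * card ((\<lambda>x. x - e * x) ` A)"
proof -
  have ee: "e * (e * x) = e * x" for x using A(3) by (simp add: mult.assoc[symmetric])
  have sg: "subgrp A" using A by (simp add: subrng_def)
  show "(*) e ` A \<subseteq> A" using A by (auto simp: subrng_def)
  show 2: "(\<lambda>x. x - e * x) ` A \<subseteq> A" using A by (auto simp: subrng_def intro: subgrp_diff)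
  have m: "(e * x) * (e * y) = e * (x * y)" for x y using ee[of "x * y"] by (simp add: algebra_simps)
  show "subrng ((*) e ` A)"
    using A subgrp_scale[OF sg] by (auto simp: subrng_def m)
  \<comment> \<open>With the identity of the ambient ring the complement is (1 - e) A and can be
    treated like e A, although 1 - e need not lie in \<open>A\<close>.\<close>
  have im: "(\<lambda>x. x - e * x) ` A = (*) (1 - e) ` A" by (auto simp: left_diff_distrib)
  have "(1 - e) * (1 - e) = 1 - e" using A(3) by (simp add: algebra_simps)
  then have ff: "(1 - e) * ((1 - e) * x) = (1 - e) * x" for x by (simp add: mult.assoc[symmetric])
  have m': "((1 - e) * x) * ((1 - e) * y) = (1 - e) * (x * y)" for x y
    using ff[of "x * y"] by (simp only: ac_simps)
  show "subrng ((\<lambda>x. x - e * x) ` A)"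
    unfolding im subrng_def using A subgrp_scale[OF sg] by (auto simp: subrng_def m')
  have "{x \<in> A. e * x = 0} = (\<lambda>x. x - e * x) ` A"
    using 2 ee by (auto simp: right_diff_distrib intro: image_eqI[of x _ x for x])
  then show "card A = card ((*) e ` A) * card ((\<lambda>x. x - e * x) ` A)" if "finite A"
    using card_hom_image[OF sg that, of "(*) e"] by (simp add: distrib_left)
qed

section \<open>A recursion for the number of isomorphism classes\<close>

abbreviation iso_classes :: "nat \<Rightarrow> nat ring set set"
  where "iso_classes N \<equiv> comm_rngs_of_card N // comm_rng_iso_rel N"

type_synonym invariant = "code + nat \<times> nat ring set \<times> nat ring set"

text \<open>
  An indecomposable ring has a code as invariant; a ring with a proper idempotent \<open>e\<close> has the order
  of \<open>e R\<close> and the isomorphism classes of \<open>e R\<close> and its complement.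
\<close>

definition has_invariant :: "nat \<Rightarrow> nat \<Rightarrow> nat \<Rightarrow> nat ring \<Rightarrow> invariant \<Rightarrow> bool"
  where "has_invariant p n T R t = (case t of
    Inl c \<Rightarrow> \<exists>s r a y. presentation p n T s r (emb R) a y \<and> c = code_of p n T s r a y
  | Inr (k, c, d) \<Rightarrow> \<exists>e S S'. e \<in> emb R \<and> e * e = e \<and>
      S \<in> comm_rngs_of_card (p ^ k) \<and> S' \<in> comm_rngs_of_card (p ^ (n - k)) \<and>
      c = comm_rng_iso_rel (p ^ k) `` {S} \<and> d = comm_rng_iso_rel (p ^ (n - k)) `` {S'} \<and>
      subrng_isom ((*) e ` emb R) (emb S) \<and> subrng_isom ((\<lambda>x. x - e * x) ` emb R) (emb S'))"

lemma has_invariant_exists: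
  assumes p: "Factorial_Ring.prime p" and T: "T > 0" "n \<le> T * T" and R: "R \<in> comm_rngs_of_card (p ^ n)"
  shows "\<exists>t \<in> codes p n T <+> (SIGMA k : {1..<n}. iso_classes (p ^ k) \<times> iso_classes (p ^ (n - k))).
    has_invariant p n T R t"
proof (cases "indecomposable (emb R)")
  note R' = emb_finite_card[OF R]
  case True
  then obtain s r a y where P: "presentation p n T s r (emb R) a y"
    using presentation_exists[OF R'(2,3) _ R'(4) p T] by blast
  then show ?thesis
    using code_of_mem[OF P p] by (intro bexI[of _ "Inl (code_of p n T s r a y)"]) (auto simp: has_invariant_def)
next
  note R' = emb_finite_card[OF R]
  case False
  then obtain e x where e: "e \<in> emb R" "e * e = e" "e \<noteq> 0" "x \<in> emb R" "e * x \<noteq> x"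
    by (auto simp: indecomposable_def)
  let ?A = "(*) e ` emb R" and ?B = "(\<lambda>x. x - e * x) ` emb R"
  note parts = idempotent_parts[OF R'(2) e(1,2)]
  have p1: "1 < p" using p by (rule prime_gt_1_nat)
  have fin: "finite ?A" "finite ?B" using R' by auto
  note sg = subrng_subgrp[OF R'(2)]
  obtain k where k: "card ?A = p ^ k"
    by (rule card_finite_subgrp_power[OF sg R'(3) p R'(4) subrng_subgrp[OF parts(1)] parts(3)])
  obtain l where l: "card ?B = p ^ l"
    by (rule card_finite_subgrp_power[OF sg R'(3) p R'(4) subrng_subgrp[OF parts(2)] parts(4)])
  have "p ^ n = p ^ (k + l)" using parts(5)[OF R'(3)] k l R'(4) by (simp add: power_add)
  then have n: "n = k + l" using p1 by (simp add: power_inject_exp)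
  \<comment> \<open>Both parts have at least two elements, so their exponents lie strictly between 0
    and \<open>n\<close> and the recursion only refers to smaller exponents.\<close>
  have "{0, e} \<subseteq> ?A"
    using e subgrp_zero[OF sg] by (auto intro: image_eqI[of _ _ 0] image_eqI[of _ _ e])
  then have "card {0, e} \<le> card ?A" using fin by (intro card_mono)
  then have "k \<noteq> 0" using e k by (intro notI) simp
  have "{0, x - e * x} \<subseteq> ?B"
    using e subgrp_zero[OF sg] by (auto intro: image_eqI[of _ _ 0])
  then have "card {0, x - e * x} \<le> card ?B" using fin by (intro card_mono)
  then have "l \<noteq> 0" using e(5) l by (intro notI) simp
  obtain S where S: "S \<in> comm_rngs_of_card (p ^ k)" "subrng_isom ?A (emb S)"
    using subrng_representative[OF parts(1) fin(1)] k by auto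
  obtain S' where S': "S' \<in> comm_rngs_of_card (p ^ (n - k))" "subrng_isom ?B (emb S')"
    using subrng_representative[OF parts(2) fin(2)] l n by auto
  let ?t = "Inr (k, comm_rng_iso_rel (p ^ k) `` {S}, comm_rng_iso_rel (p ^ (n - k)) `` {S'}) :: invariant"
  have "has_invariant p n T R ?t"
    unfolding has_invariant_def using e(1,2) S S' by auto
  moreover have "?t \<in> codes p n T <+> (SIGMA k : {1..<n}. iso_classes (p ^ k) \<times> iso_classes (p ^ (n - k)))"
    using S S' \<open>k \<noteq> 0\<close> \<open>l \<noteq> 0\<close> n by (auto intro!: quotientI)
  ultimately show ?thesis by blast
qed

lemma has_invariant_isom:
  assumes p: "Factorial_Ring.prime p"
    and R: "R \<in> comm_rngs_of_card (p ^ n)" and R': "R' \<in> comm_rngs_of_card (p ^ n)"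
    and t: "has_invariant p n T R t" "has_invariant p n T R' t"
  shows "(R, R') \<in> comm_rng_iso_rel (p ^ n)"
proof (rule comm_rng_iso_rel_emb[OF R R'])
  note E = emb_finite_card[OF R] and E' = emb_finite_card[OF R']
  show "subrng_isom (emb R) (emb R')"
  proof (cases t)
    case (Inl c)
    then show ?thesis using t code_of_isom[OF _ _ p] by (fastforce simp: has_invariant_def)
  next
    case (Inr u)
    obtain k c d where u: "u = (k, c, d)" by (cases u)
    obtain e S1 S2 where e: "e \<in> emb R" "e * e = e"
      and S: "S1 \<in> comm_rngs_of_card (p ^ k)" "S2 \<in> comm_rngs_of_card (p ^ (n - k))"
      "c = comm_rng_iso_rel (p ^ k) `` {S1}" "d = comm_rng_iso_rel (p ^ (n - k)) `` {S2}"
      "subrng_isom ((*) e ` emb R) (emb S1)" "subrng_isom ((\<lambda>x. x - e * x) ` emb R) (emb S2)"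
      using t(1) unfolding has_invariant_def Inr u by auto
    obtain e' S1' S2' where e': "e' \<in> emb R'" "e' * e' = e'"
      and S': "S1' \<in> comm_rngs_of_card (p ^ k)" "S2' \<in> comm_rngs_of_card (p ^ (n - k))"
      "c = comm_rng_iso_rel (p ^ k) `` {S1'}" "d = comm_rng_iso_rel (p ^ (n - k)) `` {S2'}"
      "subrng_isom ((*) e' ` emb R') (emb S1')" "subrng_isom ((\<lambda>x. x - e' * x) ` emb R') (emb S2')"
      using t(2) unfolding has_invariant_def Inr u by auto
    have class_isom: "subrng_isom (emb S) (emb S')"
      if "S \<in> comm_rngs_of_card N" "S' \<in> comm_rngs_of_card N"
        "comm_rng_iso_rel N `` {S} = comm_rng_iso_rel N `` {S'}" for S S' N
    proof -
      have "(S, S') \<in> comm_rng_iso_rel N"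
        using eq_equiv_class[OF that(3) equiv_comm_rng_iso_rel that(2)] .
      then show ?thesis
        using emb_isom[OF emb_finite_card(1)[OF that(1)] emb_finite_card(1)[OF that(2)]]
        by (auto simp: comm_rng_iso_rel_def)
    qed
    note parts = idempotent_parts[OF E'(2) e']
    show ?thesis
    proof (rule subrng_isom_split[OF E(2) e E'(2) e'])
      show "subrng_isom ((*) e ` emb R) ((*) e' ` emb R')"
        using subrng_isom_trans[OF S(5) subrng_isom_trans[OF class_isom[OF S(1) S'(1)]
          subrng_isom_sym[OF S'(5) parts(1)]]] S(3) S'(3) by simp
      show "subrng_isom ((\<lambda>x. x - e * x) ` emb R) ((\<lambda>x. x - e' * x) ` emb R')"
        using subrng_isom_trans[OF S(6) subrng_isom_trans[OF class_isom[OF S(2) S'(2)]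
          subrng_isom_sym[OF S'(6) parts(2)]]] S(4) S'(4) by simp
    qed
  qed
qed

text \<open>Finiteness is carried along because an infinite set has cardinality 0 in the formal
  sense, so that a bound on the cardinality alone would say nothing.\<close>

lemma num_comm_rngs_recursion:
  assumes p: "Factorial_Ring.prime p" and T: "T > 0" "n \<le> T * T"
    and fin: "\<And>k. 1 \<le> k \<Longrightarrow> k < n \<Longrightarrow> finite (iso_classes (p ^ k))"
  shows "finite (iso_classes (p ^ n))"
    and "num_comm_rngs (p ^ n) \<le> card (codes p n T) +
      (\<Sum>k\<in>{1..<n}. num_comm_rngs (p ^ k) * num_comm_rngs (p ^ (n - k)))"
proof -
  let ?S = "SIGMA k : {1..<n}. iso_classes (p ^ k) \<times> iso_classes (p ^ (n - k))"
  have fS: "finite ?S" using fin by (intro finite_SigmaI finite_cartesian_product) auto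
  then have C: "finite (codes p n T <+> ?S)" using finite_codes by simp
  note q = card_quotient_le[OF equiv_comm_rng_iso_rel C has_invariant_exists[OF p T] has_invariant_isom[OF p]]
  show "finite (iso_classes (p ^ n))" by (rule q(1))
  have "card (codes p n T <+> ?S) = card (codes p n T) + card ?S"
    using fS finite_codes by (intro card_Plus)
  also have "card ?S = (\<Sum>k\<in>{1..<n}. num_comm_rngs (p ^ k) * num_comm_rngs (p ^ (n - k)))"
    using fin by (subst card_SigmaI) (auto simp: num_comm_rngs_def card_cartesian_product)
  finally show "num_comm_rngs (p ^ n) \<le> card (codes p n T) +
      (\<Sum>k\<in>{1..<n}. num_comm_rngs (p ^ k) * num_comm_rngs (p ^ (n - k)))"
    using q(2) by (simp add: num_comm_rngs_def)
qed

section \<open>Numerical estimates for the upper bound\<close>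

lemma cubic_amgm: "27 * (s * r ^ 2) \<le> 4 * (s + r) ^ 3" if "s \<ge> 0" "r \<ge> 0" for s r :: real
proof -
  \<comment> \<open>The inequality of arithmetic and geometric means for s, r/2, r/2 as a polynomial
    identity. The square vanishes at r = 2 s, the ratio at which the lower bound is built.\<close>
  have "4 * (s + r) ^ 3 - 27 * (s * r ^ 2) = (r - 2 * s) ^ 2 * (4 * r + s)"
    by (simp add: power2_eq_square power3_eq_cube algebra_simps)
  also have "\<dots> \<ge> 0" using that by simp
  finally show ?thesis by simp
qed

text \<open>The constant 35 is 32 + 1 + 2. The first table has n (n + 1) (7 T + 1) digits, at most 2
  n^2 times 16 \<surd>n; the linear part of r (r + 1) / 2 contributes at most n^2; and there are at
  most p^(2 n) pairs (s, r).\<close>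

lemma card_codes_le:
  assumes p: "Factorial_Ring.prime p" and n: "n \<ge> 1" and T: "T = nat \<lceil>sqrt n\<rceil>"
  shows "real (card (codes p n T)) \<le> p powr (2 / 27 * real n ^ 3 + 35 * real n powr (5 / 2))"
proof -
  have p1: "1 < p" using p by (rule prime_gt_1_nat)
  define q where "q = real n powr (5 / 2)"
  have q: "q = real n ^ 2 * sqrt n"
    using n powr_add[of "real n" 2 "1 / 2"] by (simp add: q_def powr_half_sqrt)
  have sq: "1 \<le> sqrt n" using n by simp
  have nq: "real n ^ 2 \<le> q"
    using mult_left_mono[OF sq, of "real n ^ 2"] by (simp add: q)
  have nn: "real n \<le> real n ^ 2" using n by (simp add: power2_eq_square)
  have T2: "real T \<le> 2 * sqrt n"
    using sq unfolding T by linarith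
  have e: "real (n * ((7 * T + 1) * (n + 1)) + s * (r * (r + 1) div 2)) \<le> 2 / 27 * real n ^ 3 + 33 * q"
    if sr: "s + r \<le> n" for s r
  proof -
    have "real (n * ((7 * T + 1) * (n + 1))) = (real n * (real n + 1)) * (7 * real T + 1)"
      by (simp add: algebra_simps)
    also have "\<dots> \<le> (2 * real n ^ 2) * (16 * sqrt n)"
    proof (rule mult_mono)
      show "real n * (real n + 1) \<le> 2 * real n ^ 2" using nn by (simp add: power2_eq_square algebra_simps)
      show "7 * real T + 1 \<le> 16 * sqrt n" using T2 sq by linarith
    qed auto
    finally have 1: "real (n * ((7 * T + 1) * (n + 1))) \<le> 32 * q" by (simp add: q)
    have "real (s * (r * (r + 1) div 2)) = (real s * real r ^ 2 + real s * real r) / 2"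
      by (simp add: real_of_nat_div power2_eq_square algebra_simps)
    moreover have "27 * (real s * real r ^ 2) \<le> 4 * (real s + real r) ^ 3" by (rule cubic_amgm) auto
    moreover have "(real s + real r) ^ 3 \<le> real n ^ 3" using sr by (intro power_mono) auto
    moreover have "real s * real r \<le> real n * real n" using sr by (intro mult_mono) auto
    then have "real s * real r \<le> q" using nq by (simp add: power2_eq_square)
    moreover have "q \<ge> 0" by (simp add: q_def)
    ultimately have "real (s * (r * (r + 1) div 2)) \<le> 2 / 27 * real n ^ 3 + q" by argo
    then show ?thesis using 1 by simp
  qed
  let ?I = "{(s, r). s + r \<le> n}"
  have sub: "?I \<subseteq> {..n} \<times> {..n}" by auto
  have "real (card (codes p n T)) =
      (\<Sum>(s, r)\<in>?I. real p powr real (n * ((7 * T + 1) * (n + 1)) + s * (r * (r + 1) div 2)))"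
  proof -
    have "real (p ^ A * p ^ B) = real p powr real (A + B)" for A B
      using p1 by (simp add: powr_add powr_realpow)
    then show ?thesis unfolding card_codes of_nat_sum by (simp only: case_prod_beta')
  qed
  also have "\<dots> \<le> (\<Sum>(s, r)\<in>?I. real p powr (2 / 27 * real n ^ 3 + 33 * q))"
    by (intro sum_mono, clarify, intro powr_mono e) (use p1 in auto)
  also have "\<dots> = card ?I * real p powr (2 / 27 * real n ^ 3 + 33 * q)"
    by (simp add: case_prod_unfold)
  also have "\<dots> \<le> real p powr (2 * q) * real p powr (2 / 27 * real n ^ 3 + 33 * q)"
  proof (rule mult_right_mono)
    have "n + 1 \<le> 2 ^ n" using less_exp[of n] by (metis Suc_eq_plus1 Suc_leI)
    moreover have "card ?I \<le> (n + 1) * (n + 1)"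
      using card_mono[OF _ sub] by (simp add: card_cartesian_product)
    ultimately have "card ?I \<le> 2 ^ n * 2 ^ n" by (meson le_trans mult_le_mono)
    also have "\<dots> \<le> p ^ n * p ^ n" using p1 by (intro mult_mono power_mono) auto
    also have "\<dots> = p ^ (2 * n)" by (simp add: mult_2 power_add)
    finally have "real (card ?I) \<le> real (p ^ (2 * n))" using of_nat_le_iff by blast
    also have "\<dots> = real p powr (2 * real n)"
      using p1 powr_realpow[of p "2 * n"] by simp
    also have "\<dots> \<le> real p powr (2 * q)" using p1 order.trans[OF nn nq] by (intro powr_mono) simp_all
    finally show "real (card ?I) \<le> real p powr (2 * q)" .
  qed simp
  also have "\<dots> = real p powr (2 / 27 * real n ^ 3 + 35 * q)" by (simp add: powr_add[symmetric] add.commute)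
  finally show ?thesis by (simp add: q_def)
qed

text \<open>The summand n^2 in the exponent pays for the recursion. It makes the exponent F satisfy
  F k + F l \<le> F (k + l) - 2 k l, so the products of smaller counts add up to at most half of
  p^F(n); the bound for the codes lacks this summand and takes at most the other half.\<close>

lemma num_comm_rngs_upper:
  assumes p: "Factorial_Ring.prime p" and "n \<ge> 1"
  shows "finite (iso_classes (p ^ n)) \<and>
    real (num_comm_rngs (p ^ n)) \<le> p powr (2 / 27 * real n ^ 3 + 35 * real n powr (5 / 2) + real n ^ 2)"
  using \<open>n \<ge> 1\<close>
proof (induction n rule: less_induct)
  case (less n)
  have p1: "1 < p" using p by (rule prime_gt_1_nat)
  define F where "F x = 2 / 27 * x ^ 3 + 35 * x powr (5 / 2) + x ^ 2" for x :: real
  have IH: "finite (iso_classes (p ^ k))" "real (num_comm_rngs (p ^ k)) \<le> p powr F k" if "1 \<le> k" "k < n" for k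
    using less.IH[OF that(2,1)] by (simp_all add: F_def)
  let ?T = "nat \<lceil>sqrt n\<rceil>"
  have T: "?T > 0" "n \<le> ?T * ?T"
  proof -
    have "0 < sqrt n" using less.prems by simp
    then show "?T > 0" by linarith
    have "sqrt n \<le> real ?T" by linarith
    then have "sqrt n * sqrt n \<le> real ?T * real ?T"
      by (intro mult_mono real_sqrt_ge_zero of_nat_0_le_iff)
    then have "real n \<le> real (?T * ?T)" by simp
    then show "n \<le> ?T * ?T" using of_nat_le_iff by blast
  qed
  have super: "F k + F l \<le> F (k + l) - 2 * (k * l)" if "k > 0" "l > 0" for k l :: real
  proof -
    have "x powr (5 / 2) \<le> x * (k + l) powr (3 / 2)" if "x > 0" "x \<le> k + l" for x
      using that powr_add[of x 1 "3 / 2"] by (auto intro!: mult_left_mono powr_mono2)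
    then have "k powr (5 / 2) + l powr (5 / 2) \<le> k * (k + l) powr (3 / 2) + l * (k + l) powr (3 / 2)"
      using that by (intro add_mono) auto
    also have "\<dots> = (k + l) powr (5 / 2)"
      using that powr_add[of "k + l" 1 "3 / 2"] by (simp add: algebra_simps)
    finally have "k powr (5 / 2) + l powr (5 / 2) \<le> (k + l) powr (5 / 2)" .
    moreover have "k ^ 3 + l ^ 3 \<le> (k + l) ^ 3"
      using that by (simp add: power3_eq_cube algebra_simps)
    moreover have "(k + l) ^ 2 = k ^ 2 + l ^ 2 + 2 * (k * l)" by (simp add: power2_eq_square algebra_simps)
    ultimately show ?thesis unfolding F_def by argo
  qed
  have codes: "real (card (codes p n ?T)) \<le> real p powr F n / p"
  proof -
    have "real (card (codes p n ?T)) \<le> p powr (2 / 27 * real n ^ 3 + 35 * real n powr (5 / 2))"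
      by (rule card_codes_le[OF p less.prems refl])
    also have "\<dots> \<le> p powr (F n - 1)"
      using p1 less.prems by (intro powr_mono) (auto simp: F_def)
    finally show ?thesis using p1 by (simp add: powr_diff)
  qed
  have prods: "real (num_comm_rngs (p ^ k)) * real (num_comm_rngs (p ^ (n - k))) \<le> real p powr F n / p ^ n"
    if k: "k \<in> {1..<n}" for k
  proof -
    have "real (num_comm_rngs (p ^ k)) * real (num_comm_rngs (p ^ (n - k))) \<le> p powr F k * p powr F (n - k)"
      using k by (intro mult_mono IH) auto
    also have "\<dots> = p powr (F k + F (n - k))" by (simp add: powr_add)
    also have "\<dots> \<le> p powr (F n - n)"
    proof (rule powr_mono)
      \<comment> \<open>Since (k - 1) (n - k - 1) \<ge> 0, k (n - k) is at least n - 1; with n \<ge>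
        2 the gain 2 k (n - k) is at least n.\<close>
      have "1 * 1 \<le> (real k - 1) * (real (n - k) - 1) + 1" using k by simp
      then have "real n - 1 \<le> real k * real (n - k)" using k by (simp add: algebra_simps of_nat_diff)
      moreover have "real n \<ge> 2" using k by auto
      ultimately have "real n \<le> 2 * (real k * real (n - k))" by argo
      then show "F k + F (n - k) \<le> F n - n"
        using super[of k "n - k"] k by (simp add: of_nat_diff)
    qed (use p1 in auto)
    finally show ?thesis using p1 by (simp add: powr_diff powr_realpow)
  qed
  note rec = num_comm_rngs_recursion[OF p T IH(1)]
  have "real (num_comm_rngs (p ^ n)) \<le> real (card (codes p n ?T)) +
      (\<Sum>k\<in>{1..<n}. real (num_comm_rngs (p ^ k)) * real (num_comm_rngs (p ^ (n - k))))"
    using of_nat_mono[OF rec(2), where 'a = real] by simp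
  also have "\<dots> \<le> real p powr F n / p + (\<Sum>k\<in>{1..<n}. real p powr F n / p ^ n)"
    by (intro add_mono sum_mono codes prods)
  also have "\<dots> = real p powr F n * (1 / p + (real n - 1) / p ^ n)"
    using less.prems by (simp add: algebra_simps of_nat_diff)
  also have "\<dots> \<le> real p powr F n * (1 / 2 + 1 / 2)"
  proof (intro mult_left_mono add_mono)
    show "1 / real p \<le> 1 / 2" using p1 by (simp add: field_simps)
    obtain m where m: "n = Suc m" using less.prems by (cases n) auto
    have "m < 2 ^ m" by (rule less_exp)
    then have "2 * m \<le> 2 ^ n" by (simp add: m)
    also have "(2::nat) ^ n \<le> p ^ n" using p1 by (intro power_mono) auto
    finally have "real (2 * m) \<le> real (p ^ n)" using of_nat_le_iff by blast
    then show "(real n - 1) / real (p ^ n) \<le> 1 / 2" using p1 by (simp add: m field_simps)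
  qed auto
  finally show ?case using rec(1) by (simp add: F_def)
qed

section \<open>The lower bound\<close>

text \<open>A triple (k, j, i) addresses coordinate k of the product of the unit vectors i and j:
  these are the free structure constants of a symmetric product.\<close>

definition table_index :: "nat \<Rightarrow> nat \<Rightarrow> (nat \<times> nat \<times> nat) set"
  where "table_index n r = {r..<n} \<times> (SIGMA j : {..<r}. {..j})"

text \<open>Only entries with i \<le> j are stored; \<open>max\<close> and \<open>min\<close> find
  the entry for an unordered pair. Reduction modulo p is left to \<open>table_rng\<close>.\<close>

definition bilin :: "nat \<Rightarrow> (nat \<times> nat \<times> nat \<Rightarrow> nat) \<Rightarrow> nat \<Rightarrow> (nat \<Rightarrow> nat) \<Rightarrow> (nat \<Rightarrow> nat) \<Rightarrow> nat"
  where "bilin r c k u v = (\<Sum>i<r. \<Sum>j<r. c (k, max i j, min i j) * u i * v j)"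

text \<open>Products of the first \<open>r\<close> coordinates land in the last n - r, which
  annihilate everything. All triple products are therefore 0, and every table gives an associative
  ring.\<close>

definition table_rng :: "nat \<Rightarrow> nat \<Rightarrow> nat \<Rightarrow> (nat \<times> nat \<times> nat \<Rightarrow> nat) \<Rightarrow> (nat \<Rightarrow> nat) ring"
  where "table_rng p n r c = \<lparr>carrier = {..<n} \<rightarrow>\<^sub>E {..<p},
    mult = (\<lambda>u v. \<lambda>k\<in>{..<n}. if k < r then 0 else bilin r c k u v mod p),
    one = (\<lambda>_. 0), zero = (\<lambda>k\<in>{..<n}. 0), add = (\<lambda>u v. \<lambda>k\<in>{..<n}. (u k + v k) mod p)\<rparr>"

lemma bilin_commute: "bilin r c k u v = bilin r c k v u"
  unfolding bilin_def by (subst sum.swap) (simp add: max.commute min.commute mult.commute mult.left_commute)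

lemma bilin_zero: "(\<And>i. i < r \<Longrightarrow> u i = 0) \<Longrightarrow> bilin r c k u v = 0"
  by (simp add: bilin_def)

lemma bilin_cong: "(\<And>i. i < r \<Longrightarrow> [u i = u' i] (mod p)) \<Longrightarrow> [bilin r c k u v = bilin r c k u' v] (mod p)"
  unfolding bilin_def by (intro cong_sum cong_mult) auto

lemma bilin_add: "bilin r c k (\<lambda>i. u i + u' i) v = bilin r c k u v + bilin r c k u' v"
  by (simp add: bilin_def algebra_simps sum.distrib)

lemma bilin_unit:
  assumes "i < r" "j < r"
  shows "bilin r c k (\<lambda>l. if l = i then 1 else 0) (\<lambda>l. if l = j then 1 else 0) = c (k, max i j, min i j)"
proof -
  have "c (k, max a b, min a b) * (if a = i then 1 else 0) * (if b = j then 1 else 0)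
      = (if b = j then if a = i then c (k, max i j, min i j) else 0 else 0)" for a b
    by simp
  then show ?thesis using assms by (simp add: bilin_def)
qed

lemma comm_rng_table_rng:
  assumes p: "p > 0" and r: "r \<le> n"
  shows "comm_rng (table_rng p n r c)"
proof -
  let ?R = "table_rng p n r c"
  have "abelian_group ?R"
  proof (rule abelian_groupI)
    fix u assume "u \<in> carrier ?R"
    then have u: "u \<in> {..<n} \<rightarrow>\<^sub>E {..<p}" by (simp add: table_rng_def)
    let ?v = "\<lambda>k\<in>{..<n}. (p - u k) mod p"
    have "(?v k + u k) mod p = 0" if "k < n" for k
    proof -
      have "u k < p" using u that by auto
      then show ?thesis using that by (simp add: mod_add_left_eq)
    qed
    then show "\<exists>v\<in>carrier ?R. v \<oplus>\<^bsub>?R\<^esub> u = \<zero>\<^bsub>?R\<^esub>"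
      using p by (intro bexI[of _ ?v]) (auto simp: table_rng_def intro!: restrict_ext)
    have "(\<lambda>k\<in>{..<n}. u k) = u" using u by (simp add: PiE_restrict)
    moreover have "(\<lambda>k\<in>{..<n}. (0 + u k) mod p) = (\<lambda>k\<in>{..<n}. u k)"
      using u by (intro restrict_ext) (auto simp: PiE_def Pi_def)
    moreover have "\<zero>\<^bsub>?R\<^esub> \<oplus>\<^bsub>?R\<^esub> u = (\<lambda>k\<in>{..<n}. (0 + u k) mod p)"
      by (simp add: table_rng_def cong: restrict_cong)
    ultimately show "\<zero>\<^bsub>?R\<^esub> \<oplus>\<^bsub>?R\<^esub> u = u" by simp
  next
    fix u v w
    show "u \<oplus>\<^bsub>?R\<^esub> v \<in> carrier ?R" "\<zero>\<^bsub>?R\<^esub> \<in> carrier ?R"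
      using p by (simp_all add: table_rng_def restrict_PiE_iff)
    show "u \<oplus>\<^bsub>?R\<^esub> v \<oplus>\<^bsub>?R\<^esub> w = u \<oplus>\<^bsub>?R\<^esub> (v \<oplus>\<^bsub>?R\<^esub> w)"
      unfolding table_rng_def by (auto simp: mod_add_left_eq mod_add_right_eq add.assoc intro!: restrict_ext)
    show "u \<oplus>\<^bsub>?R\<^esub> v = v \<oplus>\<^bsub>?R\<^esub> u"
      unfolding table_rng_def by (simp add: add.commute)
  qed
  moreover have "rng_axioms ?R"
  proof (rule rng_axioms.intro)
    fix x y z
    show "x \<otimes>\<^bsub>?R\<^esub> y \<in> carrier ?R" using p by (simp add: table_rng_def restrict_PiE_iff)
    have mult: "u \<otimes>\<^bsub>?R\<^esub> v = (\<lambda>k\<in>{..<n}. if k < r then 0 else bilin r c k u v mod p)" for u v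
      by (simp add: table_rng_def)
    have "bilin r c k (u \<otimes>\<^bsub>?R\<^esub> v) w = 0" for k u v w
      by (rule bilin_zero) (use r in \<open>simp add: mult\<close>)
    then have "bilin r c k (x \<otimes>\<^bsub>?R\<^esub> y) z = bilin r c k x (y \<otimes>\<^bsub>?R\<^esub> z)" for k
      using bilin_commute[of r c k x] by simp
    then show "x \<otimes>\<^bsub>?R\<^esub> y \<otimes>\<^bsub>?R\<^esub> z = x \<otimes>\<^bsub>?R\<^esub> (y \<otimes>\<^bsub>?R\<^esub> z)"
      by (simp only: mult[of "x \<otimes>\<^bsub>?R\<^esub> y"] mult[of x "y \<otimes>\<^bsub>?R\<^esub> z"])
    have *: "bilin r c k (\<lambda>k\<in>{..<n}. (x k + y k) mod p) z mod p
        = (bilin r c k x z mod p + bilin r c k y z mod p) mod p" for k x y z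
    proof -
      have "[bilin r c k (\<lambda>k\<in>{..<n}. (x k + y k) mod p) z = bilin r c k (\<lambda>k. x k + y k) z] (mod p)"
        using r by (intro bilin_cong) (auto simp: cong_def)
      then show ?thesis by (simp add: cong_def bilin_add mod_add_eq)
    qed
    show "(x \<oplus>\<^bsub>?R\<^esub> y) \<otimes>\<^bsub>?R\<^esub> z = x \<otimes>\<^bsub>?R\<^esub> z \<oplus>\<^bsub>?R\<^esub> y \<otimes>\<^bsub>?R\<^esub> z"
      by (auto simp: table_rng_def * intro!: restrict_ext)
    show "z \<otimes>\<^bsub>?R\<^esub> (x \<oplus>\<^bsub>?R\<^esub> y) = z \<otimes>\<^bsub>?R\<^esub> x \<oplus>\<^bsub>?R\<^esub> z \<otimes>\<^bsub>?R\<^esub> y"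
      by (auto simp: table_rng_def * bilin_commute[of r c _ z] intro!: restrict_ext)
  qed
  moreover have "comm_rng_axioms ?R"
  proof
    fix x y
    have "bilin r c k x y = bilin r c k y x" for k by (rule bilin_commute)
    then show "x \<otimes>\<^bsub>?R\<^esub> y = y \<otimes>\<^bsub>?R\<^esub> x" by (simp add: table_rng_def cong: if_cong)
  qed
  ultimately show ?thesis by (simp add: comm_rng_def rng_def)
qed

text \<open>The vector \<open>u\<close> is reached by adding one unit vector at a time, by induction
  on the sum of its digits. The target \<open>R\<close> enters only through its addition, hence the
  separate hypothesis on the zero vector.\<close>

lemma table_rng_hom_eq:
  assumes p: "p > 1" and h: "\<And>u v. u \<in> carrier (table_rng p n r c) \<Longrightarrow> v \<in> carrier (table_rng p n r c) \<Longrightarrow>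
      h (u \<oplus>\<^bsub>table_rng p n r c\<^esub> v) = h u \<oplus>\<^bsub>R\<^esub> h v"
    and g: "\<And>u v. u \<in> carrier (table_rng p n r c) \<Longrightarrow> v \<in> carrier (table_rng p n r c) \<Longrightarrow>
      g (u \<oplus>\<^bsub>table_rng p n r c\<^esub> v) = g u \<oplus>\<^bsub>R\<^esub> g v"
    and 0: "h (\<lambda>k\<in>{..<n}. 0) = g (\<lambda>k\<in>{..<n}. 0)"
    and e: "\<And>i. i < n \<Longrightarrow> h (\<lambda>k\<in>{..<n}. if k = i then 1 else 0) = g (\<lambda>k\<in>{..<n}. if k = i then 1 else 0)"
    and u: "u \<in> carrier (table_rng p n r c)"
  shows "h u = g u"
proof -
  let ?S = "table_rng p n r c"
  have add: "h (\<lambda>k\<in>{..<n}. (u k + v k) mod p) = g (\<lambda>k\<in>{..<n}. (u k + v k) mod p)"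
    if "u \<in> carrier ?S" "v \<in> carrier ?S" "h u = g u" "h v = g v" for u v
    using h[OF that(1,2)] g[OF that(1,2)] that(3,4) by (simp add: table_rng_def)
  have "h u = g u" if "u \<in> {..<n} \<rightarrow>\<^sub>E {..<p}" for u
    using that
  proof (induction "\<Sum>k<n. u k" arbitrary: u)
    case 0
    then have u: "u = (\<lambda>k\<in>{..<n}. 0)" by (intro ext) (auto simp: PiE_def extensional_def)
    show ?case unfolding u by (rule assms(4))
  next
    case (Suc m)
    then obtain i where i: "i < n" "u i > 0" by (metis lessThan_iff neq0_conv sum.neutral Zero_not_Suc)
    let ?e = "\<lambda>k\<in>{..<n}. if k = i then 1 else 0" and ?w = "u(i := u i - 1)"
    have w: "?w \<in> {..<n} \<rightarrow>\<^sub>E {..<p}"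
      using Suc.prems i by (auto simp: PiE_def Pi_def extensional_def less_imp_diff_less)
    have "(\<Sum>k<n. u k) = u i + (\<Sum>k\<in>{..<n} - {i}. u k)" using i by (intro sum.remove) auto
    moreover have "(\<Sum>k<n. ?w k) = ?w i + (\<Sum>k\<in>{..<n} - {i}. ?w k)" using i by (intro sum.remove) auto
    moreover have "(\<Sum>k\<in>{..<n} - {i}. ?w k) = (\<Sum>k\<in>{..<n} - {i}. u k)" by (intro sum.cong) auto
    ultimately have "m = (\<Sum>k<n. ?w k)" using Suc.hyps(2) i by simp
    then have "h ?w = g ?w" using Suc.hyps(1) w by blast
    moreover have "?w \<in> carrier ?S" "?e \<in> carrier ?S"
      using w p by (simp_all add: table_rng_def restrict_PiE_iff)
    ultimately have "h (\<lambda>k\<in>{..<n}. (?w k + ?e k) mod p) = g (\<lambda>k\<in>{..<n}. (?w k + ?e k) mod p)"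
      by (intro add e i)
    moreover have "(\<lambda>k\<in>{..<n}. (?w k + ?e k) mod p) = u"
      using Suc.prems i by (intro ext) (auto simp: PiE_def extensional_def Pi_def)
    ultimately show ?case by simp
  qed
  then show ?thesis using u by (simp add: table_rng_def)
qed

text \<open>Products of unit vectors display the structure constants modulo \<open>p\<close>, and
  the entries of both tables are below \<open>p\<close>.\<close>

lemma table_rng_mult_inj:
  assumes p: "p > 1" and c: "c \<in> table_index n r \<rightarrow>\<^sub>E {..<p}" and d: "d \<in> table_index n r \<rightarrow>\<^sub>E {..<p}"
    and eq: "\<And>u v. u \<in> carrier (table_rng p n r c) \<Longrightarrow> v \<in> carrier (table_rng p n r c) \<Longrightarrow>
      u \<otimes>\<^bsub>table_rng p n r c\<^esub> v = u \<otimes>\<^bsub>table_rng p n r d\<^esub> v" and r: "r \<le> n"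
  shows "c = d"
proof (rule PiE_ext[OF c d])
  fix t assume t: "t \<in> table_index n r"
  then obtain k j i where kji: "t = (k, j, i)" "r \<le> k" "k < n" "j < r" "i \<le> j"
    by (auto simp: table_index_def)
  let ?e = "\<lambda>i. \<lambda>l\<in>{..<n}. if l = i then 1 else 0 :: nat"
  have ee: "bilin r c k (?e j) (?e i) = c t" for c
  proof -
    have "bilin r c k (?e j) (?e i) = bilin r c k (\<lambda>l. if l = j then 1 else 0) (\<lambda>l. if l = i then 1 else 0)"
      unfolding bilin_def using r by (intro sum.cong) auto
    also have "\<dots> = c t" using kji bilin_unit[of j r i c k] by (simp add: max_def min_def)
    finally show ?thesis .
  qed
  have "?e i \<in> carrier (table_rng p n r c)" for i using p by (auto simp: table_rng_def)
  then have "(?e j \<otimes>\<^bsub>table_rng p n r c\<^esub> ?e i) k = (?e j \<otimes>\<^bsub>table_rng p n r d\<^esub> ?e i) k"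
    using eq by metis
  then have "c t mod p = d t mod p" using kji ee[of c] ee[of d] by (simp add: table_rng_def)
  then show "c t = d t" using PiE_mem[OF c t] PiE_mem[OF d t] by simp
qed

text \<open>A table is recovered from its class together with an isomorphism from a fixed ring of
  that class. Such an isomorphism is determined by the images of the n unit vectors, each with at
  most p^n values, whence the factor p^(n n).\<close>

lemma num_comm_rngs_ge:
  assumes p: "p > 1" and r: "r \<le> n" and fin: "finite (iso_classes (p ^ n))"
  shows "p ^ ((n - r) * (r * (r + 1) div 2)) \<le> num_comm_rngs (p ^ n) * p ^ (n * n)"
proof -
  let ?Tab = "table_index n r \<rightarrow>\<^sub>E {..<p}" and ?R = "table_rng p n r" and ?V = "{..<n} \<rightarrow>\<^sub>E {..<p}"
  have V: "carrier (?R c) = ?V" "finite ?V" "card ?V = p ^ n" for c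
    by (auto simp: table_rng_def finite_PiE card_PiE)
  have comm: "comm_rng (?R c)" for c using p r by (intro comm_rng_table_rng) auto
  have "\<exists>S\<in>comm_rngs_of_card (p ^ n). rng_iso (?R c) S \<noteq> {}" for c
    using comm_rng_nat_representative[OF comm[of c]] V by simp
  then obtain S where S: "\<And>c. S c \<in> comm_rngs_of_card (p ^ n)" "\<And>c. rng_iso (?R c) (S c) \<noteq> {}"
    by metis
  define cl where "cl c = comm_rng_iso_rel (p ^ n) `` {S c}" for c
  have cl: "cl c \<in> iso_classes (p ^ n)" for c unfolding cl_def by (intro quotientI S)
  have iso: "rng_iso (?R c) (?R d) \<noteq> {}" if "cl c = cl d" for c d
  proof -
    have "(S c, S d) \<in> comm_rng_iso_rel (p ^ n)"
      using that eq_equiv_class[OF _ equiv_comm_rng_iso_rel S(1)] by (simp add: cl_def)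
    then obtain f where f: "f \<in> rng_iso (S c) (S d)" by (auto simp: comm_rng_iso_rel_def)
    obtain g where g: "g \<in> rng_iso (?R c) (S c)" using S(2) by blast
    obtain h where h: "h \<in> rng_iso (?R d) (S d)" using S(2) by blast
    have "rng (?R d)" using comm[of d] by (simp add: comm_rng_def)
    from rng_iso_trans[OF rng_iso_trans[OF g f] rng_iso_sym[OF this h]] show ?thesis by blast
  qed
  \<comment> \<open>The base table depends on the class only, so the isomorphisms chosen for all
    tables of a class have the same source.\<close>
  define base where "base C = (SOME c. cl c = C)" for C
  have base: "cl (base (cl c)) = cl c" for c unfolding base_def by (rule someI[where P = "\<lambda>d. cl d = cl c"]) simp
  have "\<exists>h. h \<in> rng_iso (?R (base (cl c))) (?R c)" for c using iso[OF base] by blast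
  then obtain h where h: "\<And>c. h c \<in> rng_iso (?R (base (cl c))) (?R c)" by metis
  define e where "e i = (\<lambda>k\<in>{..<n}. if k = i then 1 else 0 :: nat)" for i
  define \<Psi> where "\<Psi> c = (cl c, \<lambda>i\<in>{..<n}. h c (e i))" for c
  have hV: "bij_betw (h c) ?V ?V" for c using h[of c] by (simp add: rng_iso_iff V)
  have ev: "e i \<in> ?V" for i using p by (auto simp: e_def)
  have "inj_on \<Psi> ?Tab"
  proof (rule inj_onI)
    fix c d assume c: "c \<in> ?Tab" and d: "d \<in> ?Tab" and eq: "\<Psi> c = \<Psi> d"
    then have cd: "cl c = cl d" by (simp add: \<Psi>_def)
    let ?B = "?R (base (cl c))"
    have hc: "h c (u \<oplus>\<^bsub>?B\<^esub> v) = h c u \<oplus>\<^bsub>?R c\<^esub> h c v" "h c (u \<otimes>\<^bsub>?B\<^esub> v) = h c u \<otimes>\<^bsub>?R c\<^esub> h c v"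
      if "u \<in> ?V" "v \<in> ?V" for u v using h[of c] that by (auto simp: rng_iso_iff V)
    have hd: "h d (u \<oplus>\<^bsub>?B\<^esub> v) = h d u \<oplus>\<^bsub>?R c\<^esub> h d v" "h d (u \<otimes>\<^bsub>?B\<^esub> v) = h d u \<otimes>\<^bsub>?R d\<^esub> h d v"
      if "u \<in> ?V" "v \<in> ?V" for u v
    proof -
      \<comment> \<open>Addition does not depend on the table, so \<open>h c\<close> and
        \<open>h d\<close> are additive maps into the same group and can be compared on unit
        vectors.\<close>
      have "add (?R d) = add (?R c)" by (simp add: table_rng_def)
      then show "h d (u \<oplus>\<^bsub>?B\<^esub> v) = h d u \<oplus>\<^bsub>?R c\<^esub> h d v" "h d (u \<otimes>\<^bsub>?B\<^esub> v) = h d u \<otimes>\<^bsub>?R d\<^esub> h d v"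
        using h[of d] that by (auto simp: rng_iso_iff V cd)
    qed
    interpret C: comm_rng "?R c" by (rule comm)
    interpret B: comm_rng ?B by (rule comm)
    have z: "f \<zero>\<^bsub>?B\<^esub> = \<zero>\<^bsub>?R c\<^esub>" if f: "\<And>u v. u \<in> ?V \<Longrightarrow> v \<in> ?V \<Longrightarrow> f (u \<oplus>\<^bsub>?B\<^esub> v) = f u \<oplus>\<^bsub>?R c\<^esub> f v"
      "f ` ?V \<subseteq> ?V" for f
    proof -
      have zB: "\<zero>\<^bsub>?B\<^esub> \<in> ?V" using B.zero_closed by (simp add: V)
      then have "f \<zero>\<^bsub>?B\<^esub> = f \<zero>\<^bsub>?B\<^esub> \<oplus>\<^bsub>?R c\<^esub> f \<zero>\<^bsub>?B\<^esub>" using f(1)[OF zB zB] by simp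
      moreover have "f \<zero>\<^bsub>?B\<^esub> \<in> carrier (?R c)" using zB f(2) by (auto simp: V)
      ultimately show ?thesis using C.add.l_cancel_one' by metis
    qed
    have hh: "h c u = h d u" if u: "u \<in> ?V" for u
    proof (rule table_rng_hom_eq[OF p, where r = r and c = "base (cl c)" and R = "?R c" and h = "h c" and g = "h d"])
      show "h c (\<lambda>k\<in>{..<n}. if k = i then 1 else 0) = h d (\<lambda>k\<in>{..<n}. if k = i then 1 else 0)" if "i < n" for i
      proof -
        have "snd (\<Psi> c) i = snd (\<Psi> d) i" by (simp only: eq)
        then show ?thesis using that by (simp add: \<Psi>_def e_def)
      qed
      have "(\<lambda>k\<in>{..<n}. 0) = \<zero>\<^bsub>?B\<^esub>" by (simp add: table_rng_def)
      then show "h c (\<lambda>k\<in>{..<n}. 0) = h d (\<lambda>k\<in>{..<n}. 0)"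
        using z[of "h c"] z[of "h d"] hc hd hV by (simp add: bij_betw_def)
    qed (use hc hd u V in simp_all)
    show "c = d"
    proof (rule table_rng_mult_inj[OF p c d _ r])
      fix u v assume "u \<in> carrier (?R c)" "v \<in> carrier (?R c)"
      then have "u \<in> h c ` ?V" "v \<in> h c ` ?V" using hV[of c] by (simp_all add: V bij_betw_def)
      then obtain x y where xy: "x \<in> ?V" "y \<in> ?V" "u = h c x" "v = h c y" by blast
      have "x \<otimes>\<^bsub>?B\<^esub> y \<in> ?V" using B.m_closed xy by (simp add: V)
      then show "u \<otimes>\<^bsub>?R c\<^esub> v = u \<otimes>\<^bsub>?R d\<^esub> v"
        using xy hc(2)[OF xy(1,2)] hd(2)[OF xy(1,2)] hh by simp
    qed
  qed
  moreover have "\<Psi> ` ?Tab \<subseteq> iso_classes (p ^ n) \<times> ({..<n} \<rightarrow>\<^sub>E ?V)"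
  proof (rule image_subsetI)
    fix c
    have "h c (e i) \<in> ?V" for i using bij_betwE[OF hV] ev by blast
    then show "\<Psi> c \<in> iso_classes (p ^ n) \<times> ({..<n} \<rightarrow>\<^sub>E ?V)"
      by (simp add: \<Psi>_def cl restrict_PiE_iff del: PiE_restrict)
  qed
  moreover have "finite (iso_classes (p ^ n) \<times> ({..<n} \<rightarrow>\<^sub>E ?V))"
    using fin V by (intro finite_cartesian_product finite_PiE) auto
  ultimately have "card ?Tab \<le> card (iso_classes (p ^ n) \<times> ({..<n} \<rightarrow>\<^sub>E ?V))"
    by (rule card_inj_on_le)
  moreover have "finite (table_index n r)" by (auto simp: table_index_def)
  then have "card ?Tab = p ^ ((n - r) * (r * (r + 1) div 2))"
    by (simp add: card_PiE table_index_def card_cartesian_product card_triangle del: card_SigmaI)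
  ultimately show ?thesis
    by (simp add: card_cartesian_product card_PiE V power_mult num_comm_rngs_def)
qed

theorem theorem4p5:
  fixes p :: nat
  assumes "Factorial_Ring.prime p"
  shows "\<exists>\<delta> :: nat \<Rightarrow> real.
    (\<forall>n\<ge>1. real (num_comm_rngs (p ^ n)) = real p powr \<delta> n) \<and>
    (\<exists>C :: real. \<forall>n\<ge>1. \<bar>\<delta> n - 2 / 27 * real n ^ 3\<bar> \<le> C * real n powr (5 / 2))"
proof -
  have p1: "1 < p" using assms by (rule prime_gt_1_nat)
  define \<delta> where "\<delta> n = log p (num_comm_rngs (p ^ n))" for n
  \<comment> \<open>36 is the 35 of the upper bound plus 1 for n^2 \<le> n^(5/2); from below, an
    error of 2 n^2 is enough.\<close>
  have main: "real (num_comm_rngs (p ^ n)) = p powr \<delta> n \<and>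
      \<bar>\<delta> n - 2 / 27 * real n ^ 3\<bar> \<le> 36 * real n powr (5 / 2)" if n: "n \<ge> 1" for n
  proof -
    let ?N = "num_comm_rngs (p ^ n)"
    note up = num_comm_rngs_upper[OF assms n]
    have nq: "real n ^ 2 \<le> real n powr (5 / 2)"
      using n powr_mono[of 2 "5 / 2" "real n"] by simp
    \<comment> \<open>The maximiser of (n - r) r^2, rounded down; rounding loses at most 2/3, so r
      \<ge> 2 (n - 1) / 3.\<close>
    define r where "r = 2 * n div 3"
    have r: "r \<le> n" by (simp add: r_def)
    let ?E = "(n - r) * (r * (r + 1) div 2)"
    have lo: "p ^ ?E \<le> ?N * p ^ (n * n)" using num_comm_rngs_ge[OF p1 r] up by simp
    \<comment> \<open>The count must be nonzero for its logarithm to recover it.\<close>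
    then have pos: "?N > 0" using p1 by (intro gr0I) simp
    then have d: "real ?N = p powr \<delta> n" using p1 by (simp add: \<delta>_def)
    have "\<delta> n \<le> 2 / 27 * real n ^ 3 + 35 * real n powr (5 / 2) + real n ^ 2"
      using up p1 unfolding d by simp
    \<comment> \<open>Of the error 2 n^2, one n^2 is the factor p^(n n) for the additive maps;
      rounding of \<open>r\<close> costs at most 4/27 n^2.\<close>
    moreover have "2 / 27 * real n ^ 3 - 2 * real n ^ 2 \<le> \<delta> n"
    proof -
      have "p powr real ?E \<le> p powr (\<delta> n + real n ^ 2)"
      proof -
        have "p powr real ?E = real (p ^ ?E)" using p1 by (subst powr_realpow) auto
        also have "\<dots> \<le> real (?N * p ^ (n * n))" using lo of_nat_le_iff by blast
        also have "\<dots> = p powr \<delta> n * p powr real (n * n)" using p1 by (subst powr_realpow) (auto simp: d)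
        also have "\<dots> = p powr (\<delta> n + real n ^ 2)" by (simp add: powr_add power2_eq_square)
        finally show ?thesis .
      qed
      then have 1: "real ?E \<le> \<delta> n + real n ^ 2" using p1 by simp
      have "3 * r \<le> 2 * n" "2 * n \<le> 3 * r + 2" unfolding r_def by linarith+
      then have "3 * real r \<le> 2 * real n" "2 * real n \<le> 3 * real r + 2" by linarith+
      then have "real n / 3 \<le> real (n - r)" "2 / 3 * (real n - 1) \<le> real r"
        using r by (simp_all add: of_nat_diff)
      then have "real n / 3 * (2 / 3 * (real n - 1)) ^ 2 \<le> real (n - r) * real r ^ 2"
        using n by (intro mult_mono power_mono) auto
      also have "\<dots> \<le> real (n - r) * (real r * (real r + 1))"
        by (intro mult_left_mono) (auto simp: power2_eq_square algebra_simps)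
      also have "\<dots> = 2 * real ?E"
      proof -
        have "2 * real (r * (r + 1) div 2) = real r * (real r + 1)"
          by (simp add: real_of_nat_div algebra_simps)
        then show ?thesis unfolding of_nat_mult mult.left_commute[of 2] by simp
      qed
      finally have "real n / 3 * (2 / 3 * (real n - 1)) ^ 2 \<le> 2 * real ?E" .
      moreover have "real n / 3 * (2 / 3 * (real n - 1)) ^ 2 =
          4 / 27 * real n ^ 3 - 8 / 27 * real n ^ 2 + 4 / 27 * real n"
        by (simp add: power2_eq_square power3_eq_cube field_simps)
      moreover have "0 \<le> real n ^ 2" "0 \<le> real n" by simp_all
      ultimately show ?thesis using 1 by argo
    qed
    moreover have "0 \<le> real n ^ 2" by simp
    ultimately show ?thesis using d nq by (simp add: abs_le_iff)
  qed
  show ?thesis by (intro exI[of _ \<delta>] conjI exI[of _ 36]) (use main in auto)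
qed

end
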